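(* Let $\mathsf{T}$ be a big tensor-triangulated category which is canonically stratified (by a graded commutative Noetherian ring $R$). If $\mathcal{D}$ is a definable triangulated $\otimes$-ideal in $\mathsf{T}$, then $\mathcal{D}=\mathcal{D}^{d}$.
   Context: A big tensor-triangulated category is a compactly generated triangulated category $\mathsf{T}$ with a compatible closed symmetric monoidal structure (product $\otimes$, unit $\mathbb{1}$, internal hom $F$) whose compact objects $\mathsf{T}^{\mathrm{c}}$ coincide with its rigid objects ($X$ is rigid if $F(X,\mathbb{1})\otimes Y\to F(X,Y)$ is an isomorphism for all $Y$). A class is a $\otimes$-ideal if it is closed under $X\otimes-$ for all $X\in\mathsf{T}$; a localising $\otimes$-ideal is a triangulated $\otimes$-ideal closed under coproducts. Stratification (Benson--Iyengar--Krause): a graded commutative Noetherian ring $R$ acts canonically on $\mathsf{T}$ if there is a graded ring map $R\to\mathrm{End}^*_{\mathsf{T}}(\mathbb{1})$, inducing compatible maps $R\to\mathrm{End}^*_{\mathsf{T}}(X)$ via $-\otimes X$. $\mathrm{Spec}(R)$ is the set of homogeneous prime ideals. For $\mathcal{V}\subseteq\mathrm{Spec}(R)$ specialization closed, let $\mathsf{T}_{\mathcal{V}}=\{X:\mathrm{Hom}^*_{\mathsf{T}}(C,X)_{\mathfrak{p}}=0\ \forall C\in\mathsf{T}^{\mathrm{c}},\mathfrak{p}\notin\mathcal{V}\}$; this localising subcategory gives functorial triangles $\Gamma_{\mathcal{V}}X\to X\to L_{\mathcal{V}}X\to\Sigma\Gamma_{\mathcal{V}}X$ with $\Gamma_{\mathcal{V}}X\in\mathsf{T}_{\mathcal{V}}$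 and $L_{\mathcal{V}}X$ right orthogonal to $\mathsf{T}_{\mathcal{V}}$. For $\mathfrak{p}\in\mathrm{Spec}(R)$ set $\Gamma_{\mathfrak{p}}=\Gamma_{\mathcal{V}(\mathfrak{p})}L_{\mathcal{Z}(\mathfrak{p})}$ with $\mathcal{V}(\mathfrak{p})=\{\mathfrak{q}\supseteq\mathfrak{p}\}$, $\mathcal{Z}(\mathfrak{p})=\{\mathfrak{q}\not\subseteq\mathfrak{p}\}$. $\mathrm{supp}(X)=\{\mathfrak{p}:\Gamma_{\mathfrak{p}}X\not\simeq0\}$; $\mathrm{supp}$ of a subcategory is the union over its objects. $\mathsf{T}$ is canonically stratified by $R$ if for each $\mathfrak{p}$, $\Gamma_{\mathfrak{p}}\mathsf{T}$ contains no non-zero proper localising $\otimes$-ideals; equivalently $\mathrm{supp}$ is a bijection from localising $\otimes$-ideals of $\mathsf{T}$ to subsets of $\mathrm{supp}(\mathsf{T})$. A class $\mathcal{D}\subseteq\mathsf{T}$ is definable if there is a set of maps $f_i$ in $\mathsf{T}^{\mathrm{c}}$ with $\mathcal{D}=\{X:\mathrm{Hom}_{\mathsf{T}}(f_i,X)\text{ is surjective for all }i\}$. $(\mathsf{T}^{\mathrm{c}},\mathbf{Ab})^{\mathrm{fp}}$ is the category of finitely presented functors $G=\mathrm{coker}(\mathrm{Hom}_{\mathsf{T}}(f,-)|_{\mathsf{T}^{\mathrm{c}}})$, $f$ a map in $\mathsf{T}^{\mathrm{c}}$; $\widetilde{G}\colon\mathsf{T}\to\mathbf{Ab}$ is the same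 cokernel computed on $\mathsf{T}$. With $D=F(-,\mathbb{1})$, put $\mathcal{S}_{\mathcal{D}}=\{G:\widetilde{G}(X)=0\ \forall X\in\mathcal{D}\}$ and $(\delta G)(Y)=\mathrm{Hom}_{(\mathsf{T}^{\mathrm{c}},\mathbf{Ab})}(G,\mathrm{Hom}_{\mathsf{T}}(DY,-))$, an exact contravariant autoequivalence of $(\mathsf{T}^{\mathrm{c}},\mathbf{Ab})^{\mathrm{fp}}$. The dual definable category of $\mathcal{D}$ is $\mathcal{D}^{d}=\{Y\in\mathsf{T}:\widetilde{H}(Y)=0\ \forall H\in\delta\mathcal{S}_{\mathcal{D}}\}$. *)

theory Defs
  imports "HOL-Algebra.Ring_Divisibility" "HOL-Algebra.Elementary_Groups"
begin

unbundle cardinal_syntax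

section \<open>Small sets\<close>

text \<open>
  Objects and morphisms of a category form types, which may be large. The distinction between sets
  and classes is made by an uncountable strongly inaccessible cardinal: a collection counts as a set
  if its cardinality lies below it (a Grothendieck universe).
\<close>

definition inaccessible :: "'u rel \<Rightarrow> bool" where
  "inaccessible \<kappa> \<longleftrightarrow> Card_order \<kappa> \<and> natLeq <o \<kappa> \<and> regularCard \<kappa> \<and>
     (\<forall>A :: 'u set. |A| <o \<kappa> \<longrightarrow> |Pow A| <o \<kappa>)"

definition small :: "'u rel \<Rightarrow> 'a set \<Rightarrow> bool" where
  "small \<kappa> A \<longleftrightarrow> |A| <o \<kappa>"


section \<open>Categories\<close>

text \<open>
  Every element of the two types is an object, respectively a morphism; \<open>g \<cdot> f\<close> (first \<open>f\<close>, then
  \<open>g\<close>) is meaningful only for \<open>trg f = src g\<close>.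
\<close>

record ('o, 'm) cat =
  src :: "'m \<Rightarrow> 'o"
  trg :: "'m \<Rightarrow> 'o"
  idn :: "'o \<Rightarrow> 'm"
  cmp :: "'m \<Rightarrow> 'm \<Rightarrow> 'm" (infixl "\<cdot>\<index>" 70)

definition Mor :: "('o, 'm, 'z) cat_scheme \<Rightarrow> 'o \<Rightarrow> 'o \<Rightarrow> 'm set" where
  "Mor T X Y = {f. src T f = X \<and> trg T f = Y}"

locale category =
  fixes T :: "('o, 'm, 'z) cat_scheme" (structure)
  assumes idn_Mor: "idn T X \<in> Mor T X X"
    and cmp_Mor: "\<lbrakk>f \<in> Mor T X Y; g \<in> Mor T Y Z\<rbrakk> \<Longrightarrow> g \<cdot> f \<in> Mor T X Z"
    and idn_left: "f \<in> Mor T X Y \<Longrightarrow> idn T Y \<cdot> f = f"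
    and idn_right: "f \<in> Mor T X Y \<Longrightarrow> f \<cdot> idn T X = f"
    and cmp_assoc: "\<lbrakk>f \<in> Mor T W X; g \<in> Mor T X Y; h \<in> Mor T Y Z\<rbrakk>
      \<Longrightarrow> (h \<cdot> g) \<cdot> f = h \<cdot> (g \<cdot> f)"

definition inverse_of :: "('o, 'm, 'z) cat_scheme \<Rightarrow> 'm \<Rightarrow> 'm \<Rightarrow> bool" where
  "inverse_of T f g \<longleftrightarrow> g \<in> Mor T (trg T f) (src T f) \<and>
     g \<cdot>\<^bsub>T\<^esub> f = idn T (src T f) \<and> f \<cdot>\<^bsub>T\<^esub> g = idn T (trg T f)"

definition is_iso :: "('o, 'm, 'z) cat_scheme \<Rightarrow> 'm \<Rightarrow> bool" where
  "is_iso T f \<longleftrightarrow> (\<exists>g. inverse_of T f g)"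

definition inverse_mor :: "('o, 'm, 'z) cat_scheme \<Rightarrow> 'm \<Rightarrow> 'm" where
  "inverse_mor T f = (THE g. inverse_of T f g)"

definition Iso :: "('o, 'm, 'z) cat_scheme \<Rightarrow> 'o \<Rightarrow> 'o \<Rightarrow> 'm set" where
  "Iso T X Y = {f \<in> Mor T X Y. is_iso T f}"

definition isomorphic :: "('o, 'm, 'z) cat_scheme \<Rightarrow> 'o \<Rightarrow> 'o \<Rightarrow> bool" where
  "isomorphic T X Y \<longleftrightarrow> Iso T X Y \<noteq> {}"

definition is_coproduct ::
  "('o, 'm, 'z) cat_scheme \<Rightarrow> 'i set \<Rightarrow> ('i \<Rightarrow> 'o) \<Rightarrow> 'o \<Rightarrow> ('i \<Rightarrow> 'm) \<Rightarrow> bool" where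
  "is_coproduct T I A P \<iota> \<longleftrightarrow> (\<forall>i\<in>I. \<iota> i \<in> Mor T (A i) P) \<and>
     (\<forall>Y g. (\<forall>i\<in>I. g i \<in> Mor T (A i) Y) \<longrightarrow>
        (\<exists>!h. h \<in> Mor T P Y \<and> (\<forall>i\<in>I. h \<cdot>\<^bsub>T\<^esub> \<iota> i = g i)))"

text \<open>
  Each small set is equipotent to a small subset of the type that carries \<open>\<kappa>\<close>, so it suffices to take
  index sets there.
\<close>

definition has_small_coproducts :: "'u rel \<Rightarrow> ('o, 'm, 'z) cat_scheme \<Rightarrow> bool" where
  "has_small_coproducts \<kappa> T \<longleftrightarrow>
     (\<forall>(I :: 'u set) A. small \<kappa> I \<longrightarrow> (\<exists>P \<iota>. is_coproduct T I A P \<iota>))"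


section \<open>Triangulated categories\<close>

record ('o, 'm) tri_cat = "('o, 'm) cat" +
  zer :: "'o \<Rightarrow> 'o \<Rightarrow> 'm"
  plus_mor :: "'m \<Rightarrow> 'm \<Rightarrow> 'm" (infixl "\<boxplus>\<index>" 65)
  susO :: "'o \<Rightarrow> 'o"
  susM :: "'m \<Rightarrow> 'm"
  triangles :: "('m \<times> 'm \<times> 'm) set"

definition mor_group :: "('o, 'm, 'z) tri_cat_scheme \<Rightarrow> 'o \<Rightarrow> 'o \<Rightarrow> 'm monoid" where
  "mor_group T X Y = \<lparr>carrier = Mor T X Y, mult = plus_mor T, one = zer T X Y\<rparr>"

definition neg_mor :: "('o, 'm, 'z) tri_cat_scheme \<Rightarrow> 'm \<Rightarrow> 'm" where
  "neg_mor T f = m_inv (mor_group T (src T f) (trg T f)) f"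

definition zero_object :: "('o, 'm, 'z) tri_cat_scheme \<Rightarrow> 'o \<Rightarrow> bool" where
  "zero_object T Z \<longleftrightarrow> (\<forall>X. (\<exists>!f. f \<in> Mor T X Z) \<and> (\<exists>!f. f \<in> Mor T Z X))"

locale additive_category = category T
  for T :: "('o, 'm, 'z) tri_cat_scheme" (structure) +
  assumes mor_group_comm: "comm_group (mor_group T X Y)"
    and cmp_plus_right: "\<lbrakk>f \<in> Mor T X Y; g \<in> Mor T X Y; h \<in> Mor T Y Z\<rbrakk>
      \<Longrightarrow> h \<cdot> (f \<boxplus> g) = h \<cdot> f \<boxplus> h \<cdot> g"
    and cmp_plus_left: "\<lbrakk>h \<in> Mor T X Y; f \<in> Mor T Y Z; g \<in> Mor T Y Z\<rbrakk>
      \<Longrightarrow> (f \<boxplus> g) \<cdot> h = f \<cdot> h \<boxplus> g \<cdot> h"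
    and ex_zero_object: "\<exists>Z. zero_object T Z"
    and ex_biproduct: "\<exists>P i j p q.
      i \<in> Mor T X P \<and> j \<in> Mor T Y P \<and> p \<in> Mor T P X \<and> q \<in> Mor T P Y \<and>
      p \<cdot> i = idn T X \<and> q \<cdot> j = idn T Y \<and> q \<cdot> i = zer T X Y \<and> p \<cdot> j = zer T Y X \<and>
      i \<cdot> p \<boxplus> j \<cdot> q = idn T P"

text \<open>The suspension is an automorphism, so that its negative powers are defined strictly.\<close>

locale triangulated_category = additive_category T
  for T :: "('o, 'm, 'z) tri_cat_scheme" (structure) +
  assumes sus_Mor: "f \<in> Mor T X Y \<Longrightarrow> susM T f \<in> Mor T (susO T X) (susO T Y)"
    and sus_idn: "susM T (idn T X) = idn T (susO T X)"
    and sus_cmp: "\<lbrakk>f \<in> Mor T X Y; g \<in> Mor T Y Z\<rbrakk> \<Longrightarrow> susM T (g \<cdot> f) = susM T g \<cdot> susM T f"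
    and sus_plus: "\<lbrakk>f \<in> Mor T X Y; g \<in> Mor T X Y\<rbrakk> \<Longrightarrow> susM T (f \<boxplus> g) = susM T f \<boxplus> susM T g"
    and bij_susO: "bij (susO T)"
    and bij_susM: "bij (susM T)"
    and triangle_Mor: "(f, g, h) \<in> triangles T \<Longrightarrow>
      trg T f = src T g \<and> trg T g = src T h \<and> trg T h = susO T (src T f)"
    and triangle_iso: "\<lbrakk>(f, g, h) \<in> triangles T;
      f' \<in> Mor T X' Y'; g' \<in> Mor T Y' Z'; h' \<in> Mor T Z' (susO T X');
      u \<in> Iso T (src T f) X'; v \<in> Iso T (src T g) Y'; w \<in> Iso T (src T h) Z';
      v \<cdot> f = f' \<cdot> u; w \<cdot> g = g' \<cdot> v; susM T u \<cdot> h = h' \<cdot> w\<rbrakk> \<Longrightarrow> (f', g', h') \<in> triangles T"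
    and triangle_idn: "zero_object T Z \<Longrightarrow>
      (idn T X, zer T X Z, zer T Z (susO T X)) \<in> triangles T"
    and triangle_ex: "\<exists>g h. (f, g, h) \<in> triangles T"
    and triangle_rotate: "\<lbrakk>f \<in> Mor T X Y; g \<in> Mor T Y Z; h \<in> Mor T Z (susO T X)\<rbrakk> \<Longrightarrow>
      (f, g, h) \<in> triangles T \<longleftrightarrow> (g, h, neg_mor T (susM T f)) \<in> triangles T"
    and triangle_fill: "\<lbrakk>(f, g, h) \<in> triangles T; (f', g', h') \<in> triangles T;
      u \<in> Mor T (src T f) (src T f'); v \<in> Mor T (src T g) (src T g'); v \<cdot> f = f' \<cdot> u\<rbrakk>
      \<Longrightarrow> \<exists>w \<in> Mor T (src T h) (src T h'). w \<cdot> g = g' \<cdot> v \<and> susM T u \<cdot> h = h' \<cdot> w"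
    and octahedral: "\<lbrakk>trg T f = src T g; (f, f', f'') \<in> triangles T; (g, g', g'') \<in> triangles T;
      (g \<cdot> f, h', h'') \<in> triangles T\<rbrakk> \<Longrightarrow>
      \<exists>a \<in> Mor T (src T f'') (src T h''). \<exists>b \<in> Mor T (src T h'') (src T g'').
        (a, b, susM T f' \<cdot> g'') \<in> triangles T \<and>
        a \<cdot> f' = h' \<cdot> g \<and> h'' \<cdot> a = f'' \<and> b \<cdot> h' = g' \<and> g'' \<cdot> b = susM T f \<cdot> h''"

definition powO :: "('o, 'm, 'z) tri_cat_scheme \<Rightarrow> int \<Rightarrow> 'o \<Rightarrow> 'o" where
  "powO T n = (if 0 \<le> n then susO T ^^ nat n else the_inv (susO T) ^^ nat (- n))"

definition powM :: "('o, 'm, 'z) tri_cat_scheme \<Rightarrow> int \<Rightarrow> 'm \<Rightarrow> 'm" where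
  "powM T n = (if 0 \<le> n then susM T ^^ nat n else the_inv (susM T) ^^ nat (- n))"

text \<open>
  An object \<open>C\<close> is compact if the canonical map \<open>\<Oplus>\<^sub>i Hom(C, A\<^sub>i) \<rightarrow> Hom(C, \<Coprod>\<^sub>i A\<^sub>i)\<close> is bijective.
  The families \<open>c\<close> below are the elements of the direct sum; \<^const>\<open>finprod\<close> is the sum in the additively
  understood group \<^const>\<open>mor_group\<close>.
\<close>

definition compacts :: "'u rel \<Rightarrow> ('o, 'm, 'z) tri_cat_scheme \<Rightarrow> 'o set" where
  "compacts \<kappa> T = {C. \<forall>(I :: 'u set) A P \<iota>. small \<kappa> I \<and> is_coproduct T I A P \<iota> \<longrightarrow>
     (\<forall>f \<in> Mor T C P. \<exists>!c. c \<in> (\<Pi>\<^sub>E i\<in>I. Mor T C (A i)) \<and> finite {i \<in> I. c i \<noteq> zer T C (A i)} \<and>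
        f = finprod (mor_group T C P) (\<lambda>i. \<iota> i \<cdot>\<^bsub>T\<^esub> c i) {i \<in> I. c i \<noteq> zer T C (A i)})}"

definition compactly_generated :: "'u rel \<Rightarrow> ('o, 'm, 'z) tri_cat_scheme \<Rightarrow> bool" where
  "compactly_generated \<kappa> T \<longleftrightarrow> (\<forall>X Y. small \<kappa> (Mor T X Y)) \<and> has_small_coproducts \<kappa> T \<and>
     (\<exists>\<G> \<subseteq> compacts \<kappa> T. small \<kappa> \<G> \<and>
        (\<forall>X. (\<forall>C\<in>\<G>. \<forall>n. Mor T (powO T n C) X = {zer T (powO T n C) X}) \<longrightarrow> zero_object T X))"

definition triangulated_subcategory :: "('o, 'm, 'z) tri_cat_scheme \<Rightarrow> 'o set \<Rightarrow> bool" where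
  "triangulated_subcategory T S \<longleftrightarrow> (\<forall>Z. zero_object T Z \<longrightarrow> Z \<in> S) \<and> (\<forall>X. susO T X \<in> S \<longleftrightarrow> X \<in> S) \<and>
     (\<forall>(f, g, h) \<in> triangles T.
        (src T f \<in> S \<and> src T g \<in> S \<longrightarrow> src T h \<in> S) \<and>
        (src T g \<in> S \<and> src T h \<in> S \<longrightarrow> src T f \<in> S) \<and>
        (src T f \<in> S \<and> src T h \<in> S \<longrightarrow> src T g \<in> S))"

definition coproduct_closed :: "'u rel \<Rightarrow> ('o, 'm, 'z) cat_scheme \<Rightarrow> 'o set \<Rightarrow> bool" where
  "coproduct_closed \<kappa> T S \<longleftrightarrow> (\<forall>(I :: 'u set) A P \<iota>.
     small \<kappa> I \<and> is_coproduct T I A P \<iota> \<and> (\<forall>i\<in>I. A i \<in> S) \<longrightarrow> P \<in> S)"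


section \<open>Big tensor-triangulated categories\<close>

text \<open>
  \<open>ev X Y\<close> is the counit \<open>F(X, Y) \<otimes> X \<rightarrow> Y\<close> of the tensor-hom adjunction and \<open>tsus X Y\<close> the isomorphism
  \<open>\<Sigma>X \<otimes> Y \<rightarrow> \<Sigma>(X \<otimes> Y)\<close>.
\<close>

record ('o, 'm) tt_cat = "('o, 'm) tri_cat" +
  tenO :: "'o \<Rightarrow> 'o \<Rightarrow> 'o" (infixl "\<boxtimes>\<index>" 75)
  tenM :: "'m \<Rightarrow> 'm \<Rightarrow> 'm" (infixl "\<diamondop>\<index>" 75)
  unit :: 'o
  assc :: "'o \<Rightarrow> 'o \<Rightarrow> 'o \<Rightarrow> 'm"
  lunit :: "'o \<Rightarrow> 'm"
  runit :: "'o \<Rightarrow> 'm"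
  swap :: "'o \<Rightarrow> 'o \<Rightarrow> 'm"
  ihom :: "'o \<Rightarrow> 'o \<Rightarrow> 'o"
  ev :: "'o \<Rightarrow> 'o \<Rightarrow> 'm"
  tsus :: "'o \<Rightarrow> 'o \<Rightarrow> 'm"

locale symmetric_monoidal_category = category T
  for T :: "('o, 'm, 'z) tt_cat_scheme" (structure) +
  assumes ten_Mor: "\<lbrakk>f \<in> Mor T X X'; g \<in> Mor T Y Y'\<rbrakk> \<Longrightarrow> f \<diamondop> g \<in> Mor T (X \<boxtimes> Y) (X' \<boxtimes> Y')"
    and ten_idn: "idn T X \<diamondop> idn T Y = idn T (X \<boxtimes> Y)"
    and ten_cmp: "\<lbrakk>f \<in> Mor T X X'; f' \<in> Mor T X' X''; g \<in> Mor T Y Y'; g' \<in> Mor T Y' Y''\<rbrakk>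
      \<Longrightarrow> (f' \<cdot> f) \<diamondop> (g' \<cdot> g) = (f' \<diamondop> g') \<cdot> (f \<diamondop> g)"
    and assc_Iso: "assc T X Y Z \<in> Iso T ((X \<boxtimes> Y) \<boxtimes> Z) (X \<boxtimes> (Y \<boxtimes> Z))"
    and assc_nat: "\<lbrakk>f \<in> Mor T X X'; g \<in> Mor T Y Y'; h \<in> Mor T Z Z'\<rbrakk>
      \<Longrightarrow> assc T X' Y' Z' \<cdot> ((f \<diamondop> g) \<diamondop> h) = (f \<diamondop> (g \<diamondop> h)) \<cdot> assc T X Y Z"
    and lunit_Iso: "lunit T X \<in> Iso T (unit T \<boxtimes> X) X"
    and lunit_nat: "f \<in> Mor T X X' \<Longrightarrow> lunit T X' \<cdot> (idn T (unit T) \<diamondop> f) = f \<cdot> lunit T X"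
    and runit_Iso: "runit T X \<in> Iso T (X \<boxtimes> unit T) X"
    and runit_nat: "f \<in> Mor T X X' \<Longrightarrow> runit T X' \<cdot> (f \<diamondop> idn T (unit T)) = f \<cdot> runit T X"
    and swap_Mor: "swap T X Y \<in> Mor T (X \<boxtimes> Y) (Y \<boxtimes> X)"
    and swap_nat: "\<lbrakk>f \<in> Mor T X X'; g \<in> Mor T Y Y'\<rbrakk>
      \<Longrightarrow> swap T X' Y' \<cdot> (f \<diamondop> g) = (g \<diamondop> f) \<cdot> swap T X Y"
    and swap_swap: "swap T Y X \<cdot> swap T X Y = idn T (X \<boxtimes> Y)"
    and pentagon: "assc T W X (Y \<boxtimes> Z) \<cdot> assc T (W \<boxtimes> X) Y Z =
      (idn T W \<diamondop> assc T X Y Z) \<cdot> assc T W (X \<boxtimes> Y) Z \<cdot> (assc T W X Y \<diamondop> idn T Z)"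
    and unit_triangle: "(idn T X \<diamondop> lunit T Y) \<cdot> assc T X (unit T) Y = runit T X \<diamondop> idn T Y"
    and hexagon: "assc T Y Z X \<cdot> swap T X (Y \<boxtimes> Z) \<cdot> assc T X Y Z =
      (idn T Y \<diamondop> swap T X Z) \<cdot> assc T Y X Z \<cdot> (swap T X Y \<diamondop> idn T Z)"

locale closed_symmetric_monoidal_category = symmetric_monoidal_category T
  for T :: "('o, 'm, 'z) tt_cat_scheme" (structure) +
  assumes ev_Mor: "ev T X Y \<in> Mor T (ihom T X Y \<boxtimes> X) Y"
    and ev_universal: "f \<in> Mor T (A \<boxtimes> X) Y \<Longrightarrow>
      \<exists>!g. g \<in> Mor T A (ihom T X Y) \<and> ev T X Y \<cdot> (g \<diamondop> idn T X) = f"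

definition transpose :: "('o, 'm, 'z) tt_cat_scheme \<Rightarrow> 'o \<Rightarrow> 'o \<Rightarrow> 'o \<Rightarrow> 'm \<Rightarrow> 'm" where
  "transpose T A X Y f =
     (THE g. g \<in> Mor T A (ihom T X Y) \<and> ev T X Y \<cdot>\<^bsub>T\<^esub> (g \<diamondop>\<^bsub>T\<^esub> idn T X) = f)"

text \<open>\<open>F(u, v) : F(X, Y) \<rightarrow> F(X', Y')\<close> for \<open>u : X' \<rightarrow> X\<close> and \<open>v : Y \<rightarrow> Y'\<close>.\<close>

definition ihomM :: "('o, 'm, 'z) tt_cat_scheme \<Rightarrow> 'm \<Rightarrow> 'm \<Rightarrow> 'm" where
  "ihomM T u v = (let X = trg T u; Y = src T v in
     transpose T (ihom T X Y) (src T u) (trg T v)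
       (v \<cdot>\<^bsub>T\<^esub> ev T X Y \<cdot>\<^bsub>T\<^esub> (idn T (ihom T X Y) \<diamondop>\<^bsub>T\<^esub> u)))"

definition dualO :: "('o, 'm, 'z) tt_cat_scheme \<Rightarrow> 'o \<Rightarrow> 'o" where
  "dualO T X = ihom T X (unit T)"

definition dualM :: "('o, 'm, 'z) tt_cat_scheme \<Rightarrow> 'm \<Rightarrow> 'm" where
  "dualM T u = ihomM T u (idn T (unit T))"

text \<open>
  Compatibility in the sense of Hovey, Palmieri and Strickland. Graded commutativity of the
  isomorphisms \<open>\<Sigma>\<^sup>r\<one> \<otimes> \<Sigma>\<^sup>s\<one> \<rightarrow> \<Sigma>\<^sup>r\<^sup>+\<^sup>s\<one>\<close> is required for \<open>r = s = 1\<close>, from which the general case follows.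
  In exactness of \<open>F(-, W)\<close> "up to sign", the sign is absorbed by the isomorphism \<open>t\<close>.
\<close>

locale tensor_triangulated_category =
  triangulated_category T + closed_symmetric_monoidal_category T
  for T :: "('o, 'm, 'z) tt_cat_scheme" (structure) +
  assumes tsus_Iso: "tsus T X Y \<in> Iso T (susO T X \<boxtimes> Y) (susO T (X \<boxtimes> Y))"
    and tsus_nat: "\<lbrakk>f \<in> Mor T X X'; g \<in> Mor T Y Y'\<rbrakk>
      \<Longrightarrow> tsus T X' Y' \<cdot> (susM T f \<diamondop> g) = susM T (f \<diamondop> g) \<cdot> tsus T X Y"
    and tsus_runit: "susM T (runit T X) \<cdot> tsus T X (unit T) = runit T (susO T X)"
    and tsus_assc: "susM T (assc T X Y Z) \<cdot> tsus T (X \<boxtimes> Y) Z \<cdot> (tsus T X Y \<diamondop> idn T Z) =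
      tsus T X (Y \<boxtimes> Z) \<cdot> assc T (susO T X) Y Z"
    and ten_exact: "(f, g, h) \<in> triangles T \<Longrightarrow>
      (f \<diamondop> idn T W, g \<diamondop> idn T W, tsus T (src T f) W \<cdot> (h \<diamondop> idn T W)) \<in> triangles T"
    and ihom_exact_right: "\<exists>s. (\<forall>X. s X \<in> Iso T (ihom T W (susO T X)) (susO T (ihom T W X))) \<and>
      (\<forall>X Y. \<forall>u \<in> Mor T X Y.
         s Y \<cdot> ihomM T (idn T W) (susM T u) = susM T (ihomM T (idn T W) u) \<cdot> s X) \<and>
      (\<forall>(f, g, h) \<in> triangles T.
         (ihomM T (idn T W) f, ihomM T (idn T W) g, s (src T f) \<cdot> ihomM T (idn T W) h) \<in> triangles T)"
    and ihom_exact_left: "\<exists>t. (\<forall>X. t X \<in> Iso T (ihom T X W) (susO T (ihom T (susO T X) W))) \<and>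
      (\<forall>X Y. \<forall>u \<in> Mor T X Y.
         t X \<cdot> ihomM T u (idn T W) = susM T (ihomM T (susM T u) (idn T W)) \<cdot> t Y) \<and>
      (\<forall>(f, g, h) \<in> triangles T.
         (ihomM T g (idn T W), ihomM T f (idn T W),
            susM T (ihomM T h (idn T W)) \<cdot> t (src T f)) \<in> triangles T)"
    and swap_sus_unit: "swap T (susO T (unit T)) (susO T (unit T)) =
      neg_mor T (idn T (susO T (unit T) \<boxtimes> susO T (unit T)))"

text \<open>The canonical map \<open>F(X, \<one>) \<otimes> Y \<rightarrow> F(X, Y)\<close>.\<close>

definition rigid_map :: "('o, 'm, 'z) tt_cat_scheme \<Rightarrow> 'o \<Rightarrow> 'o \<Rightarrow> 'm" where
  "rigid_map T X Y = transpose T (dualO T X \<boxtimes>\<^bsub>T\<^esub> Y) X Y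
     (lunit T Y \<cdot>\<^bsub>T\<^esub> (ev T X (unit T) \<diamondop>\<^bsub>T\<^esub> idn T Y) \<cdot>\<^bsub>T\<^esub> inverse_mor T (assc T (dualO T X) X Y)
        \<cdot>\<^bsub>T\<^esub> (idn T (dualO T X) \<diamondop>\<^bsub>T\<^esub> swap T Y X) \<cdot>\<^bsub>T\<^esub> assc T (dualO T X) Y X)"

definition rigids :: "('o, 'm, 'z) tt_cat_scheme \<Rightarrow> 'o set" where
  "rigids T = {X. \<forall>Y. is_iso T (rigid_map T X Y)}"

locale big_tt_category = tensor_triangulated_category T
  for \<kappa> :: "'u rel" and T :: "('o, 'm, 'z) tt_cat_scheme" (structure) +
  assumes inaccessible: "inaccessible \<kappa>"
    and compactly_generated: "compactly_generated \<kappa> T"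
    and compacts_eq_rigids: "compacts \<kappa> T = rigids T"

definition tensor_ideal :: "('o, 'm, 'z) tt_cat_scheme \<Rightarrow> 'o set \<Rightarrow> bool" where
  "tensor_ideal T S \<longleftrightarrow> (\<forall>X. \<forall>Y\<in>S. X \<boxtimes>\<^bsub>T\<^esub> Y \<in> S)"

definition localising_ideal :: "'u rel \<Rightarrow> ('o, 'm, 'z) tt_cat_scheme \<Rightarrow> 'o set \<Rightarrow> bool" where
  "localising_ideal \<kappa> T L \<longleftrightarrow>
     triangulated_subcategory T L \<and> tensor_ideal T L \<and> coproduct_closed \<kappa> T L"


section \<open>Graded rings and their homogeneous primes\<close>

text \<open>\<open>gr i\<close> is the set of homogeneous elements of degree \<open>i\<close> (including zero).\<close>

definition homogeneous_family ::
  "('r, 'b) ring_scheme \<Rightarrow> (int \<Rightarrow> 'r set) \<Rightarrow> (int \<Rightarrow> 'r) \<Rightarrow> bool" where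
  "homogeneous_family R gr c \<longleftrightarrow> (\<forall>i. c i \<in> gr i) \<and> finite {i. c i \<noteq> \<zero>\<^bsub>R\<^esub>}"

definition family_sum :: "('r, 'b) ring_scheme \<Rightarrow> (int \<Rightarrow> 'r) \<Rightarrow> 'r" where
  "family_sum R c = finsum R c {i. c i \<noteq> \<zero>\<^bsub>R\<^esub>}"

locale graded_commutative_ring = ring R
  for R :: "('r, 'b) ring_scheme" (structure) and gr :: "int \<Rightarrow> 'r set" +
  assumes gr_subgroup: "subgroup (gr i) (add_monoid R)"
    and gr_decomposition: "x \<in> carrier R \<Longrightarrow> \<exists>!c. homogeneous_family R gr c \<and> x = family_sum R c"
    and gr_one: "\<one> \<in> gr 0"
    and gr_mult: "\<lbrakk>a \<in> gr i; b \<in> gr j\<rbrakk> \<Longrightarrow> a \<otimes> b \<in> gr (i + j)"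
    and gr_commute: "\<lbrakk>a \<in> gr i; b \<in> gr j\<rbrakk> \<Longrightarrow> a \<otimes> b = (if even (i * j) then b \<otimes> a else \<ominus> (b \<otimes> a))"

definition homogeneous_ideal :: "('r, 'b) ring_scheme \<Rightarrow> (int \<Rightarrow> 'r set) \<Rightarrow> 'r set \<Rightarrow> bool" where
  "homogeneous_ideal R gr I \<longleftrightarrow> ideal I R \<and>
     (\<forall>c. homogeneous_family R gr c \<and> family_sum R c \<in> I \<longrightarrow> (\<forall>i. c i \<in> I))"

definition Spec :: "('r, 'b) ring_scheme \<Rightarrow> (int \<Rightarrow> 'r set) \<Rightarrow> 'r set set" where
  "Spec R gr = {p. homogeneous_ideal R gr p \<and> p \<noteq> carrier R \<and>
     (\<forall>i j. \<forall>a \<in> gr i. \<forall>b \<in> gr j. a \<otimes>\<^bsub>R\<^esub> b \<in> p \<longrightarrow> a \<in> p \<or> b \<in> p)}"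


section \<open>Canonical actions\<close>

text \<open>
  A graded ring map \<open>R \<rightarrow> End\<^sup>*(\<one>)\<close> with \<open>End\<^sup>i(\<one>) = Hom(\<one>, \<Sigma>\<^sup>i\<one>)\<close>: \<open>\<phi> i\<close> is its part of degree \<open>i\<close>. The
  product of \<open>a\<close> and \<open>b\<close> in \<open>End\<^sup>*\<close>, of degrees \<open>i\<close> and \<open>j\<close>, is \<open>\<Sigma>\<^sup>j(a) \<cdot> b\<close>.
\<close>

definition graded_ring_map_to_End_unit ::
  "('o, 'm, 'z) tt_cat_scheme \<Rightarrow> ('r, 'b) ring_scheme \<Rightarrow> (int \<Rightarrow> 'r set) \<Rightarrow> (int \<Rightarrow> 'r \<Rightarrow> 'm) \<Rightarrow> bool"
where
  "graded_ring_map_to_End_unit T R gr \<phi> \<longleftrightarrow>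
     (\<forall>i. \<forall>a \<in> gr i. \<phi> i a \<in> Mor T (unit T) (powO T i (unit T))) \<and>
     (\<forall>i. \<forall>a \<in> gr i. \<forall>b \<in> gr i. \<phi> i (a \<oplus>\<^bsub>R\<^esub> b) = \<phi> i a \<boxplus>\<^bsub>T\<^esub> \<phi> i b) \<and>
     \<phi> 0 \<one>\<^bsub>R\<^esub> = idn T (unit T) \<and>
     (\<forall>i j. \<forall>a \<in> gr i. \<forall>b \<in> gr j. \<phi> (i + j) (a \<otimes>\<^bsub>R\<^esub> b) = powM T j (\<phi> i a) \<cdot>\<^bsub>T\<^esub> \<phi> j b)"

text \<open>The isomorphism \<open>\<Sigma>\<^sup>nX \<otimes> Y \<rightarrow> \<Sigma>\<^sup>n(X \<otimes> Y)\<close>.\<close>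

primrec tsus_nat_pow :: "('o, 'm, 'z) tt_cat_scheme \<Rightarrow> nat \<Rightarrow> 'o \<Rightarrow> 'o \<Rightarrow> 'm" where
  "tsus_nat_pow T 0 X Y = idn T (X \<boxtimes>\<^bsub>T\<^esub> Y)"
| "tsus_nat_pow T (Suc n) X Y = susM T (tsus_nat_pow T n X Y) \<cdot>\<^bsub>T\<^esub> tsus T (powO T (int n) X) Y"

definition tsus_pow :: "('o, 'm, 'z) tt_cat_scheme \<Rightarrow> int \<Rightarrow> 'o \<Rightarrow> 'o \<Rightarrow> 'm" where
  "tsus_pow T n X Y = (if 0 \<le> n then tsus_nat_pow T (nat n) X Y
     else powM T n (inverse_mor T (tsus_nat_pow T (nat (- n)) (powO T n X) Y)))"

text \<open>The induced map \<open>R \<rightarrow> End\<^sup>*(X)\<close>: \<open>X \<cong> \<one> \<otimes> X \<rightarrow> \<Sigma>\<^sup>i\<one> \<otimes> X \<cong> \<Sigma>\<^sup>i(\<one> \<otimes> X) \<cong> \<Sigma>\<^sup>iX\<close>.\<close>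

definition action ::
  "('o, 'm, 'z) tt_cat_scheme \<Rightarrow> (int \<Rightarrow> 'r \<Rightarrow> 'm) \<Rightarrow> int \<Rightarrow> 'r \<Rightarrow> 'o \<Rightarrow> 'm" where
  "action T \<phi> i a X = powM T i (lunit T X) \<cdot>\<^bsub>T\<^esub> tsus_pow T i (unit T) X
     \<cdot>\<^bsub>T\<^esub> (\<phi> i a \<diamondop>\<^bsub>T\<^esub> idn T X) \<cdot>\<^bsub>T\<^esub> inverse_mor T (lunit T X)"

text \<open>The product \<open>a m\<close> in the graded module \<open>Hom\<^sup>*(C, X)\<close>, for \<open>a\<close> of degree \<open>i\<close> and \<open>m : C \<rightarrow> \<Sigma>\<^sup>nX\<close>.\<close>

definition smult_Hom ::
  "('o, 'm, 'z) tt_cat_scheme \<Rightarrow> (int \<Rightarrow> 'r \<Rightarrow> 'm) \<Rightarrow> 'o \<Rightarrow> int \<Rightarrow> 'r \<Rightarrow> int \<Rightarrow> 'm \<Rightarrow> 'm" where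
  "smult_Hom T \<phi> X i a n m = powM T n (action T \<phi> i a X) \<cdot>\<^bsub>T\<^esub> m"

text \<open>
  The localisation \<open>Hom\<^sup>*(C, X)\<^sub>p\<close> inverts the homogeneous elements outside \<open>p\<close>. Its part of degree
  \<open>d\<close> consists of the left fractions \<open>s\<^sup>-\<^sup>1m\<close>, where \<open>(i, s, m)\<close> has \<open>s\<close> of degree \<open>i\<close> and \<open>m\<close> of degree
  \<open>d + i\<close>. Two fractions are equal if they can be brought to a common denominator with a common
  numerator (the Ore form, in which no signs occur).
\<close>

definition fractions ::
  "('o, 'm, 'z) tt_cat_scheme \<Rightarrow> (int \<Rightarrow> 'r set) \<Rightarrow> 'o \<Rightarrow> 'o \<Rightarrow> 'r set \<Rightarrow> int \<Rightarrow> (int \<times> 'r \<times> 'm) set" where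
  "fractions T gr C X p d = {(i, s, m). s \<in> gr i - p \<and> m \<in> Mor T C (powO T (d + i) X)}"

definition fraction_eq ::
  "('o, 'm, 'z) tt_cat_scheme \<Rightarrow> ('r, 'b) ring_scheme \<Rightarrow> (int \<Rightarrow> 'r set) \<Rightarrow> (int \<Rightarrow> 'r \<Rightarrow> 'm) \<Rightarrow>
   'o \<Rightarrow> 'o \<Rightarrow> 'r set \<Rightarrow> int \<Rightarrow> (int \<times> 'r \<times> 'm) rel" where
  "fraction_eq T R gr \<phi> C X p d = {((i, s, m), (j, t, n)).
     (i, s, m) \<in> fractions T gr C X p d \<and> (j, t, n) \<in> fractions T gr C X p d \<and>
     (\<exists>k l a b. a \<in> gr k \<and> b \<in> gr l \<and> k + i = l + j \<and>
        a \<otimes>\<^bsub>R\<^esub> s = b \<otimes>\<^bsub>R\<^esub> t \<and> a \<otimes>\<^bsub>R\<^esub> s \<notin> p \<and>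
        smult_Hom T \<phi> X k a (d + i) m = smult_Hom T \<phi> X l b (d + j) n)}"

definition localised_Hom ::
  "('o, 'm, 'z) tt_cat_scheme \<Rightarrow> ('r, 'b) ring_scheme \<Rightarrow> (int \<Rightarrow> 'r set) \<Rightarrow> (int \<Rightarrow> 'r \<Rightarrow> 'm) \<Rightarrow>
   'o \<Rightarrow> 'o \<Rightarrow> 'r set \<Rightarrow> int \<Rightarrow> (int \<times> 'r \<times> 'm) set set" where
  "localised_Hom T R gr \<phi> C X p d = fractions T gr C X p d // fraction_eq T R gr \<phi> C X p d"

text \<open>A localised module vanishes iff each of its graded parts consists of a single element.\<close>

definition T_sub ::
  "'u rel \<Rightarrow> ('o, 'm, 'z) tt_cat_scheme \<Rightarrow> ('r, 'b) ring_scheme \<Rightarrow> (int \<Rightarrow> 'r set) \<Rightarrow> (int \<Rightarrow> 'r \<Rightarrow> 'm) \<Rightarrow>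
   'r set set \<Rightarrow> 'o set" where
  "T_sub \<kappa> T R gr \<phi> V = {X. \<forall>C \<in> compacts \<kappa> T. \<forall>p \<in> Spec R gr - V.
     \<forall>d. is_singleton (localised_Hom T R gr \<phi> C X p d)}"


section \<open>Stratification\<close>

definition right_orthogonal :: "('o, 'm, 'z) tri_cat_scheme \<Rightarrow> 'o set \<Rightarrow> 'o set" where
  "right_orthogonal T S = {Y. \<forall>X\<in>S. Mor T X Y = {zer T X Y}}"

definition localisation_triangle ::
  "('o, 'm, 'z) tri_cat_scheme \<Rightarrow> 'o set \<Rightarrow> 'o \<Rightarrow> 'o \<Rightarrow> 'o \<Rightarrow> bool" where
  "localisation_triangle T S A X B \<longleftrightarrow> A \<in> S \<and> B \<in> right_orthogonal T S \<and>
     (\<exists>(f, g, h) \<in> triangles T. f \<in> Mor T A X \<and> g \<in> Mor T X B)"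

text \<open>
  The localisation triangle of \<open>X\<close> exists for localising subcategories with a set of generators and is
  unique up to isomorphism; \<open>\<Gamma>\<close> and \<open>L\<close> choose its outer vertices.
\<close>

definition Gamma ::
  "'u rel \<Rightarrow> ('o, 'm, 'z) tt_cat_scheme \<Rightarrow> ('r, 'b) ring_scheme \<Rightarrow> (int \<Rightarrow> 'r set) \<Rightarrow> (int \<Rightarrow> 'r \<Rightarrow> 'm) \<Rightarrow>
   'r set set \<Rightarrow> 'o \<Rightarrow> 'o" where
  "Gamma \<kappa> T R gr \<phi> V X = (SOME A. \<exists>B. localisation_triangle T (T_sub \<kappa> T R gr \<phi> V) A X B)"

definition Loc ::
  "'u rel \<Rightarrow> ('o, 'm, 'z) tt_cat_scheme \<Rightarrow> ('r, 'b) ring_scheme \<Rightarrow> (int \<Rightarrow> 'r set) \<Rightarrow> (int \<Rightarrow> 'r \<Rightarrow> 'm) \<Rightarrow>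
   'r set set \<Rightarrow> 'o \<Rightarrow> 'o" where
  "Loc \<kappa> T R gr \<phi> V X = (SOME B. \<exists>A. localisation_triangle T (T_sub \<kappa> T R gr \<phi> V) A X B)"

definition Gamma_prime ::
  "'u rel \<Rightarrow> ('o, 'm, 'z) tt_cat_scheme \<Rightarrow> ('r, 'b) ring_scheme \<Rightarrow> (int \<Rightarrow> 'r set) \<Rightarrow> (int \<Rightarrow> 'r \<Rightarrow> 'm) \<Rightarrow>
   'r set \<Rightarrow> 'o \<Rightarrow> 'o" where
  "Gamma_prime \<kappa> T R gr \<phi> p X = Gamma \<kappa> T R gr \<phi> {q \<in> Spec R gr. p \<subseteq> q}
     (Loc \<kappa> T R gr \<phi> {q \<in> Spec R gr. \<not> q \<subseteq> p} X)"

definition Gamma_image ::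
  "'u rel \<Rightarrow> ('o, 'm, 'z) tt_cat_scheme \<Rightarrow> ('r, 'b) ring_scheme \<Rightarrow> (int \<Rightarrow> 'r set) \<Rightarrow> (int \<Rightarrow> 'r \<Rightarrow> 'm) \<Rightarrow>
   'r set \<Rightarrow> 'o set" where
  "Gamma_image \<kappa> T R gr \<phi> p = {Y. \<exists>X. isomorphic T Y (Gamma_prime \<kappa> T R gr \<phi> p X)}"

definition canonically_stratified ::
  "'u rel \<Rightarrow> ('o, 'm, 'z) tt_cat_scheme \<Rightarrow> ('r, 'b) ring_scheme \<Rightarrow> (int \<Rightarrow> 'r set) \<Rightarrow> (int \<Rightarrow> 'r \<Rightarrow> 'm) \<Rightarrow> bool"
where
  "canonically_stratified \<kappa> T R gr \<phi> \<longleftrightarrow>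
     graded_commutative_ring R gr \<and> noetherian_ring R \<and> graded_ring_map_to_End_unit T R gr \<phi> \<and>
     (\<forall>p \<in> Spec R gr. \<forall>L \<subseteq> Gamma_image \<kappa> T R gr \<phi> p. localising_ideal \<kappa> T L \<longrightarrow>
        L = {Z. zero_object T Z} \<or> L = Gamma_image \<kappa> T R gr \<phi> p)"


section \<open>Definable classes and their duals\<close>

definition compact_maps :: "'u rel \<Rightarrow> ('o, 'm, 'z) tri_cat_scheme \<Rightarrow> 'm set" where
  "compact_maps \<kappa> T = {f. src T f \<in> compacts \<kappa> T \<and> trg T f \<in> compacts \<kappa> T}"

definition precomp_image :: "('o, 'm, 'z) tri_cat_scheme \<Rightarrow> 'm \<Rightarrow> 'o \<Rightarrow> 'm set" where
  "precomp_image T f X = (\<lambda>g. g \<cdot>\<^bsub>T\<^esub> f) ` Mor T (trg T f) X"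

definition definable :: "'u rel \<Rightarrow> ('o, 'm, 'z) tri_cat_scheme \<Rightarrow> 'o set \<Rightarrow> bool" where
  "definable \<kappa> T D \<longleftrightarrow> (\<exists>F \<subseteq> compact_maps \<kappa> T. small \<kappa> F \<and>
     D = {X. \<forall>f\<in>F. precomp_image T f X = Mor T (src T f) X})"

text \<open>Functors to abelian groups, by their values on objects and on morphisms.\<close>

record ('o, 'm, 'e) ab_functor =
  fobj :: "'o \<Rightarrow> 'e monoid"
  fmor :: "'m \<Rightarrow> 'e \<Rightarrow> 'e"

definition representable :: "('o, 'm, 'z) tri_cat_scheme \<Rightarrow> 'o \<Rightarrow> ('o, 'm, 'm) ab_functor" where
  "representable T A = \<lparr>fobj = mor_group T A, fmor = (\<lambda>u x. u \<cdot>\<^bsub>T\<^esub> x)\<rparr>"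

text \<open>
  The cokernel of \<open>Hom(f, -)\<close>, with cosets as elements. For \<open>f\<close> in \<open>T\<^sup>c\<close>, it is the functor
  \<open>G\<tilde>\<close> on all of \<open>T\<close>; the finitely presented functor \<open>G\<close> is its restriction to \<open>T\<^sup>c\<close>. The constructions
  on \<open>G\<close> below look only at this restriction.
\<close>

definition coker_Hom :: "('o, 'm, 'z) tri_cat_scheme \<Rightarrow> 'm \<Rightarrow> ('o, 'm, 'm set) ab_functor" where
  "coker_Hom T f =
     \<lparr>fobj = (\<lambda>X. mor_group T (src T f) X Mod precomp_image T f X),
      fmor = (\<lambda>u S. \<Union>x\<in>S. precomp_image T f (trg T u) #>\<^bsub>mor_group T (src T f) (trg T u)\<^esub> (u \<cdot>\<^bsub>T\<^esub> x))\<rparr>"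

definition fp_functors :: "'u rel \<Rightarrow> ('o, 'm, 'z) tri_cat_scheme \<Rightarrow> ('o, 'm, 'm set) ab_functor set" where
  "fp_functors \<kappa> T = coker_Hom T ` compact_maps \<kappa> T"

definition nat_transformation :: "'u rel \<Rightarrow> ('o, 'm, 'z) tri_cat_scheme \<Rightarrow>
    ('o, 'm, 'e) ab_functor \<Rightarrow> ('o, 'm, 'e') ab_functor \<Rightarrow> ('o \<Rightarrow> 'e \<Rightarrow> 'e') \<Rightarrow> bool" where
  "nat_transformation \<kappa> T G H \<eta> \<longleftrightarrow>
     (\<forall>C \<in> compacts \<kappa> T. \<eta> C \<in> hom (fobj G C) (fobj H C)) \<and>
     (\<forall>u \<in> compact_maps \<kappa> T. \<forall>x \<in> carrier (fobj G (src T u)).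
        \<eta> (trg T u) (fmor G u x) = fmor H u (\<eta> (src T u) x))"

definition nat_isomorphic :: "'u rel \<Rightarrow> ('o, 'm, 'z) tri_cat_scheme \<Rightarrow>
    ('o, 'm, 'e) ab_functor \<Rightarrow> ('o, 'm, 'e') ab_functor \<Rightarrow> bool" where
  "nat_isomorphic \<kappa> T G H \<longleftrightarrow> (\<exists>\<eta>. nat_transformation \<kappa> T G H \<eta> \<and>
     (\<forall>C \<in> compacts \<kappa> T. \<eta> C \<in> iso (fobj G C) (fobj H C)))"

text \<open>
  The group of natural transformations between functors on \<open>T\<^sup>c\<close>. They are made extensional, so that
  distinct elements of the carrier are distinct transformations.
\<close>

definition nat_group :: "'u rel \<Rightarrow> ('o, 'm, 'z) tri_cat_scheme \<Rightarrow>
    ('o, 'm, 'e) ab_functor \<Rightarrow> ('o, 'm, 'e') ab_functor \<Rightarrow> ('o \<Rightarrow> 'e \<Rightarrow> 'e') monoid" where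
  "nat_group \<kappa> T G H =
     \<lparr>carrier = {\<eta> \<in> (\<Pi>\<^sub>E C \<in> compacts \<kappa> T. extensional (carrier (fobj G C))). nat_transformation \<kappa> T G H \<eta>},
      mult = (\<lambda>\<eta> \<theta>. \<lambda>C \<in> compacts \<kappa> T. \<lambda>x \<in> carrier (fobj G C). \<eta> C x \<otimes>\<^bsub>fobj H C\<^esub> \<theta> C x),
      one = (\<lambda>C \<in> compacts \<kappa> T. \<lambda>x \<in> carrier (fobj G C). \<one>\<^bsub>fobj H C\<^esub>)\<rparr>"

text \<open>\<open>(\<delta>G)(Y) = Hom(G, Hom(DY, -))\<close>; a map \<open>u\<close> acts by composition with \<open>Hom(Du, -)\<close>.\<close>

definition delta :: "'u rel \<Rightarrow> ('o, 'm, 'z) tt_cat_scheme \<Rightarrow>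
    ('o, 'm, 'e) ab_functor \<Rightarrow> ('o, 'm, 'o \<Rightarrow> 'e \<Rightarrow> 'm) ab_functor" where
  "delta \<kappa> T G =
     \<lparr>fobj = (\<lambda>Y. nat_group \<kappa> T G (representable T (dualO T Y))),
      fmor = (\<lambda>u \<eta>. \<lambda>C \<in> compacts \<kappa> T. \<lambda>x \<in> carrier (fobj G C). \<eta> C x \<cdot>\<^bsub>T\<^esub> dualM T u)\<rparr>"

definition annihilator ::
  "'u rel \<Rightarrow> ('o, 'm, 'z) tri_cat_scheme \<Rightarrow> 'o set \<Rightarrow> ('o, 'm, 'm set) ab_functor set" where
  "annihilator \<kappa> T D = {G \<in> fp_functors \<kappa> T. \<forall>X\<in>D. trivial_group (fobj G X)}"

text \<open>
  \<open>\<delta>G\<close> lives on \<open>T\<^sup>c\<close>; its extension to \<open>T\<close> is computed from a presentation, that is, from a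
  cokernel \<open>H\<close> which on \<open>T\<^sup>c\<close> is naturally isomorphic to \<open>\<delta>G\<close>.
\<close>

definition dual_definable :: "'u rel \<Rightarrow> ('o, 'm, 'z) tt_cat_scheme \<Rightarrow> 'o set \<Rightarrow> 'o set" where
  "dual_definable \<kappa> T D = {Y. \<forall>G \<in> annihilator \<kappa> T D. \<forall>H \<in> fp_functors \<kappa> T.
     nat_isomorphic \<kappa> T (delta \<kappa> T G) H \<longrightarrow> trivial_group (fobj H Y)}"

end

theory Submission
  imports Defs
begin

text \<open>
  For compact \<open>P\<close>, which is rigid, a map \<open>t : DP \<rightarrow> A\<close> is the same as an element \<open>x : \<one> \<rightarrow> A \<otimes> P\<close>, and by
  symmetry, for compact \<open>A\<close>, the same as a map \<open>g : DA \<rightarrow> P\<close>. The key claim is that if \<open>a t = 0\<close> for all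
  \<open>a : A \<rightarrow> X\<close> with \<open>X\<close> in \<open>D\<close>, then also \<open>y g = 0\<close> for all \<open>y : P \<rightarrow> Y\<close> with \<open>Y\<close> in \<open>D\<close>. Indeed, the
  name \<open>\<one> \<rightarrow> F(P, Y)\<close> of \<open>y\<close> induces a map \<open>a : A \<rightarrow> A \<otimes> F(P, Y)\<close>, whose target lies in the ideal \<open>D\<close>
  because \<open>F(P, Y) \<cong> DP \<otimes> Y\<close>; now \<open>(a \<otimes> P) x = 0\<close>, and evaluation turns this into \<open>(A \<otimes> y) x = 0\<close>.

  If \<open>G = coker Hom(f, -)\<close> with \<open>f : A \<rightarrow> B\<close> vanishes on \<open>D\<close>, then \<open>(\<delta>G)(P)\<close> consists of the maps
  \<open>t : DP \<rightarrow> A\<close> with \<open>f t = 0\<close>, to which the claim applies. If \<open>coker Hom(k, -)\<close>, with \<open>k\<close> starting at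
  \<open>P\<close>, represents \<open>\<delta>G\<close> and \<open>t\<close> corresponds to the class of the identity of \<open>P\<close>, then the cofibre of \<open>g\<close>
  factors through \<open>k\<close>, hence so does every map from \<open>P\<close> to an object of \<open>D\<close>. Conversely, for each \<open>f\<close> that
  defines \<open>D\<close>, continue \<open>Df\<close> to a triangle \<open>DB \<rightarrow> DA \<rightarrow> E \<rightarrow> \<Sigma>DB\<close>; by the claim \<open>coker Hom(f', -)\<close> with
  \<open>f' : E \<rightarrow> \<Sigma>DB\<close> vanishes on \<open>D\<close>, and its image under \<open>\<delta>\<close> is \<open>coker Hom(f, -)\<close>.
\<close>

section \<open>Categories and additive categories\<close>

lemma Mor_iff: "f \<in> Mor T X Y \<longleftrightarrow> src T f = X \<and> trg T f = Y"
  by (simp add: Mor_def)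

section \<open>Typing rules and isomorphisms in a category\<close>

context category
begin

lemma src_cmp [simp]: "trg T f = src T g \<Longrightarrow> src T (g \<cdot> f) = src T f"
  and trg_cmp [simp]: "trg T f = src T g \<Longrightarrow> trg T (g \<cdot> f) = trg T g"
  using cmp_Mor [of f "src T f" "src T g" g "trg T g"] by (auto simp: Mor_iff)

lemma src_idn [simp]: "src T (idn T X) = X" and trg_idn [simp]: "trg T (idn T X) = X"
  using idn_Mor [of X] by (auto simp: Mor_iff)

lemma idn_cmp [simp]: "trg T f = X \<Longrightarrow> idn T X \<cdot> f = f"
  and cmp_idn [simp]: "src T f = X \<Longrightarrow> f \<cdot> idn T X = f"
  using idn_left idn_right by (auto simp: Mor_iff)

text \<open>Orients associativity so that composites nest to the right. A rule about
  \<open>g \<cdot> f\<close> then misses the same factors inside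
  \<open>g \<cdot> (f \<cdot> k)\<close>, which is why many later equations have a second version
  with a trailing \<open>k\<close>.\<close>

lemma cmp_cmp [simp]:
  "\<lbrakk>trg T f = src T g; trg T g = src T h\<rbrakk> \<Longrightarrow> (h \<cdot> g) \<cdot> f = h \<cdot> (g \<cdot> f)"
  by (rule cmp_assoc [of f "src T f" "trg T f" g "trg T g" h "trg T h"]) (auto simp: Mor_iff)

lemma inverse_of_unique: "\<lbrakk>inverse_of T f g; inverse_of T f h\<rbrakk> \<Longrightarrow> g = h"
  unfolding inverse_of_def Mor_iff by (metis cmp_cmp cmp_idn idn_cmp)

lemma inverse_of_inverse_mor: "is_iso T f \<Longrightarrow> inverse_of T f (inverse_mor T f)"
  unfolding is_iso_def inverse_mor_def by (metis inverse_of_unique theI)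

lemma
  assumes "is_iso T f"
  shows src_inverse [simp]: "src T (inverse_mor T f) = trg T f"
    and trg_inverse [simp]: "trg T (inverse_mor T f) = src T f"
    and inverse_cmp [simp]: "inverse_mor T f \<cdot> f = idn T (src T f)"
    and cmp_inverse [simp]: "f \<cdot> inverse_mor T f = idn T (trg T f)"
    and is_iso_inverse [simp]: "is_iso T (inverse_mor T f)"
  using inverse_of_inverse_mor [OF assms] unfolding is_iso_def inverse_of_def Mor_iff by auto

lemma
  assumes "is_iso T f"
  shows inverse_cmp_cmp [simp]: "trg T g = src T f \<Longrightarrow> inverse_mor T f \<cdot> (f \<cdot> g) = g"
    and cmp_inverse_cmp [simp]: "trg T g = trg T f \<Longrightarrow> f \<cdot> (inverse_mor T f \<cdot> g) = g"
  using assms by (simp_all flip: cmp_cmp)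

lemma is_isoI:
  "\<lbrakk>src T g = trg T f; trg T g = src T f; g \<cdot> f = idn T (src T f); f \<cdot> g = idn T (trg T f)\<rbrakk>
    \<Longrightarrow> is_iso T f"
  unfolding is_iso_def inverse_of_def Mor_iff by blast

lemma is_iso_idn [simp]: "is_iso T (idn T X)"
  by (rule is_isoI [where g = "idn T X"]) auto

lemma is_iso_cmp [simp]:
  "\<lbrakk>is_iso T f; is_iso T g; trg T f = src T g\<rbrakk> \<Longrightarrow> is_iso T (g \<cdot> f)"
  by (rule is_isoI [where g = "inverse_mor T f \<cdot> inverse_mor T g"]) auto

lemma iso_cancel_left:
  "\<lbrakk>is_iso T f; f \<cdot> g = f \<cdot> h; trg T g = src T f; trg T h = src T f\<rbrakk> \<Longrightarrow> g = h"
  by (metis inverse_cmp_cmp)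

lemma iso_cancel_right:
  assumes "is_iso T f" "g \<cdot> f = h \<cdot> f" "src T g = trg T f" "src T h = trg T f"
  shows "g = h"
proof -
  have "(g \<cdot> f) \<cdot> inverse_mor T f = (h \<cdot> f) \<cdot> inverse_mor T f"
    by (simp only: assms(2))
  then show ?thesis using assms(1,3,4) by simp
qed

end

section \<open>Zero morphisms, negatives and finite sums\<close>

context additive_category
begin

lemma zer_Mor: "zer T X Y \<in> Mor T X Y"
  using comm_group.axioms(1) [OF mor_group_comm, THEN comm_monoid.axioms(1), THEN monoid.one_closed]
  by (simp add: mor_group_def)

lemma src_zer [simp]: "src T (zer T X Y) = X" and trg_zer [simp]: "trg T (zer T X Y) = Y"
  using zer_Mor by (auto simp: Mor_iff)

lemma carrier_mor_group [simp]: "carrier (mor_group T X Y) = Mor T X Y"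
  and mult_mor_group [simp]: "x \<otimes>\<^bsub>mor_group T X Y\<^esub> y = x \<boxplus> y"
  and one_mor_group [simp]: "\<one>\<^bsub>mor_group T X Y\<^esub> = zer T X Y"
  by (auto simp: mor_group_def)

lemma mor_group_group: "group (mor_group T X Y)"
  using mor_group_comm by (rule comm_group.axioms(2))

lemma mor_group_monoid: "comm_monoid (mor_group T X Y)"
  using mor_group_comm by (rule comm_group.axioms(1))

lemma plus_Mor: "\<lbrakk>f \<in> Mor T X Y; g \<in> Mor T X Y\<rbrakk> \<Longrightarrow> f \<boxplus> g \<in> Mor T X Y"
  using monoid.m_closed [OF group.is_monoid [OF mor_group_group [of X Y]]] by simp

lemma src_plus [simp]: "\<lbrakk>src T f = src T g; trg T f = trg T g\<rbrakk> \<Longrightarrow> src T (f \<boxplus> g) = src T g"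
  and trg_plus [simp]: "\<lbrakk>src T f = src T g; trg T f = trg T g\<rbrakk> \<Longrightarrow> trg T (f \<boxplus> g) = trg T g"
  using plus_Mor [of f "src T g" "trg T g" g] by (auto simp: Mor_iff)

lemma zer_plus [simp]: "f \<in> Mor T X Y \<Longrightarrow> zer T X Y \<boxplus> f = f"
  and plus_zer [simp]: "f \<in> Mor T X Y \<Longrightarrow> f \<boxplus> zer T X Y = f"
  using monoid.l_one [OF group.is_monoid [OF mor_group_group [of X Y]]]
    monoid.r_one [OF group.is_monoid [OF mor_group_group [of X Y]]] by auto

lemma plus_left_cancel:
  "\<lbrakk>f \<boxplus> g = f \<boxplus> h; f \<in> Mor T X Y; g \<in> Mor T X Y; h \<in> Mor T X Y\<rbrakk> \<Longrightarrow> g = h"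
  using monoid.Units_l_cancel [OF group.is_monoid [OF mor_group_group [of X Y]], of f g h]
    group.Units_eq [OF mor_group_group [of X Y]] by auto

text \<open>The test by which composition and suspension are shown to preserve zero
  morphisms.\<close>

lemma plus_idem: "\<lbrakk>f \<boxplus> f = f; f \<in> Mor T X Y\<rbrakk> \<Longrightarrow> f = zer T X Y"
  using plus_left_cancel [of f f "zer T X Y"] by (simp add: zer_Mor)

lemma cmp_zer [simp]:
  assumes "src T h = Y"
  shows "h \<cdot> zer T X Y = zer T X (trg T h)"
proof (rule plus_idem)
  have "h \<cdot> (zer T X Y \<boxplus> zer T X Y) = h \<cdot> zer T X Y \<boxplus> h \<cdot> zer T X Y"
    by (rule cmp_plus_right) (use assms in \<open>auto simp: Mor_iff\<close>)
  then show "h \<cdot> zer T X Y \<boxplus> h \<cdot> zer T X Y = h \<cdot> zer T X Y" by (simp add: zer_Mor)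
qed (use assms in \<open>auto simp: Mor_iff\<close>)

lemma zer_cmp [simp]:
  assumes "trg T h = X"
  shows "zer T X Y \<cdot> h = zer T (src T h) Y"
proof (rule plus_idem)
  have "(zer T X Y \<boxplus> zer T X Y) \<cdot> h = zer T X Y \<cdot> h \<boxplus> zer T X Y \<cdot> h"
    by (rule cmp_plus_left) (use assms in \<open>auto simp: Mor_iff\<close>)
  then show "zer T X Y \<cdot> h \<boxplus> zer T X Y \<cdot> h = zer T X Y \<cdot> h" by (simp add: zer_Mor)
qed (use assms in \<open>auto simp: Mor_iff\<close>)

lemma neg_Mor: "f \<in> Mor T X Y \<Longrightarrow> neg_mor T f \<in> Mor T X Y"
  and plus_neg: "f \<in> Mor T X Y \<Longrightarrow> f \<boxplus> neg_mor T f = zer T X Y"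
  using group.inv_closed [OF mor_group_group [of X Y], of f]
    group.r_inv [OF mor_group_group [of X Y], of f] by (auto simp: neg_mor_def Mor_iff)

lemma src_neg [simp]: "src T (neg_mor T f) = src T f"
  and trg_neg [simp]: "trg T (neg_mor T f) = trg T f"
  using neg_Mor [of f "src T f" "trg T f"] by (auto simp: Mor_iff)

lemma neg_unique:
  assumes "f \<boxplus> g = zer T X Y" "f \<in> Mor T X Y" "g \<in> Mor T X Y"
  shows "g = neg_mor T f"
  using assms by (intro plus_left_cancel [of f g "neg_mor T f" X Y]) (auto simp: plus_neg neg_Mor)

lemma neg_zer [simp]: "neg_mor T (zer T X Y) = zer T X Y"
  by (rule neg_unique [symmetric]) (auto simp: zer_Mor)

lemma cmp_neg [simp]:
  assumes "trg T f = src T h"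
  shows "h \<cdot> neg_mor T f = neg_mor T (h \<cdot> f)"
proof (rule neg_unique)
  have "h \<cdot> (f \<boxplus> neg_mor T f) = h \<cdot> f \<boxplus> h \<cdot> neg_mor T f"
    by (rule cmp_plus_right) (use assms in \<open>auto simp: Mor_iff\<close>)
  then show "h \<cdot> f \<boxplus> h \<cdot> neg_mor T f = zer T (src T f) (trg T h)"
    using assms plus_neg [of f "src T f" "trg T f"] by (simp add: Mor_iff)
qed (use assms in \<open>auto simp: Mor_iff\<close>)

lemma neg_cmp [simp]:
  assumes "trg T h = src T f"
  shows "neg_mor T f \<cdot> h = neg_mor T (f \<cdot> h)"
proof (rule neg_unique)
  have "(f \<boxplus> neg_mor T f) \<cdot> h = f \<cdot> h \<boxplus> neg_mor T f \<cdot> h"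
    by (rule cmp_plus_left) (use assms in \<open>auto simp: Mor_iff\<close>)
  then show "f \<cdot> h \<boxplus> neg_mor T f \<cdot> h = zer T (src T h) (trg T f)"
    using assms plus_neg [of f "src T f" "trg T f"] by (simp add: Mor_iff)
qed (use assms in \<open>auto simp: Mor_iff\<close>)

lemma neg_neg: "neg_mor T (neg_mor T f) = f"
  using group.inv_inv [OF mor_group_group, of f "src T f" "trg T f"]
  unfolding neg_mor_def [of T "neg_mor T f"] src_neg trg_neg
  by (simp add: neg_mor_def Mor_iff)

lemma neg_inject: "neg_mor T f = neg_mor T g \<Longrightarrow> f = g"
  by (metis neg_neg)

lemma plus_minus:
  assumes "f \<in> Mor T X Y" "g \<in> Mor T X Y"
  shows "(f \<boxplus> neg_mor T g) \<boxplus> g = f"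
proof -
  interpret comm_group "mor_group T X Y" by (rule mor_group_comm)
  have "neg_mor T g = inv\<^bsub>mor_group T X Y\<^esub> g" using assms(2) by (auto simp: neg_mor_def Mor_iff)
  then show ?thesis using assms m_assoc [of f "inv\<^bsub>mor_group T X Y\<^esub> g" g] l_inv [of g]
    inv_closed [of g] by simp
qed

lemma finprod_Mor:
  "(\<And>i. i \<in> J \<Longrightarrow> c i \<in> Mor T X Y) \<Longrightarrow> finprod (mor_group T X Y) c J \<in> Mor T X Y"
  using comm_monoid.finprod_closed [OF mor_group_monoid, of c J X Y] by auto

lemma finprod_insert_Mor:
  "\<lbrakk>finite J; j \<notin> J; \<And>i. i \<in> insert j J \<Longrightarrow> c i \<in> Mor T X Y\<rbrakk>
    \<Longrightarrow> finprod (mor_group T X Y) c (insert j J) = c j \<boxplus> finprod (mor_group T X Y) c J"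
  using comm_monoid.finprod_insert [OF mor_group_monoid, of J j c X Y] by auto

lemma cmp_finprod:
  assumes "\<And>i. i \<in> J \<Longrightarrow> c i \<in> Mor T X Y" "h \<in> Mor T Y Z"
  shows "h \<cdot> finprod (mor_group T X Y) c J = finprod (mor_group T X Z) (\<lambda>i. h \<cdot> c i) J"
  using assms
\<comment> \<open>For infinite \<open>J\<close> both sides are zero, since \<open>finprod\<close>
  then takes the unit of the group as its default value.\<close>
proof (induction J rule: infinite_finite_induct)
  case (insert j J)
  have "h \<cdot> (c j \<boxplus> finprod (mor_group T X Y) c J)
      = h \<cdot> c j \<boxplus> h \<cdot> finprod (mor_group T X Y) c J"
    by (rule cmp_plus_right) (use insert in \<open>auto intro: finprod_Mor\<close>)
  moreover have "finprod (mor_group T X Z) (\<lambda>i. h \<cdot> c i) (insert j J)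
      = h \<cdot> c j \<boxplus> finprod (mor_group T X Z) (\<lambda>i. h \<cdot> c i) J"
    by (rule finprod_insert_Mor) (use insert in \<open>auto intro: cmp_Mor\<close>)
  ultimately show ?case using insert by (subst finprod_insert_Mor) auto
qed (auto simp: Mor_iff comm_monoid.finprod_infinite [OF mor_group_monoid]
    comm_monoid.finprod_empty [OF mor_group_monoid])

lemma finprod_cmp:
  assumes "\<And>i. i \<in> J \<Longrightarrow> c i \<in> Mor T Y Z" "h \<in> Mor T X Y"
  shows "finprod (mor_group T Y Z) c J \<cdot> h = finprod (mor_group T X Z) (\<lambda>i. c i \<cdot> h) J"
  using assms
proof (induction J rule: infinite_finite_induct)
  case (insert j J)
  have "(c j \<boxplus> finprod (mor_group T Y Z) c J) \<cdot> h
      = c j \<cdot> h \<boxplus> finprod (mor_group T Y Z) c J \<cdot> h"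
    by (rule cmp_plus_left) (use insert in \<open>auto intro: finprod_Mor\<close>)
  moreover have "finprod (mor_group T X Z) (\<lambda>i. c i \<cdot> h) (insert j J)
      = c j \<cdot> h \<boxplus> finprod (mor_group T X Z) (\<lambda>i. c i \<cdot> h) J"
    by (rule finprod_insert_Mor) (use insert in \<open>auto intro: cmp_Mor\<close>)
  ultimately show ?case using insert by (subst finprod_insert_Mor) auto
qed (auto simp: Mor_iff comm_monoid.finprod_infinite [OF mor_group_monoid]
    comm_monoid.finprod_empty [OF mor_group_monoid])

lemma finprod_single:
  assumes "finite J" "j \<in> J" "\<And>i. i \<in> J \<Longrightarrow> c i \<in> Mor T X Y"
    "\<And>i. \<lbrakk>i \<in> J; i \<noteq> j\<rbrakk> \<Longrightarrow> c i = zer T X Y"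
  shows "finprod (mor_group T X Y) c J = c j"
proof -
  have "finprod (mor_group T X Y) c (insert j (J - {j})) = c j \<boxplus> finprod (mor_group T X Y) c (J - {j})"
    using assms by (intro finprod_insert_Mor) auto
  moreover have "finprod (mor_group T X Y) c (J - {j}) = zer T X Y"
    using comm_monoid.finprod_one_eqI [OF mor_group_monoid, of "J - {j}" c X Y] assms by auto
  ultimately show ?thesis using assms(2,3) by (simp add: insert_absorb)
qed

text \<open>Every map into or out of \<open>Z\<close> factors through the identity of
  \<open>Z\<close>.\<close>

lemma zero_object_iff: "zero_object T Z \<longleftrightarrow> idn T Z = zer T Z Z"
proof
  assume "idn T Z = zer T Z Z"
  then have "f = zer T X Z" if "f \<in> Mor T X Z" for f X
    using that by (metis Mor_iff idn_cmp zer_cmp)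
  moreover have "f = zer T Z X" if "f \<in> Mor T Z X" for f X
    using that \<open>idn T Z = zer T Z Z\<close> by (metis Mor_iff cmp_idn cmp_zer)
  ultimately show "zero_object T Z" unfolding zero_object_def by (metis zer_Mor)
qed (metis zero_object_def idn_Mor zer_Mor)

lemma zero_object_from: "\<lbrakk>zero_object T Z; f \<in> Mor T Z X; g \<in> Mor T Z X\<rbrakk> \<Longrightarrow> f = g"
  by (auto simp: zero_object_def)

end

section \<open>Triangulated categories\<close>

context triangulated_category
begin

lemma src_susM [simp]: "src T (susM T f) = susO T (src T f)"
  and trg_susM [simp]: "trg T (susM T f) = susO T (trg T f)"
  using sus_Mor [of f "src T f" "trg T f"] by (auto simp: Mor_iff)

lemma susM_cmp [simp]: "trg T f = src T g \<Longrightarrow> susM T (g \<cdot> f) = susM T g \<cdot> susM T f"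
  using sus_cmp by (simp add: Mor_iff)

lemma susM_zer [simp]: "susM T (zer T X Y) = zer T (susO T X) (susO T Y)"
  using sus_plus [of "zer T X Y" X Y "zer T X Y"]
  by (intro plus_idem) (auto simp: Mor_iff)

text \<open>Suspension is bijective on the type of all morphisms, so a preimage exists; its ends are
  the right ones because suspension is injective on objects.\<close>

lemma sus_full:
  assumes "f \<in> Mor T (susO T X) (susO T Y)"
  obtains f' where "f' \<in> Mor T X Y" "susM T f' = f"
proof -
  obtain f' where f': "susM T f' = f" using bij_susM by (metis bij_pointE)
  then have "susO T (src T f') = susO T X" "susO T (trg T f') = susO T Y"
    using assms unfolding Mor_iff by (metis src_susM, metis trg_susM)
  then have "f' \<in> Mor T X Y"
    using bij_is_inj [OF bij_susO] unfolding Mor_iff inj_def by blast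
  then show ?thesis using f' by (rule that)
qed

lemma sus_faithful: "susM T f = susM T g \<Longrightarrow> f = g"
  using bij_susM by (metis bij_def injD)

lemma zero_object_sus: "zero_object T Z \<Longrightarrow> zero_object T (susO T Z)"
  unfolding zero_object_iff by (metis sus_idn susM_zer)

lemma triangle_typing:
  assumes "(f, g, h) \<in> triangles T"
  shows "src T g = trg T f" "src T h = trg T g" "trg T h = susO T (src T f)"
  using triangle_Mor [OF assms] by auto

lemma triangle_rotateD:
  "(f, g, h) \<in> triangles T \<Longrightarrow> (g, h, neg_mor T (susM T f)) \<in> triangles T"
  using triangle_rotate [of f "src T f" "trg T f" g "trg T g" h] triangle_typing [of f g h]
  by (auto simp: Mor_iff)

text \<open>Map the trivial triangle on the identity of \<open>src T f\<close> to the given one by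
  the identity and \<open>f\<close>. The filled third component exhibits \<open>g \<cdot> f\<close>
  as a map that factors through a zero object.\<close>

lemma triangle_cmp_zer:
  assumes t: "(f, g, h) \<in> triangles T"
  shows "g \<cdot> f = zer T (src T f) (trg T g)"
proof -
  obtain Z where Z: "zero_object T Z" using ex_zero_object by auto
  have "(idn T (src T f), zer T (src T f) Z, zer T Z (susO T (src T f))) \<in> triangles T"
    using Z by (rule triangle_idn)
  from triangle_fill [OF this t, of "idn T (src T f)" f]
  obtain w where "w \<in> Mor T Z (src T h)" "w \<cdot> zer T (src T f) Z = g \<cdot> f"
    using triangle_typing [OF t] by (auto simp: Mor_iff)
  then show ?thesis using triangle_typing [OF t] by (auto simp: Mor_iff)
qed

text \<open>A map that kills \<open>f\<close>, together with a zero map, is a morphism to the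
  trivial triangle on the identity of \<open>trg T x\<close>; its third component is the
  factorisation.\<close>

lemma triangle_weak_cokernel:
  assumes t: "(f, g, h) \<in> triangles T" and x: "src T x = trg T f" "x \<cdot> f = zer T (src T f) (trg T x)"
  obtains w where "w \<in> Mor T (trg T g) (trg T x)" "w \<cdot> g = x"
proof -
  obtain Z where Z: "zero_object T Z" using ex_zero_object by auto
  let ?X = "trg T x"
  \<comment> \<open>The zero object is taken as \<open>susO T Z\<close> so that rotating back gives
    a triangle \<open>Z \<rightarrow> X \<rightarrow> X \<rightarrow> \<Sigma>Z\<close>. The sign of
    the rotation falls on a zero morphism and disappears.\<close>
  have "(idn T ?X, zer T ?X (susO T Z), zer T (susO T Z) (susO T ?X)) \<in> triangles T"
    using zero_object_sus [OF Z] by (rule triangle_idn)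
  then have "(zer T Z ?X, idn T ?X, zer T ?X (susO T Z)) \<in> triangles T"
    by (subst triangle_rotate [of _ Z ?X _ ?X]) (auto simp: Mor_iff)
  then have "\<exists>w \<in> Mor T (src T h) (src T (zer T ?X (susO T Z))).
      w \<cdot> g = idn T ?X \<cdot> x \<and> susM T (zer T (src T f) Z) \<cdot> h = zer T ?X (susO T Z) \<cdot> w"
    by (rule triangle_fill [OF t]) (use x triangle_typing [OF t] in \<open>simp_all add: Mor_iff\<close>)
  then obtain w where w: "w \<in> Mor T (src T h) ?X" "w \<cdot> g = idn T ?X \<cdot> x"
    unfolding src_zer by blast
  show ?thesis
  proof (rule that)
    show "w \<in> Mor T (trg T g) (trg T x)" using w(1) triangle_typing [OF t] by simp
    show "w \<cdot> g = x" using w(2) by simp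
  qed
qed

text \<open>Only third components can be filled, so the trivial triangle and the given one are both
  rotated. The required map then appears suspended, with a sign on either side, and is recovered by
  desuspension.\<close>

lemma triangle_weak_kernel:
  assumes t: "(f, g, h) \<in> triangles T" and s: "trg T s = trg T f" "g \<cdot> s = zer T (src T s) (trg T g)"
  obtains r where "r \<in> Mor T (src T s) (src T f)" "f \<cdot> r = s"
proof -
  obtain Z where Z: "zero_object T Z" using ex_zero_object by auto
  let ?S = "src T s"
  have "(idn T ?S, zer T ?S Z, zer T Z (susO T ?S)) \<in> triangles T"
    using Z by (rule triangle_idn)
  note t0 = triangle_rotateD [OF this]
  have "\<exists>w \<in> Mor T (src T (neg_mor T (susM T (idn T ?S)))) (src T (neg_mor T (susM T f))).
      w \<cdot> zer T Z (susO T ?S) = h \<cdot> zer T Z (src T h) \<and>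
      susM T s \<cdot> neg_mor T (susM T (idn T ?S)) = neg_mor T (susM T f) \<cdot> w"
    by (rule triangle_fill [OF t0 triangle_rotateD [OF t]])
      (use s triangle_typing [OF t] in \<open>simp_all add: Mor_iff\<close>)
  then obtain w where w: "src T w = susO T ?S" "trg T w = susO T (src T f)"
      "susM T s \<cdot> neg_mor T (idn T (susO T ?S)) = neg_mor T (susM T f) \<cdot> w"
    by (auto simp: Mor_iff sus_idn)
  obtain r where r: "r \<in> Mor T ?S (src T f)" "susM T r = w"
    using sus_full [of w ?S "src T f"] w by (auto simp: Mor_iff)
  have "neg_mor T (susM T s) = neg_mor T (susM T f \<cdot> w)"
    using w s by simp
  then have "susM T s = susM T (f \<cdot> r)"
    using r by (auto dest: neg_inject simp: Mor_iff)
  then have "f \<cdot> r = s" using sus_faithful by metis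
  with r(1) show ?thesis by (rule that)
qed

end

section \<open>Monoidal coherence\<close>

context symmetric_monoidal_category
begin

lemma src_ten [simp]: "src T (f \<diamondop> g) = src T f \<boxtimes> src T g"
  and trg_ten [simp]: "trg T (f \<diamondop> g) = trg T f \<boxtimes> trg T g"
  using ten_Mor [of f "src T f" "trg T f" g "src T g" "trg T g"] by (auto simp: Mor_iff)

lemma ten_cmp_ten:
  "\<lbrakk>trg T f = src T f'; trg T g = src T g'\<rbrakk> \<Longrightarrow> (f' \<diamondop> g') \<cdot> (f \<diamondop> g) = (f' \<cdot> f) \<diamondop> (g' \<cdot> g)"
  using ten_cmp [of f "src T f" "trg T f" f' "trg T f'" g "src T g" "trg T g" g' "trg T g'"]
  by (simp add: Mor_iff)

lemma ten_cmp_ten_cmp: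
  "\<lbrakk>trg T f = src T f'; trg T g = src T g'; trg T k = src T f \<boxtimes> src T g\<rbrakk>
    \<Longrightarrow> (f' \<diamondop> g') \<cdot> ((f \<diamondop> g) \<cdot> k) = ((f' \<cdot> f) \<diamondop> (g' \<cdot> g)) \<cdot> k"
  by (simp add: ten_cmp_ten flip: cmp_cmp)

lemmas interchange = ten_cmp_ten ten_cmp_ten_cmp

lemma is_iso_ten [simp]: "\<lbrakk>is_iso T f; is_iso T g\<rbrakk> \<Longrightarrow> is_iso T (f \<diamondop> g)"
  by (rule is_isoI [where g = "inverse_mor T f \<diamondop> inverse_mor T g"]) (auto simp: ten_cmp_ten ten_idn)

lemma src_assc [simp]: "src T (assc T X Y Z) = (X \<boxtimes> Y) \<boxtimes> Z"
  and trg_assc [simp]: "trg T (assc T X Y Z) = X \<boxtimes> (Y \<boxtimes> Z)"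
  and is_iso_assc [simp]: "is_iso T (assc T X Y Z)"
  and src_lunit [simp]: "src T (lunit T X) = unit T \<boxtimes> X"
  and trg_lunit [simp]: "trg T (lunit T X) = X"
  and is_iso_lunit [simp]: "is_iso T (lunit T X)"
  and src_runit [simp]: "src T (runit T X) = X \<boxtimes> unit T"
  and trg_runit [simp]: "trg T (runit T X) = X"
  and is_iso_runit [simp]: "is_iso T (runit T X)"
  and src_swap [simp]: "src T (swap T X Y) = X \<boxtimes> Y"
  and trg_swap [simp]: "trg T (swap T X Y) = Y \<boxtimes> X"
  using assc_Iso [of X Y Z] lunit_Iso [of X] runit_Iso [of X] swap_Mor [of X Y]
  by (auto simp: Iso_def Mor_iff)

lemma is_iso_swap [simp]: "is_iso T (swap T X Y)"
  by (rule is_isoI [where g = "swap T Y X"]) (auto simp: swap_swap)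

lemma swap_swap_cmp [simp]: "trg T k = X \<boxtimes> Y \<Longrightarrow> swap T Y X \<cdot> (swap T X Y \<cdot> k) = k"
  by (simp add: swap_swap flip: cmp_cmp)

lemma assc_natural:
  "\<lbrakk>trg T f = X; trg T g = Y; trg T h = Z\<rbrakk> \<Longrightarrow>
    assc T X Y Z \<cdot> ((f \<diamondop> g) \<diamondop> h) = (f \<diamondop> (g \<diamondop> h)) \<cdot> assc T (src T f) (src T g) (src T h)"
  by (rule assc_nat) (auto simp: Mor_iff)

lemma assc_natural_cmp:
  "\<lbrakk>trg T f = X; trg T g = Y; trg T h = Z; trg T k = (src T f \<boxtimes> src T g) \<boxtimes> src T h\<rbrakk> \<Longrightarrow>
    assc T X Y Z \<cdot> (((f \<diamondop> g) \<diamondop> h) \<cdot> k)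
      = (f \<diamondop> (g \<diamondop> h)) \<cdot> (assc T (src T f) (src T g) (src T h) \<cdot> k)"
  using assc_natural [of f X g Y h Z] by (simp flip: cmp_cmp)

lemma swap_natural:
  "\<lbrakk>trg T f = X; trg T g = Y\<rbrakk> \<Longrightarrow> swap T X Y \<cdot> (f \<diamondop> g) = (g \<diamondop> f) \<cdot> swap T (src T f) (src T g)"
  by (rule swap_nat) (auto simp: Mor_iff)

lemma swap_natural_cmp:
  "\<lbrakk>trg T f = X; trg T g = Y; trg T k = src T f \<boxtimes> src T g\<rbrakk>
    \<Longrightarrow> swap T X Y \<cdot> ((f \<diamondop> g) \<cdot> k) = (g \<diamondop> f) \<cdot> (swap T (src T f) (src T g) \<cdot> k)"
  using swap_natural [of f X g Y] by (simp flip: cmp_cmp)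

lemma lunit_natural: "trg T f = X \<Longrightarrow> lunit T X \<cdot> (idn T (unit T) \<diamondop> f) = f \<cdot> lunit T (src T f)"
  by (rule lunit_nat) (auto simp: Mor_iff)

lemma lunit_natural_cmp:
  "\<lbrakk>trg T f = X; trg T k = unit T \<boxtimes> src T f\<rbrakk>
    \<Longrightarrow> lunit T X \<cdot> ((idn T (unit T) \<diamondop> f) \<cdot> k) = f \<cdot> (lunit T (src T f) \<cdot> k)"
  using lunit_natural [of f X] by (simp flip: cmp_cmp)

lemma runit_natural: "trg T f = X \<Longrightarrow> runit T X \<cdot> (f \<diamondop> idn T (unit T)) = f \<cdot> runit T (src T f)"
  by (rule runit_nat) (auto simp: Mor_iff)

text \<open>The natural isomorphism \<open>lunit\<close> conjugates
  \<open>\<one> \<otimes> f\<close> into \<open>f\<close>.\<close>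

lemma unit_ten_faithful:
  assumes "idn T (unit T) \<diamondop> f = idn T (unit T) \<diamondop> g" "src T f = src T g" "trg T f = trg T g"
  shows "f = g"
proof (rule iso_cancel_right)
  show "f \<cdot> lunit T (src T f) = g \<cdot> lunit T (src T f)"
    using lunit_natural [of f] lunit_natural [of g] assms by auto
qed (use assms in auto)

lemma ten_unit_faithful:
  assumes "f \<diamondop> idn T (unit T) = g \<diamondop> idn T (unit T)" "src T f = src T g" "trg T f = trg T g"
  shows "f = g"
proof (rule iso_cancel_right)
  show "f \<cdot> runit T (src T f) = g \<cdot> runit T (src T f)"
    using runit_natural [of f] runit_natural [of g] assms by auto
qed (use assms in auto)

text \<open>Kelly's argument: both sides agree after \<open>\<one> \<otimes> -\<close> and precomposition with associators.\<close>

lemma lunit_ten: "lunit T (X \<boxtimes> Y) \<cdot> assc T (unit T) X Y = lunit T X \<diamondop> idn T Y"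
proof (rule unit_ten_faithful)
  let ?U = "unit T"
  let ?k = "assc T ?U (?U \<boxtimes> X) Y \<cdot> (assc T ?U ?U X \<diamondop> idn T Y)"
  show "idn T ?U \<diamondop> (lunit T (X \<boxtimes> Y) \<cdot> assc T ?U X Y) = idn T ?U \<diamondop> (lunit T X \<diamondop> idn T Y)"
  proof (rule iso_cancel_right)
    have "(idn T ?U \<diamondop> (lunit T (X \<boxtimes> Y) \<cdot> assc T ?U X Y)) \<cdot> ?k
        = (idn T ?U \<diamondop> lunit T (X \<boxtimes> Y)) \<cdot> ((idn T ?U \<diamondop> assc T ?U X Y) \<cdot> ?k)"
      by (simp add: interchange)
    also have "\<dots> = (idn T ?U \<diamondop> lunit T (X \<boxtimes> Y)) \<cdot> (assc T ?U ?U (X \<boxtimes> Y) \<cdot> assc T (?U \<boxtimes> ?U) X Y)"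
      using pentagon [of ?U ?U X Y] by simp
    also have "\<dots> = (runit T ?U \<diamondop> idn T (X \<boxtimes> Y)) \<cdot> assc T (?U \<boxtimes> ?U) X Y"
      using unit_triangle [of ?U "X \<boxtimes> Y"] by (simp flip: cmp_cmp)
    also have "\<dots> = assc T ?U X Y \<cdot> ((runit T ?U \<diamondop> idn T X) \<diamondop> idn T Y)"
      by (simp add: assc_natural ten_idn)
    also have "\<dots> = assc T ?U X Y \<cdot> (((idn T ?U \<diamondop> lunit T X) \<diamondop> idn T Y) \<cdot> (assc T ?U ?U X \<diamondop> idn T Y))"
      by (simp add: ten_cmp_ten unit_triangle)
    also have "\<dots> = (idn T ?U \<diamondop> (lunit T X \<diamondop> idn T Y)) \<cdot> ?k"
      by (simp add: assc_natural_cmp)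
    finally show "(idn T ?U \<diamondop> (lunit T (X \<boxtimes> Y) \<cdot> assc T ?U X Y)) \<cdot> ?k
        = (idn T ?U \<diamondop> (lunit T X \<diamondop> idn T Y)) \<cdot> ?k" .
  qed auto
qed auto

text \<open>
  Turning elements \<open>\<one> \<rightarrow> A \<otimes> B\<close> into natural families \<open>W \<rightarrow> A \<otimes> (B \<otimes> W)\<close> reduces the triangle identities
  of a dual pair to those of the adjunction between \<open>P \<otimes> -\<close> and \<open>DP \<otimes> -\<close>.
\<close>

definition extend :: "'o \<Rightarrow> 'o \<Rightarrow> 'm \<Rightarrow> 'o \<Rightarrow> 'm" where
  "extend A B x W = assc T A B W \<cdot> ((x \<diamondop> idn T W) \<cdot> inverse_mor T (lunit T W))"

lemma
  assumes "x \<in> Mor T (unit T) (A \<boxtimes> B)"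
  shows src_extend: "src T (extend A B x W) = W"
    and trg_extend: "trg T (extend A B x W) = A \<boxtimes> (B \<boxtimes> W)"
  using assms by (auto simp: extend_def Mor_iff)

lemma inverse_lunit_natural:
  "src T f = W \<Longrightarrow> inverse_mor T (lunit T (trg T f)) \<cdot> f
    = (idn T (unit T) \<diamondop> f) \<cdot> inverse_mor T (lunit T W)"
  by (rule iso_cancel_left [where f = "lunit T (trg T f)"])
    (auto simp: lunit_natural_cmp)

lemma extend_natural:
  assumes "x \<in> Mor T (unit T) (A \<boxtimes> B)"
  shows "extend A B x (trg T f) \<cdot> f = (idn T A \<diamondop> (idn T B \<diamondop> f)) \<cdot> extend A B x (src T f)"
proof -
  have "extend A B x (trg T f) \<cdot> f
      = assc T A B (trg T f) \<cdot> ((x \<diamondop> idn T (trg T f)) \<cdot> ((idn T (unit T) \<diamondop> f) \<cdot> inverse_mor T (lunit T (src T f))))"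
    using assms by (simp add: extend_def Mor_iff inverse_lunit_natural [of f "src T f"])
  also have "\<dots> = assc T A B (trg T f) \<cdot> (((idn T A \<diamondop> idn T B) \<diamondop> f)
      \<cdot> ((x \<diamondop> idn T (src T f)) \<cdot> inverse_mor T (lunit T (src T f))))"
    using assms by (simp add: interchange Mor_iff ten_idn)
  also have "\<dots> = (idn T A \<diamondop> (idn T B \<diamondop> f)) \<cdot> extend A B x (src T f)"
    using assms by (simp add: extend_def Mor_iff assc_natural_cmp)
  finally show ?thesis .
qed

lemma extend_cmp:
  assumes "x \<in> Mor T (unit T) (A \<boxtimes> B)" "src T f = A" "src T g = B"
  shows "extend (trg T f) (trg T g) ((f \<diamondop> g) \<cdot> x) W = (f \<diamondop> (g \<diamondop> idn T W)) \<cdot> extend A B x W"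
proof -
  have "(((f \<diamondop> g) \<cdot> x) \<diamondop> idn T W) = ((f \<diamondop> g) \<diamondop> idn T W) \<cdot> (x \<diamondop> idn T W)"
    using assms by (simp add: ten_cmp_ten Mor_iff)
  then show ?thesis using assms by (simp add: extend_def Mor_iff assc_natural_cmp)
qed

text \<open>At the unit only isomorphisms and \<open>- \<otimes> \<one>\<close> intervene, and the
  latter is faithful. So one member of the family determines the element.\<close>

lemma extend_inject:
  assumes "extend A B x (unit T) = extend A B y (unit T)"
    "x \<in> Mor T (unit T) (A \<boxtimes> B)" "y \<in> Mor T (unit T) (A \<boxtimes> B)"
  shows "x = y"
proof (rule ten_unit_faithful)
  let ?l = "inverse_mor T (lunit T (unit T))"
  have eq: "(x \<diamondop> idn T (unit T)) \<cdot> ?l = (y \<diamondop> idn T (unit T)) \<cdot> ?l"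
    using assms(2,3)
    by (intro iso_cancel_left [OF is_iso_assc assms(1) [unfolded extend_def]]) (auto simp: Mor_iff)
  show "x \<diamondop> idn T (unit T) = y \<diamondop> idn T (unit T)"
    by (rule iso_cancel_right [OF _ eq]) (use assms(2,3) in \<open>auto simp: Mor_iff\<close>)
qed (use assms(2,3) in \<open>auto simp: Mor_iff\<close>)

text \<open>The family is also compatible with tensoring on the right: the pentagon moves the
  associators past \<open>x\<close>, and \<open>lunit_ten\<close> matches the unitors.\<close>

lemma extend_ten:
  assumes "x \<in> Mor T (unit T) (A \<boxtimes> B)"
  shows "extend A B x (V \<boxtimes> W)
    = (idn T A \<diamondop> assc T B V W) \<cdot> (assc T A (B \<boxtimes> V) W \<cdot> (extend A B x V \<diamondop> idn T W))"
proof -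
  let ?U = "unit T"
  let ?l = "inverse_mor T (lunit T V) \<diamondop> idn T W"
  have "extend A B x V \<diamondop> idn T W
      = (assc T A B V \<diamondop> idn T W) \<cdot> (((x \<diamondop> idn T V) \<diamondop> idn T W) \<cdot> ?l)"
    using assms by (simp add: extend_def interchange Mor_iff)
  then have "(idn T A \<diamondop> assc T B V W) \<cdot> (assc T A (B \<boxtimes> V) W \<cdot> (extend A B x V \<diamondop> idn T W))
      = ((idn T A \<diamondop> assc T B V W) \<cdot> (assc T A (B \<boxtimes> V) W \<cdot> (assc T A B V \<diamondop> idn T W)))
        \<cdot> (((x \<diamondop> idn T V) \<diamondop> idn T W) \<cdot> ?l)"
    using assms by (simp add: Mor_iff)
  also have "(idn T A \<diamondop> assc T B V W) \<cdot> (assc T A (B \<boxtimes> V) W \<cdot> (assc T A B V \<diamondop> idn T W))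
      = assc T A B (V \<boxtimes> W) \<cdot> assc T (A \<boxtimes> B) V W"
    using pentagon [of A B V W] by simp
  also have "(assc T A B (V \<boxtimes> W) \<cdot> assc T (A \<boxtimes> B) V W) \<cdot> (((x \<diamondop> idn T V) \<diamondop> idn T W) \<cdot> ?l)
      = assc T A B (V \<boxtimes> W) \<cdot> ((x \<diamondop> idn T (V \<boxtimes> W)) \<cdot> (assc T ?U V W \<cdot> ?l))"
    using assms by (simp add: assc_natural_cmp Mor_iff ten_idn)
  also have "assc T ?U V W \<cdot> ?l = inverse_mor T (lunit T (V \<boxtimes> W))"
    by (rule iso_cancel_left [of "lunit T (V \<boxtimes> W)"])
      (auto simp: lunit_ten ten_cmp_ten ten_idn simp flip: cmp_cmp)
  finally show ?thesis by (simp add: extend_def)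
qed

end

section \<open>Rigid objects\<close>

context closed_symmetric_monoidal_category
begin

lemma src_ev [simp]: "src T (ev T X Y) = ihom T X Y \<boxtimes> X"
  and trg_ev [simp]: "trg T (ev T X Y) = Y"
  using ev_Mor [of X Y] by (auto simp: Mor_iff)

lemma ev_cancel:
  "\<lbrakk>ev T X Y \<cdot> (g \<diamondop> idn T X) = ev T X Y \<cdot> (h \<diamondop> idn T X);
    g \<in> Mor T A (ihom T X Y); h \<in> Mor T A (ihom T X Y)\<rbrakk> \<Longrightarrow> g = h"
  using ev_universal [of "ev T X Y \<cdot> (h \<diamondop> idn T X)" A X Y] by (auto simp: Mor_iff)

lemma
  assumes "f \<in> Mor T (A \<boxtimes> X) Y"
  shows transpose_Mor: "transpose T A X Y f \<in> Mor T A (ihom T X Y)"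
    and ev_transpose: "ev T X Y \<cdot> (transpose T A X Y f \<diamondop> idn T X) = f"
  using theI' [OF ev_universal [OF assms]] unfolding transpose_def by auto

lemma ihomM_Mor:
  "\<lbrakk>u \<in> Mor T X' X; v \<in> Mor T Y Y'\<rbrakk> \<Longrightarrow> ihomM T u v \<in> Mor T (ihom T X Y) (ihom T X' Y')"
  using transpose_Mor [of "v \<cdot> ev T X Y \<cdot> (idn T (ihom T X Y) \<diamondop> u)" "ihom T X Y" X' Y']
  by (auto simp: ihomM_def Let_def Mor_iff)

lemma src_dualM [simp]: "src T (dualM T u) = dualO T (trg T u)"
  and trg_dualM [simp]: "trg T (dualM T u) = dualO T (src T u)"
  using ihomM_Mor [of u "src T u" "trg T u" "idn T (unit T)" "unit T" "unit T"]
  by (auto simp: dualM_def dualO_def Mor_iff)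

lemma ev_dualM:
  "ev T (src T u) (unit T) \<cdot> (dualM T u \<diamondop> idn T (src T u))
    = ev T (trg T u) (unit T) \<cdot> (idn T (dualO T (trg T u)) \<diamondop> u)"
  using ev_transpose [of "ev T (trg T u) (unit T) \<cdot> (idn T (dualO T (trg T u)) \<diamondop> u)"
      "dualO T (trg T u)" "src T u" "unit T"]
  by (simp add: dualM_def ihomM_def Let_def dualO_def Mor_iff)

section \<open>Contraction against the dual, coevaluation and triangle identities\<close>

definition pairing :: "'o \<Rightarrow> 'm" where
  "pairing P = ev T P (unit T) \<cdot> swap T P (dualO T P)"

text \<open>For rigid \<open>P\<close> this is the counit of the adjunction between
  \<open>P \<otimes> -\<close> and \<open>DP \<otimes> -\<close>; \<open>contract_surj\<close> and
  \<open>contract_cancel\<close> are its universal property.\<close>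

definition contract :: "'o \<Rightarrow> 'o \<Rightarrow> 'm" where
  "contract P Y = lunit T Y \<cdot> ((pairing P \<diamondop> idn T Y) \<cdot> inverse_mor T (assc T P (dualO T P) Y))"

lemma ihom_unit [simp]: "ihom T X (unit T) = dualO T X"
  by (simp add: dualO_def)

lemma src_pairing [simp]: "src T (pairing P) = P \<boxtimes> dualO T P"
  and trg_pairing [simp]: "trg T (pairing P) = unit T"
  by (auto simp: pairing_def)

lemma src_contract [simp]: "src T (contract P Y) = P \<boxtimes> (dualO T P \<boxtimes> Y)"
  and trg_contract [simp]: "trg T (contract P Y) = Y"
  by (auto simp: contract_def)

text \<open>The dinaturality \<open>ev_dualM\<close> of evaluation, carried through the
  symmetry.\<close>

lemma pairing_dualM:
  "pairing (src T u) \<cdot> (idn T (src T u) \<diamondop> dualM T u)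
    = pairing (trg T u) \<cdot> (u \<diamondop> idn T (dualO T (trg T u)))"
proof -
  have "pairing (src T u) \<cdot> (idn T (src T u) \<diamondop> dualM T u)
      = (ev T (src T u) (unit T) \<cdot> (dualM T u \<diamondop> idn T (src T u))) \<cdot> swap T (src T u) (dualO T (trg T u))"
    by (simp add: pairing_def swap_natural)
  also have "\<dots> = pairing (trg T u) \<cdot> (u \<diamondop> idn T (dualO T (trg T u)))"
    unfolding ev_dualM by (simp add: pairing_def swap_natural)
  finally show ?thesis .
qed

lemma contract_assc: "contract P Y \<cdot> assc T P (dualO T P) Y = lunit T Y \<cdot> (pairing P \<diamondop> idn T Y)"
  by (simp add: contract_def)

lemma contract_assc_cmp:
  "trg T k = (P \<boxtimes> dualO T P) \<boxtimes> Y \<Longrightarrow>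
    contract P Y \<cdot> (assc T P (dualO T P) Y \<cdot> k) = lunit T Y \<cdot> ((pairing P \<diamondop> idn T Y) \<cdot> k)"
  by (simp add: contract_def)

lemma contract_eqI:
  "\<lbrakk>f \<cdot> assc T P (dualO T P) Y = g \<cdot> assc T P (dualO T P) Y;
    src T f = P \<boxtimes> (dualO T P \<boxtimes> Y); src T g = P \<boxtimes> (dualO T P \<boxtimes> Y)\<rbrakk> \<Longrightarrow> f = g"
  by (rule iso_cancel_right [OF is_iso_assc]) simp_all

lemma contract_natural:
  "contract P (trg T f) \<cdot> (idn T P \<diamondop> (idn T (dualO T P) \<diamondop> f)) = f \<cdot> contract P (src T f)"
proof (rule contract_eqI)
  let ?Q = "dualO T P"
  have "contract P (trg T f) \<cdot> ((idn T P \<diamondop> (idn T ?Q \<diamondop> f)) \<cdot> assc T P ?Q (src T f))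
      = contract P (trg T f) \<cdot> (assc T P ?Q (trg T f) \<cdot> ((idn T P \<diamondop> idn T ?Q) \<diamondop> f))"
    by (simp add: assc_natural)
  also have "\<dots> = f \<cdot> (lunit T (src T f) \<cdot> (pairing P \<diamondop> idn T (src T f)))"
    by (simp add: contract_assc_cmp interchange ten_idn flip: lunit_natural_cmp)
  finally show "(contract P (trg T f) \<cdot> (idn T P \<diamondop> (idn T ?Q \<diamondop> f))) \<cdot> assc T P ?Q (src T f)
      = (f \<cdot> contract P (src T f)) \<cdot> assc T P ?Q (src T f)"
    by (simp add: contract_assc)
qed auto

text \<open>The counterpart of \<open>extend_ten\<close> for the contraction, again by the pentagon
  and \<open>lunit_ten\<close>.\<close>

lemma contract_ten:
  "contract P (V \<boxtimes> W) \<cdot> ((idn T P \<diamondop> assc T (dualO T P) V W) \<cdot> assc T P (dualO T P \<boxtimes> V) W)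
    = contract P V \<diamondop> idn T W"
proof (rule iso_cancel_right)
  let ?Q = "dualO T P"
  let ?k = "assc T P ?Q V \<diamondop> idn T W"
  have "(contract P (V \<boxtimes> W) \<cdot> ((idn T P \<diamondop> assc T ?Q V W) \<cdot> assc T P (?Q \<boxtimes> V) W)) \<cdot> ?k
      = contract P (V \<boxtimes> W) \<cdot> (assc T P ?Q (V \<boxtimes> W) \<cdot> assc T (P \<boxtimes> ?Q) V W)"
    using pentagon [of P ?Q V W] by simp
  also have "\<dots> = lunit T (V \<boxtimes> W) \<cdot> ((pairing P \<diamondop> (idn T V \<diamondop> idn T W)) \<cdot> assc T (P \<boxtimes> ?Q) V W)"
    by (simp add: contract_assc_cmp ten_idn)
  also have "\<dots> = (lunit T (V \<boxtimes> W) \<cdot> assc T (unit T) V W) \<cdot> ((pairing P \<diamondop> idn T V) \<diamondop> idn T W)"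
    by (simp add: assc_natural)
  also have "\<dots> = (contract P V \<diamondop> idn T W) \<cdot> ?k"
    by (simp add: lunit_ten ten_cmp_ten contract_assc)
  finally show "(contract P (V \<boxtimes> W) \<cdot> ((idn T P \<diamondop> assc T ?Q V W) \<cdot> assc T P (?Q \<boxtimes> V) W)) \<cdot> ?k
      = (contract P V \<diamondop> idn T W) \<cdot> ?k" .
qed auto

text \<open>The map whose transpose is \<^const>\<open>rigid_map\<close>.\<close>

lemma contract_swap:
  "lunit T Y \<cdot> (ev T P (unit T) \<diamondop> idn T Y) \<cdot> inverse_mor T (assc T (dualO T P) P Y)
      \<cdot> (idn T (dualO T P) \<diamondop> swap T Y P) \<cdot> assc T (dualO T P) Y P
    = contract P Y \<cdot> swap T (dualO T P \<boxtimes> Y) P" (is "?f = _")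
proof (rule iso_cancel_right)
  let ?Q = "dualO T P"
  \<comment> \<open>Precomposition with \<open>?k\<close> creates the left side of the hexagon for
    \<open>P\<close>, \<open>?Q\<close> and \<open>Y\<close>.\<close>
  let ?k = "swap T P (?Q \<boxtimes> Y) \<cdot> assc T P ?Q Y"
  have "?f \<cdot> ?k = (lunit T Y \<cdot> ((ev T P (unit T) \<diamondop> idn T Y) \<cdot> (inverse_mor T (assc T ?Q P Y)
      \<cdot> (idn T ?Q \<diamondop> swap T Y P)))) \<cdot> (assc T ?Q Y P \<cdot> swap T P (?Q \<boxtimes> Y) \<cdot> assc T P ?Q Y)"
    by simp
  also have "\<dots> = lunit T Y \<cdot> (pairing P \<diamondop> idn T Y)"
    unfolding hexagon by (simp add: interchange pairing_def swap_swap ten_idn)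
  also have "\<dots> = (contract P Y \<cdot> swap T (?Q \<boxtimes> Y) P) \<cdot> ?k"
    by (simp add: contract_assc)
  finally show "?f \<cdot> ?k = (contract P Y \<cdot> swap T (?Q \<boxtimes> Y) P) \<cdot> ?k" .
qed auto

lemma rigid_map_Mor: "rigid_map T P Y \<in> Mor T (dualO T P \<boxtimes> Y) (ihom T P Y)"
  unfolding rigid_map_def contract_swap by (rule transpose_Mor) (auto simp: Mor_iff)

lemma src_rigid_map [simp]: "src T (rigid_map T P Y) = dualO T P \<boxtimes> Y"
  and trg_rigid_map [simp]: "trg T (rigid_map T P Y) = ihom T P Y"
  using rigid_map_Mor [of P Y] by (auto simp: Mor_iff)

lemma ev_rigid_map:
  "ev T P Y \<cdot> (rigid_map T P Y \<diamondop> idn T P) = contract P Y \<cdot> swap T (dualO T P \<boxtimes> Y) P"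
  unfolding rigid_map_def contract_swap by (rule ev_transpose) (auto simp: Mor_iff)

text \<open>Translates evaluation, which has a universal property by closedness, into contraction.
  When \<open>rigid_map\<close> is invertible, the universal property passes over.\<close>

lemma ev_rigid_map_swap:
  assumes "s \<in> Mor T W (dualO T P \<boxtimes> Y)"
  shows "ev T P Y \<cdot> ((rigid_map T P Y \<cdot> s) \<diamondop> idn T P) = (contract P Y \<cdot> (idn T P \<diamondop> s)) \<cdot> swap T W P"
proof -
  have "ev T P Y \<cdot> ((rigid_map T P Y \<cdot> s) \<diamondop> idn T P)
      = (ev T P Y \<cdot> (rigid_map T P Y \<diamondop> idn T P)) \<cdot> (s \<diamondop> idn T P)"
    using assms by (simp add: Mor_iff ten_cmp_ten)
  also have "\<dots> = (contract P Y \<cdot> (idn T P \<diamondop> s)) \<cdot> swap T W P"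
    unfolding ev_rigid_map using assms by (simp add: Mor_iff swap_natural)
  finally show ?thesis .
qed

text \<open>Existence half of the universal property: transpose \<open>f\<close>, with its factors
  swapped, to a map into \<open>F(P, Y)\<close> and go back along the isomorphism
  \<open>rigid_map\<close>.\<close>

lemma contract_surj:
  assumes P: "P \<in> rigids T" and f: "f \<in> Mor T (P \<boxtimes> W) Y"
  obtains s where "s \<in> Mor T W (dualO T P \<boxtimes> Y)" "contract P Y \<cdot> (idn T P \<diamondop> s) = f"
proof -
  let ?r = "rigid_map T P Y"
  have r: "is_iso T ?r" using P by (simp add: rigids_def)
  have fs: "f \<cdot> swap T W P \<in> Mor T (W \<boxtimes> P) Y" using f by (simp add: Mor_iff)
  define g where "g = transpose T W P Y (f \<cdot> swap T W P)"
  have g: "g \<in> Mor T W (ihom T P Y)" "ev T P Y \<cdot> (g \<diamondop> idn T P) = f \<cdot> swap T W P"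
    unfolding g_def using transpose_Mor [OF fs] ev_transpose [OF fs] by auto
  define s where "s = inverse_mor T ?r \<cdot> g"
  have s: "s \<in> Mor T W (dualO T P \<boxtimes> Y)" using g(1) r by (simp add: s_def Mor_iff)
  have "(contract P Y \<cdot> (idn T P \<diamondop> s)) \<cdot> swap T W P = f \<cdot> swap T W P"
    using ev_rigid_map_swap [OF s] g r by (simp add: s_def Mor_iff)
  then have "contract P Y \<cdot> (idn T P \<diamondop> s) = f"
    by (rule iso_cancel_right [OF is_iso_swap]) (use s f in \<open>auto simp: Mor_iff\<close>)
  with s show ?thesis by (rule that)
qed

text \<open>Uniqueness half, from the uniqueness of transposes and the injectivity of composition
  with \<open>rigid_map\<close>.\<close>

lemma contract_cancel:
  assumes P: "P \<in> rigids T"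
    and eq: "contract P Y \<cdot> (idn T P \<diamondop> s) = contract P Y \<cdot> (idn T P \<diamondop> t)"
    and s: "s \<in> Mor T W (dualO T P \<boxtimes> Y)" and t: "t \<in> Mor T W (dualO T P \<boxtimes> Y)"
  shows "s = t"
proof -
  let ?r = "rigid_map T P Y"
  have r: "is_iso T ?r" using P by (simp add: rigids_def)
  have "?r \<cdot> s = ?r \<cdot> t"
  proof (rule ev_cancel)
    show "ev T P Y \<cdot> ((?r \<cdot> s) \<diamondop> idn T P) = ev T P Y \<cdot> ((?r \<cdot> t) \<diamondop> idn T P)"
      by (simp only: ev_rigid_map_swap [OF s] ev_rigid_map_swap [OF t] eq)
  qed (use s t in \<open>auto simp: Mor_iff\<close>)
  then show ?thesis
    by (rule iso_cancel_left [OF r]) (use s t in \<open>auto simp: Mor_iff\<close>)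
qed

text \<open>The coevaluation \<open>\<one> \<rightarrow> DP \<otimes> P\<close>, encoded as the
  adjoint of the right unitor; the defining equation is the first triangle identity at the
  unit.\<close>

definition coev :: "'o \<Rightarrow> 'm" where
  "coev P = (THE c. c \<in> Mor T (unit T) (dualO T P \<boxtimes> P) \<and> contract P P \<cdot> (idn T P \<diamondop> c) = runit T P)"

lemma
  assumes P: "P \<in> rigids T"
  shows coev_Mor: "coev P \<in> Mor T (unit T) (dualO T P \<boxtimes> P)"
    and contract_coev: "contract P P \<cdot> (idn T P \<diamondop> coev P) = runit T P"
proof -
  have "\<exists>!c. c \<in> Mor T (unit T) (dualO T P \<boxtimes> P) \<and> contract P P \<cdot> (idn T P \<diamondop> c) = runit T P"
  proof (rule ex_ex1I)
    show "\<exists>c. c \<in> Mor T (unit T) (dualO T P \<boxtimes> P) \<and> contract P P \<cdot> (idn T P \<diamondop> c) = runit T P"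
      by (rule contract_surj [OF P, of "runit T P" "unit T" P]) (auto simp: Mor_iff)
  qed (rule contract_cancel [OF P, of P _ _ "unit T"], auto)
  from theI' [OF this] show "coev P \<in> Mor T (unit T) (dualO T P \<boxtimes> P)"
    "contract P P \<cdot> (idn T P \<diamondop> coev P) = runit T P" unfolding coev_def by auto
qed

text \<open>The first triangle identity for arbitrary \<open>W\<close>. After precomposition with an
  isomorphism, \<open>contract_ten\<close> splits off the factor \<open>W\<close> and leaves the
  defining equation of \<open>coev\<close>.\<close>

lemma contract_coev_dual:
  assumes P: "P \<in> rigids T"
  shows "contract P (P \<boxtimes> W) \<cdot> (idn T P \<diamondop> extend (dualO T P) P (coev P) W) = idn T (P \<boxtimes> W)"
proof (rule iso_cancel_right)
  let ?Q = "dualO T P" and ?U = "unit T"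
  note c = coev_Mor [OF P]
  have "(contract P (P \<boxtimes> W) \<cdot> (idn T P \<diamondop> extend ?Q P (coev P) W))
      \<cdot> ((idn T P \<diamondop> lunit T W) \<cdot> assc T P ?U W)
      = contract P (P \<boxtimes> W) \<cdot> ((idn T P \<diamondop> assc T ?Q P W) \<cdot> ((idn T P \<diamondop> (coev P \<diamondop> idn T W)) \<cdot> assc T P ?U W))"
    using c by (simp add: interchange extend_def Mor_iff)
  also have "\<dots> = (contract P (P \<boxtimes> W) \<cdot> ((idn T P \<diamondop> assc T ?Q P W) \<cdot> assc T P (?Q \<boxtimes> P) W))
      \<cdot> ((idn T P \<diamondop> coev P) \<diamondop> idn T W)"
    using c by (simp add: assc_natural Mor_iff)
  also have "\<dots> = (contract P P \<cdot> (idn T P \<diamondop> coev P)) \<diamondop> idn T W"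
    unfolding contract_ten using c by (simp add: interchange Mor_iff)
  also have "\<dots> = idn T (P \<boxtimes> W) \<cdot> ((idn T P \<diamondop> lunit T W) \<cdot> assc T P ?U W)"
    unfolding contract_coev [OF P] by (simp add: unit_triangle)
  finally show "(contract P (P \<boxtimes> W) \<cdot> (idn T P \<diamondop> extend ?Q P (coev P) W))
      \<cdot> ((idn T P \<diamondop> lunit T W) \<cdot> assc T P ?U W)
      = idn T (P \<boxtimes> W) \<cdot> ((idn T P \<diamondop> lunit T W) \<cdot> assc T P ?U W)" .
qed (use src_extend [OF coev_Mor [OF P]] trg_extend [OF coev_Mor [OF P]] in \<open>auto\<close>)

text \<open>The second triangle identity follows formally from the first: contract both sides with
  \<open>P\<close>, use naturality of the contraction and cancel.\<close>

lemma coev_contract_dual: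
  assumes P: "P \<in> rigids T"
  shows "(idn T (dualO T P) \<diamondop> contract P W) \<cdot> extend (dualO T P) P (coev P) (dualO T P \<boxtimes> W)
    = idn T (dualO T P \<boxtimes> W)"
proof (rule contract_cancel [OF P])
  let ?Q = "dualO T P"
  let ?c = "extend ?Q P (coev P) (?Q \<boxtimes> W)"
  note typing = src_extend [OF coev_Mor [OF P]] trg_extend [OF coev_Mor [OF P]]
  have "contract P W \<cdot> (idn T P \<diamondop> ((idn T ?Q \<diamondop> contract P W) \<cdot> ?c))
      = (contract P W \<cdot> (idn T P \<diamondop> (idn T ?Q \<diamondop> contract P W))) \<cdot> (idn T P \<diamondop> ?c)"
    by (simp add: typing interchange)
  also have "\<dots> = contract P W \<cdot> (contract P (P \<boxtimes> (?Q \<boxtimes> W)) \<cdot> (idn T P \<diamondop> ?c))"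
    using contract_natural [of P "contract P W"] by (simp add: typing)
  also have "\<dots> = contract P W \<cdot> (idn T P \<diamondop> idn T (?Q \<boxtimes> W))"
    by (simp add: contract_coev_dual [OF P] ten_idn)
  finally show "contract P W \<cdot> (idn T P \<diamondop> ((idn T ?Q \<diamondop> contract P W) \<cdot> ?c))
      = contract P W \<cdot> (idn T P \<diamondop> idn T (?Q \<boxtimes> W))" .
qed (use src_extend [OF coev_Mor [OF P]] trg_extend [OF coev_Mor [OF P]] in \<open>auto simp: Mor_iff\<close>)

text \<open>For rigid \<open>P\<close>, the map \<open>t \<mapsto> element P t\<close> identifies \<open>Hom(DP, A)\<close> with \<open>Hom(\<one>, A \<otimes> P)\<close>.\<close>

definition element :: "'o \<Rightarrow> 'm \<Rightarrow> 'm" where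
  "element P t = (t \<diamondop> idn T P) \<cdot> coev P"

lemma element_Mor:
  "\<lbrakk>P \<in> rigids T; t \<in> Mor T (dualO T P) A\<rbrakk> \<Longrightarrow> element P t \<in> Mor T (unit T) (A \<boxtimes> P)"
  using coev_Mor [of P] by (simp add: element_def Mor_iff)

lemma element_cmp:
  assumes P: "P \<in> rigids T" and t: "t \<in> Mor T (dualO T P) A" and f: "src T f = A"
  shows "element P (f \<cdot> t) = (f \<diamondop> idn T P) \<cdot> element P t"
  using coev_Mor [OF P] t f by (simp add: element_def Mor_iff interchange)

lemma extend_element:
  assumes P: "P \<in> rigids T" and t: "t \<in> Mor T (dualO T P) A"
  shows "extend A P (element P t) W
    = (t \<diamondop> (idn T P \<diamondop> idn T W)) \<cdot> extend (dualO T P) P (coev P) W"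
  using extend_cmp [OF coev_Mor [OF P], of t "idn T P"] t by (simp add: element_def Mor_iff)

text \<open>Recovers \<open>t\<close> from its element: \<open>t\<close> commutes past the
  contraction, and what remains is the second triangle identity.\<close>

lemma contract_extend_element:
  assumes P: "P \<in> rigids T" and t: "t \<in> Mor T (dualO T P) A"
  shows "(idn T A \<diamondop> contract P W) \<cdot> extend A P (element P t) (dualO T P \<boxtimes> W) = t \<diamondop> idn T W"
proof -
  let ?Q = "dualO T P"
  let ?c = "extend ?Q P (coev P) (?Q \<boxtimes> W)"
  note typing = src_extend [OF coev_Mor [OF P]] trg_extend [OF coev_Mor [OF P]]
  have "(idn T A \<diamondop> contract P W) \<cdot> extend A P (element P t) (?Q \<boxtimes> W)
      = (t \<diamondop> idn T W) \<cdot> ((idn T ?Q \<diamondop> contract P W) \<cdot> ?c)"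
    unfolding extend_element [OF P t] using t by (simp add: typing interchange Mor_iff ten_idn)
  then show ?thesis using t by (simp add: coev_contract_dual [OF P] Mor_iff)
qed

lemma element_inject:
  assumes P: "P \<in> rigids T" and eq: "element P s = element P t"
    and s: "s \<in> Mor T (dualO T P) A" and t: "t \<in> Mor T (dualO T P) A"
  shows "s = t"
proof (rule ten_unit_faithful)
  show "s \<diamondop> idn T (unit T) = t \<diamondop> idn T (unit T)"
    using contract_extend_element [OF P s, of "unit T"] contract_extend_element [OF P t, of "unit T"]
    by (simp only: eq)
qed (use s t in \<open>auto simp: Mor_iff\<close>)

lemma element_surj:
  assumes P: "P \<in> rigids T" and x: "x \<in> Mor T (unit T) (A \<boxtimes> P)"
  obtains t where "t \<in> Mor T (dualO T P) A" "element P t = x"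
proof -
  let ?Q = "dualO T P" and ?U = "unit T"
  note typing = src_extend [OF x] trg_extend [OF x]
  note ctyping = src_extend [OF coev_Mor [OF P]] trg_extend [OF coev_Mor [OF P]]
  \<comment> \<open>The preimage contracts the factor \<open>P\<close> of \<open>x\<close> against
    \<open>DP\<close>, that is, \<open>DP \<rightarrow> A \<otimes> (P \<otimes> DP) \<rightarrow> A
    \<otimes> \<one> \<rightarrow> A\<close>.\<close>
  define t where "t = runit T A \<cdot> ((idn T A \<diamondop> pairing P) \<cdot> extend A P x ?Q)"
  have t: "t \<in> Mor T ?Q A" using x by (simp add: t_def typing Mor_iff)
  \<comment> \<open>By \<open>extend_ten\<close>, a further factor \<open>W\<close> is carried along
    by the same contraction. It is needed for \<open>W = P \<otimes> \<one>\<close>, where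
    \<open>t\<close> meets the coevaluation.\<close>
  have ten: "t \<diamondop> idn T W = (idn T A \<diamondop> contract P W) \<cdot> extend A P x (?Q \<boxtimes> W)" for W
  proof -
    have "(idn T A \<diamondop> contract P W) \<cdot> extend A P x (?Q \<boxtimes> W)
        = (idn T A \<diamondop> (contract P W \<cdot> assc T P ?Q W)) \<cdot> (assc T A (P \<boxtimes> ?Q) W \<cdot> (extend A P x ?Q \<diamondop> idn T W))"
      by (simp add: extend_ten [OF x] typing interchange)
    also have "\<dots> = (idn T A \<diamondop> lunit T W) \<cdot> ((idn T A \<diamondop> (pairing P \<diamondop> idn T W)) \<cdot> (assc T A (P \<boxtimes> ?Q) W
        \<cdot> (extend A P x ?Q \<diamondop> idn T W)))"
      by (simp add: contract_assc interchange typing)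
    also have "\<dots> = ((idn T A \<diamondop> lunit T W) \<cdot> assc T A ?U W) \<cdot> (((idn T A \<diamondop> pairing P) \<diamondop> idn T W)
        \<cdot> (extend A P x ?Q \<diamondop> idn T W))"
      by (simp add: assc_natural_cmp typing)
    also have "\<dots> = t \<diamondop> idn T W"
      unfolding unit_triangle t_def by (simp add: interchange typing)
    finally show ?thesis by simp
  qed
  have "extend A P (element P t) ?U = (t \<diamondop> idn T (P \<boxtimes> ?U)) \<cdot> extend ?Q P (coev P) ?U"
    by (simp add: extend_element [OF P t] ten_idn)
  also have "\<dots> = (idn T A \<diamondop> contract P (P \<boxtimes> ?U))
      \<cdot> (extend A P x (?Q \<boxtimes> (P \<boxtimes> ?U)) \<cdot> extend ?Q P (coev P) ?U)"
    unfolding ten by (simp add: typing ctyping)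
  \<comment> \<open>Naturality of \<open>extend A P x\<close> brings the extended coevaluation next
    to the contraction, where the first triangle identity cancels the two.\<close>
  also have "\<dots> = (idn T A \<diamondop> (contract P (P \<boxtimes> ?U)
      \<cdot> (idn T P \<diamondop> extend ?Q P (coev P) ?U))) \<cdot> extend A P x ?U"
    using extend_natural [OF x, of "extend ?Q P (coev P) ?U"] by (simp add: typing ctyping interchange)
  also have "\<dots> = extend A P x ?U"
    by (simp add: contract_coev_dual [OF P] ten_idn typing)
  finally have "element P t = x"
    by (rule extend_inject) (use element_Mor [OF P t] x in \<open>auto\<close>)
  with t show ?thesis by (rule that)
qed

text \<open>It suffices to prove the dinaturality
  \<open>(Du \<otimes> C) coev C = (DP \<otimes> u) coev P\<close> of the coevaluation. After
  contraction with \<open>P\<close>, both sides become \<open>u\<close> composed with a right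
  unitor.\<close>

lemma element_dualM:
  assumes P: "P \<in> rigids T" and C: "C \<in> rigids T" and u: "u \<in> Mor T P C"
    and t: "t \<in> Mor T (dualO T P) A"
  shows "element C (t \<cdot> dualM T u) = (idn T A \<diamondop> u) \<cdot> element P t"
proof -
  let ?Q = "dualO T P" and ?U = "unit T"
  note cP = coev_Mor [OF P] and cC = coev_Mor [OF C]
  have u': "src T u = P" "trg T u = C" using u by (auto simp: Mor_iff)
  have "(dualM T u \<diamondop> idn T C) \<cdot> coev C = (idn T ?Q \<diamondop> u) \<cdot> coev P"
  proof (rule contract_cancel [OF P])
    \<comment> \<open>The dinaturality \<open>pairing_dualM\<close> with a passive factor
      \<open>C\<close> on the right.\<close>
    have k: "contract P C \<cdot> (idn T P \<diamondop> (dualM T u \<diamondop> idn T C)) = contract C C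
        \<cdot> (u \<diamondop> idn T (dualO T C \<boxtimes> C))"
    proof (rule iso_cancel_right [OF is_iso_assc])
      have "contract P C \<cdot> ((idn T P \<diamondop> (dualM T u \<diamondop> idn T C)) \<cdot> assc T P (dualO T C) C)
          = contract P C \<cdot> (assc T P ?Q C \<cdot> ((idn T P \<diamondop> dualM T u) \<diamondop> idn T C))"
        by (simp add: assc_natural u')
      also have "\<dots> = lunit T C \<cdot> ((pairing P \<cdot> (idn T P \<diamondop> dualM T u)) \<diamondop> idn T C)"
        by (simp add: contract_assc_cmp ten_cmp_ten u')
      also have "\<dots> = lunit T C \<cdot> ((pairing C \<diamondop> idn T C) \<cdot> ((u \<diamondop> idn T (dualO T C)) \<diamondop> idn T C))"
        using pairing_dualM [of u] by (simp add: u' ten_cmp_ten)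
      also have "\<dots> = contract C C \<cdot> (assc T C (dualO T C) C \<cdot> ((u \<diamondop> idn T (dualO T C)) \<diamondop> idn T C))"
        by (simp add: contract_assc_cmp u')
      also have "\<dots> = contract C C \<cdot> ((u \<diamondop> idn T (dualO T C \<boxtimes> C)) \<cdot> assc T P (dualO T C) C)"
        by (simp add: assc_natural u' ten_idn)
      finally show "(contract P C \<cdot> (idn T P \<diamondop> (dualM T u \<diamondop> idn T C))) \<cdot> assc T P (dualO T C) C
          = (contract C C \<cdot> (u \<diamondop> idn T (dualO T C \<boxtimes> C))) \<cdot> assc T P (dualO T C) C"
        by (simp add: u')
    qed (auto simp: u')
    have "contract P C \<cdot> (idn T P \<diamondop> ((dualM T u \<diamondop> idn T C) \<cdot> coev C))
        = (contract P C \<cdot> (idn T P \<diamondop> (dualM T u \<diamondop> idn T C))) \<cdot> (idn T P \<diamondop> coev C)"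
      using cC by (simp add: interchange u' Mor_iff)
    also have "\<dots> = (contract C C \<cdot> (idn T C \<diamondop> coev C)) \<cdot> (u \<diamondop> idn T ?U)"
      unfolding k using cC by (simp add: interchange u' Mor_iff)
    also have "\<dots> = u \<cdot> (contract P P \<cdot> (idn T P \<diamondop> coev P))"
      unfolding contract_coev [OF C] contract_coev [OF P] by (simp add: runit_natural u')
    also have "\<dots> = contract P C \<cdot> (idn T P \<diamondop> ((idn T ?Q \<diamondop> u) \<cdot> coev P))"
    proof -
      have "u \<cdot> (contract P P \<cdot> (idn T P \<diamondop> coev P))
          = (contract P C \<cdot> (idn T P \<diamondop> (idn T ?Q \<diamondop> u))) \<cdot> (idn T P \<diamondop> coev P)"
        using contract_natural [of P u] cP by (simp add: u' Mor_iff)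
      then show ?thesis using cP by (simp add: interchange u' Mor_iff)
    qed
    finally show "contract P C \<cdot> (idn T P \<diamondop> ((dualM T u \<diamondop> idn T C) \<cdot> coev C))
        = contract P C \<cdot> (idn T P \<diamondop> ((idn T ?Q \<diamondop> u) \<cdot> coev P))" .
  qed (use cP cC in \<open>auto simp: Mor_iff u'\<close>)
  moreover have "element C (t \<cdot> dualM T u) = (t \<diamondop> idn T C) \<cdot> ((dualM T u \<diamondop> idn T C) \<cdot> coev C)"
    using t cC by (simp add: element_def interchange u' Mor_iff)
  moreover have "(idn T A \<diamondop> u) \<cdot> element P t = (t \<diamondop> idn T C) \<cdot> ((idn T ?Q \<diamondop> u) \<cdot> coev P)"
    using t cP by (simp add: element_def interchange u' Mor_iff)
  ultimately show ?thesis by simp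
qed

end

section \<open>Tensoring coproducts, rigidity of the unit, full faithfulness of duality\<close>

context closed_symmetric_monoidal_category
begin

text \<open>The left adjoint \<open>- \<otimes> W\<close> preserves coproducts: families out of the
  \<open>A i \<otimes> W\<close> are transposed to families out of the \<open>A i\<close>, and the
  induced map is transposed back.\<close>

lemma coproduct_ten:
  assumes cop: "is_coproduct T I A S \<iota>"
  shows "is_coproduct T I (\<lambda>i. A i \<boxtimes> W) (S \<boxtimes> W) (\<lambda>i. \<iota> i \<diamondop> idn T W)"
  unfolding is_coproduct_def
proof (intro conjI allI impI ballI)
  have \<iota>: "src T (\<iota> i) = A i" "trg T (\<iota> i) = S" if "i \<in> I" for i
    using cop that by (auto simp: is_coproduct_def Mor_iff)
  then show "\<iota> i \<diamondop> idn T W \<in> Mor T (A i \<boxtimes> W) (S \<boxtimes> W)" if "i \<in> I" for i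
    using that by (simp add: Mor_iff)
  fix Y g assume g: "\<forall>i\<in>I. g i \<in> Mor T (A i \<boxtimes> W) Y"
  define h where "h i = transpose T (A i) W Y (g i)" for i
  have h: "h i \<in> Mor T (A i) (ihom T W Y)" "ev T W Y \<cdot> (h i \<diamondop> idn T W) = g i" if "i \<in> I" for i
    using g that transpose_Mor [of "g i" "A i" W Y] ev_transpose [of "g i" "A i" W Y]
    by (auto simp: h_def)
  obtain k where k: "k \<in> Mor T S (ihom T W Y)" "\<And>i. i \<in> I \<Longrightarrow> k \<cdot> \<iota> i = h i"
    and kuniq: "\<And>k'. \<lbrakk>k' \<in> Mor T S (ihom T W Y); \<And>i. i \<in> I \<Longrightarrow> k' \<cdot> \<iota> i = h i\<rbrakk> \<Longrightarrow> k' = k"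
    using cop h(1) unfolding is_coproduct_def by metis
  show "\<exists>!H. H \<in> Mor T (S \<boxtimes> W) Y \<and> (\<forall>i\<in>I. H \<cdot> (\<iota> i \<diamondop> idn T W) = g i)"
  proof (rule ex1I)
    show "ev T W Y \<cdot> (k \<diamondop> idn T W) \<in> Mor T (S \<boxtimes> W) Y \<and>
        (\<forall>i\<in>I. (ev T W Y \<cdot> (k \<diamondop> idn T W)) \<cdot> (\<iota> i \<diamondop> idn T W) = g i)"
      using k \<iota> h by (auto simp: Mor_iff ten_cmp_ten)
  next
    fix H assume H: "H \<in> Mor T (S \<boxtimes> W) Y \<and> (\<forall>i\<in>I. H \<cdot> (\<iota> i \<diamondop> idn T W) = g i)"
    let ?k = "transpose T S W Y H"
    have tr: "?k \<in> Mor T S (ihom T W Y)" "ev T W Y \<cdot> (?k \<diamondop> idn T W) = H"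
      using H transpose_Mor [of H S W Y] ev_transpose [of H S W Y] by auto
    have "?k = k"
    proof (rule kuniq)
      fix i assume i: "i \<in> I"
      have "ev T W Y \<cdot> ((?k \<cdot> \<iota> i) \<diamondop> idn T W) = (ev T W Y \<cdot> (?k \<diamondop> idn T W)) \<cdot> (\<iota> i \<diamondop> idn T W)"
        using tr(1) \<iota> [OF i] by (simp add: Mor_iff ten_cmp_ten)
      then have "ev T W Y \<cdot> ((?k \<cdot> \<iota> i) \<diamondop> idn T W) = ev T W Y \<cdot> (h i \<diamondop> idn T W)"
        using tr(2) H h(2) i by simp
      then show "?k \<cdot> \<iota> i = h i"
        by (rule ev_cancel) (use tr(1) \<iota> [OF i] h(1) [OF i] in \<open>auto simp: Mor_iff\<close>)
    qed (rule tr(1))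
    with tr(2) show "H = ev T W Y \<cdot> (k \<diamondop> idn T W)" by simp
  qed
qed

text \<open>This is \<open>F(\<one>, Y) \<cong> Y\<close>; the inverse comes from the transpose of
  the right unitor of \<open>Y\<close>.\<close>

lemma is_iso_ev_unit: "is_iso T (ev T (unit T) Y)"
proof -
  let ?U = "unit T" and ?F = "ihom T (unit T) Y"
  have rY: "runit T Y \<in> Mor T (Y \<boxtimes> ?U) Y" by (simp add: Mor_iff)
  define g where "g = transpose T Y ?U Y (runit T Y)"
  have g: "src T g = Y" "trg T g = ?F" and evg: "ev T ?U Y \<cdot> (g \<diamondop> idn T ?U) = runit T Y"
    unfolding g_def using transpose_Mor [OF rY] ev_transpose [OF rY] by (auto simp: Mor_iff)
  \<comment> \<open>Dividing by the right unitor turns evaluation into a map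
    \<open>F(\<one>, Y) \<rightarrow> Y\<close>, for which \<open>g\<close> can be an
    inverse.\<close>
  let ?e = "ev T ?U Y \<cdot> inverse_mor T (runit T ?F)"
  have e: "?e \<cdot> runit T ?F = ev T ?U Y" by simp
  have "is_iso T ?e"
  proof (rule is_isoI)
    have "(?e \<cdot> g) \<cdot> runit T Y = (?e \<cdot> runit T ?F) \<cdot> (g \<diamondop> idn T ?U)"
      using runit_natural [of g ?F, symmetric] g by simp
    also have "\<dots> = idn T Y \<cdot> runit T Y" using evg by (simp add: e)
    finally have *: "(?e \<cdot> g) \<cdot> runit T Y = idn T Y \<cdot> runit T Y" .
    have "?e \<cdot> g = idn T Y"
      by (rule iso_cancel_right [OF is_iso_runit *]) (simp_all add: g)
    then show "?e \<cdot> g = idn T (trg T ?e)" by simp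
    have "ev T ?U Y \<cdot> ((g \<cdot> ?e) \<diamondop> idn T ?U) = (ev T ?U Y \<cdot> (g \<diamondop> idn T ?U)) \<cdot> (?e \<diamondop> idn T ?U)"
      using g by (simp add: ten_cmp_ten)
    also have "\<dots> = ?e \<cdot> runit T ?F"
      unfolding evg using runit_natural [of ?e] by simp
    also have "\<dots> = ev T ?U Y \<cdot> (idn T ?F \<diamondop> idn T ?U)" by (simp add: ten_idn)
    finally have *: "ev T ?U Y \<cdot> ((g \<cdot> ?e) \<diamondop> idn T ?U) = ev T ?U Y \<cdot> (idn T ?F \<diamondop> idn T ?U)" .
    have "g \<cdot> ?e = idn T ?F"
      by (rule ev_cancel [OF *]) (auto simp: g Mor_iff)
    then show "g \<cdot> ?e = idn T (src T ?e)" by simp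
  qed (auto simp: g)
  then have "is_iso T (?e \<cdot> runit T ?F)" by (rule is_iso_cmp [rotated]) auto
  then show ?thesis by (simp only: e)
qed

text \<open>In \<open>ev_rigid_map\<close> for the unit, evaluation, contraction and symmetry are
  isomorphisms. Hence so is \<open>rigid_map\<close> tensored with the unit, and the right unitors
  remove this factor.\<close>

lemma unit_rigid: "unit T \<in> rigids T"
  unfolding rigids_def
proof safe
  fix Y
  let ?U = "unit T" and ?\<rho> = "rigid_map T (unit T) Y"
  have "is_iso T (pairing ?U)" unfolding pairing_def by (simp add: is_iso_ev_unit)
  then have c: "is_iso T (contract ?U Y)" unfolding contract_def by simp
  have "ev T ?U Y \<cdot> (?\<rho> \<diamondop> idn T ?U)
      = ev T ?U Y \<cdot> (inverse_mor T (ev T ?U Y) \<cdot> (contract ?U Y \<cdot> swap T (dualO T ?U \<boxtimes> Y) ?U))"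
    unfolding ev_rigid_map by (simp add: is_iso_ev_unit)
  then have \<rho>: "?\<rho> \<diamondop> idn T ?U
      = inverse_mor T (ev T ?U Y) \<cdot> (contract ?U Y \<cdot> swap T (dualO T ?U \<boxtimes> Y) ?U)"
    by (rule iso_cancel_left [OF is_iso_ev_unit]) (simp_all add: is_iso_ev_unit)
  have "is_iso T (?\<rho> \<diamondop> idn T ?U)" unfolding \<rho> using c by (simp add: is_iso_ev_unit)
  then have "is_iso T ((runit T (ihom T ?U Y) \<cdot> (?\<rho> \<diamondop> idn T ?U))
      \<cdot> inverse_mor T (runit T (dualO T ?U \<boxtimes> Y)))"
    by simp
  then show "is_iso T ?\<rho>" by (simp add: runit_natural)
qed

text \<open>The map \<open>A \<otimes> y\<close> factors through \<open>a \<otimes> P\<close>, where \<open>a : A \<rightarrow> A \<otimes> F(P, Y)\<close> is the name of \<open>y\<close>.\<close>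

lemma ten_factor_ihom:
  assumes y: "y \<in> Mor T P Y"
  obtains a b where "a \<in> Mor T A (A \<boxtimes> ihom T P Y)" "src T b = (A \<boxtimes> ihom T P Y) \<boxtimes> P"
    "b \<cdot> (a \<diamondop> idn T P) = idn T A \<diamondop> y"
proof -
  let ?U = "unit T" and ?F = "ihom T P Y"
  have yl: "y \<cdot> lunit T P \<in> Mor T (?U \<boxtimes> P) Y" using y by (simp add: Mor_iff)
  \<comment> \<open>The name \<open>\<one> \<rightarrow> F(P, Y)\<close> of \<open>y\<close>. Below,
    \<open>?a\<close> tensors it with \<open>A\<close> and \<open>?b\<close> evaluates; the unit
    triangle cancels the unitors.\<close>
  define z where "z = transpose T ?U P Y (y \<cdot> lunit T P)"
  have z: "src T z = ?U" "trg T z = ?F" "ev T P Y \<cdot> (z \<diamondop> idn T P) = y \<cdot> lunit T P"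
    unfolding z_def using transpose_Mor [OF yl] ev_transpose [OF yl] by (auto simp: Mor_iff)
  let ?r = "inverse_mor T (runit T A)"
  let ?a = "(idn T A \<diamondop> z) \<cdot> ?r" and ?b = "(idn T A \<diamondop> ev T P Y) \<cdot> assc T A ?F P"
  have "?b \<cdot> (?a \<diamondop> idn T P)
      = (idn T A \<diamondop> ev T P Y) \<cdot> (assc T A ?F P \<cdot> (((idn T A \<diamondop> z) \<diamondop> idn T P) \<cdot> (?r \<diamondop> idn T P)))"
    using z by (simp add: interchange)
  also have "\<dots> = (idn T A \<diamondop> (ev T P Y \<cdot> (z \<diamondop> idn T P))) \<cdot> (assc T A ?U P \<cdot> (?r \<diamondop> idn T P))"
  proof -
    have "assc T A ?F P \<cdot> (((idn T A \<diamondop> z) \<diamondop> idn T P) \<cdot> (?r \<diamondop> idn T P))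
        = (idn T A \<diamondop> (z \<diamondop> idn T P)) \<cdot> (assc T A ?U P \<cdot> (?r \<diamondop> idn T P))"
      using z(1,2) by (simp add: assc_natural_cmp)
    then show ?thesis using z(1,2) by (simp only:) (simp add: interchange)
  qed
  also have "\<dots> = (idn T A \<diamondop> y) \<cdot> (((idn T A \<diamondop> lunit T P) \<cdot> assc T A ?U P) \<cdot> (?r \<diamondop> idn T P))"
    unfolding z(3) using y by (simp add: interchange Mor_iff)
  also have "\<dots> = idn T A \<diamondop> y"
    unfolding unit_triangle using y by (simp add: interchange Mor_iff)
  finally have "?b \<cdot> (?a \<diamondop> idn T P) = idn T A \<diamondop> y" .
  moreover have "?a \<in> Mor T A (A \<boxtimes> ?F)" "src T ?b = (A \<boxtimes> ?F) \<boxtimes> P"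
    using z by (auto simp: Mor_iff)
  ultimately show ?thesis using that by blast
qed

lemma dualM_cmp:
  assumes f: "f \<in> Mor T X Y" and g: "g \<in> Mor T Y Z"
  shows "dualM T (g \<cdot> f) = dualM T f \<cdot> dualM T g"
proof (rule ev_cancel)
  let ?U = "unit T"
  have fg: "src T f = X" "trg T f = Y" "src T g = Y" "trg T g = Z"
    using f g by (auto simp: Mor_iff)
  have "ev T X ?U \<cdot> ((dualM T f \<cdot> dualM T g) \<diamondop> idn T X)
      = (ev T X ?U \<cdot> (dualM T f \<diamondop> idn T X)) \<cdot> (dualM T g \<diamondop> idn T X)"
    using fg by (simp add: ten_cmp_ten)
  also have "\<dots> = (ev T Y ?U \<cdot> (dualM T g \<diamondop> idn T Y)) \<cdot> (idn T (dualO T Z) \<diamondop> f)"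
    using ev_dualM [of f] fg by (simp add: ten_cmp_ten)
  also have "\<dots> = ev T X ?U \<cdot> (dualM T (g \<cdot> f) \<diamondop> idn T X)"
    using ev_dualM [of g] ev_dualM [of "g \<cdot> f"] fg by (simp add: ten_cmp_ten)
  finally show "ev T X ?U \<cdot> (dualM T (g \<cdot> f) \<diamondop> idn T X)
      = ev T X ?U \<cdot> ((dualM T f \<cdot> dualM T g) \<diamondop> idn T X)" by simp
qed (use f g in \<open>auto simp: Mor_iff\<close>)

text \<open>Shows how \<open>u\<close> can be read off from the element of \<open>Du\<close>, which
  makes duality faithful and, by \<open>dualM_full\<close>, full on rigid objects.\<close>

lemma contract_dualM:
  assumes A: "A \<in> rigids T" and C: "C \<in> rigids T" and u: "u \<in> Mor T A C"
  shows "contract A C \<cdot> (idn T A \<diamondop> element C (dualM T u)) = u \<cdot> runit T A"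
proof -
  have u': "src T u = A" "trg T u = C" using u by (auto simp: Mor_iff)
  have c: "src T (coev A) = unit T" "trg T (coev A) = dualO T A \<boxtimes> A"
    using coev_Mor [OF A] by (auto simp: Mor_iff)
  have "element C (dualM T u) = (idn T (dualO T A) \<diamondop> u) \<cdot> coev A"
    using element_dualM [OF A C u, of "idn T (dualO T A)"]
        by (simp add: element_def idn_Mor u' c ten_idn)
  then have "contract A C \<cdot> (idn T A \<diamondop> element C (dualM T u))
      = (contract A C \<cdot> (idn T A \<diamondop> (idn T (dualO T A) \<diamondop> u))) \<cdot> (idn T A \<diamondop> coev A)"
    by (simp add: interchange u' c)
  also have "\<dots> = u \<cdot> (contract A A \<cdot> (idn T A \<diamondop> coev A))"
    using contract_natural [of A u] by (simp add: u' c)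
  finally show ?thesis by (simp add: contract_coev [OF A])
qed

lemma dualM_faithful:
  assumes "A \<in> rigids T" "C \<in> rigids T" "u \<in> Mor T A C" "v \<in> Mor T A C" "dualM T u = dualM T v"
  shows "u = v"
proof (rule iso_cancel_right [OF is_iso_runit])
  show "u \<cdot> runit T A = v \<cdot> runit T A"
    using contract_dualM [of A C u] contract_dualM [of A C v] assms by metis
qed (use assms in \<open>auto simp: Mor_iff\<close>)

lemma dualM_full:
  assumes A: "A \<in> rigids T" and C: "C \<in> rigids T" and s: "s \<in> Mor T (dualO T C) (dualO T A)"
  obtains u where "u \<in> Mor T A C" "dualM T u = s"
proof -
  note el = element_Mor [OF C s]
  \<comment> \<open>The equation \<open>contract_dualM\<close>, solved for \<open>u\<close>.\<close>
  define u where "u = contract A C \<cdot> ((idn T A \<diamondop> element C s) \<cdot> inverse_mor T (runit T A))"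
  have u: "u \<in> Mor T A C" using el by (simp add: u_def Mor_iff)
  have "element C (dualM T u) = element C s"
  proof (rule contract_cancel [OF A])
    show "contract A C \<cdot> (idn T A \<diamondop> element C (dualM T u)) = contract A C \<cdot> (idn T A \<diamondop> element C s)"
      unfolding contract_dualM [OF A C u] using el by (simp add: u_def Mor_iff)
    show "element C (dualM T u) \<in> Mor T (unit T) (dualO T A \<boxtimes> C)"
      by (rule element_Mor [OF C]) (use u in \<open>auto simp: Mor_iff\<close>)
  qed (rule el)
  then have "dualM T u = s"
    by (rule element_inject [OF C]) (use u s in \<open>auto simp: Mor_iff\<close>)
  with u show ?thesis by (rule that)
qed

end

section \<open>Additivity of the tensor product\<close>

context tensor_triangulated_category
begin

lemma ten_ext:
  assumes "f \<in> Mor T (X \<boxtimes> W) Y" "g \<in> Mor T (X \<boxtimes> W) Y"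
    and "transpose T X W Y f = transpose T X W Y g"
  shows "f = g"
  using assms ev_transpose by metis

text \<open>Maps out of \<open>Z \<otimes> W\<close> are transposes of maps out of \<open>Z\<close>,
  so the identity and the zero map agree.\<close>

lemma zero_object_ten:
  assumes Z: "zero_object T Z"
  shows "zero_object T (Z \<boxtimes> W)"
  unfolding zero_object_iff
  by (rule ten_ext [OF idn_Mor zer_Mor])
    (rule zero_object_from [OF Z transpose_Mor [OF idn_Mor] transpose_Mor [OF zer_Mor]])

lemma zer_ten: "zer T X Y \<diamondop> idn T W = zer T (X \<boxtimes> W) (Y \<boxtimes> W)"
proof -
  obtain Z where Z: "zero_object T Z" using ex_zero_object by auto
  have "zer T X Y \<diamondop> idn T W = (zer T Z Y \<diamondop> idn T W) \<cdot> (zer T X Z \<diamondop> idn T W)"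
    by (simp add: ten_cmp_ten)
  also have "zer T Z Y \<diamondop> idn T W = zer T (Z \<boxtimes> W) (Y \<boxtimes> W)"
    by (rule zero_object_from [OF zero_object_ten [OF Z]]) (auto simp: Mor_iff)
  finally show ?thesis by simp
qed

text \<open>As a left adjoint, \<open>- \<otimes> W\<close> preserves the biproduct of two copies of
  \<open>X\<close>, and sums of maps are expressed through biproducts.\<close>

lemma plus_ten:
  assumes f: "f \<in> Mor T X Y" and g: "g \<in> Mor T X Y"
  shows "(f \<boxplus> g) \<diamondop> idn T W = (f \<diamondop> idn T W) \<boxplus> (g \<diamondop> idn T W)"
proof -
  obtain P i j p q where
    typing: "src T i = X" "trg T i = P" "src T j = X" "trg T j = P" "src T p = P" "trg T p = X"
      "src T q = P" "trg T q = X"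
    and eqs: "p \<cdot> i = idn T X" "q \<cdot> j = idn T X" "q \<cdot> i = zer T X X" "p \<cdot> j = zer T X X"
      "i \<cdot> p \<boxplus> j \<cdot> q = idn T P"
    using ex_biproduct [of X X] unfolding Mor_iff by metis
  have fg: "src T f = X" "trg T f = Y" "src T g = X" "trg T g = Y" using f g by (auto simp: Mor_iff)
  let ?L = "\<lambda>m. m \<diamondop> idn T W"
  \<comment> \<open>\<open>?s\<close> is the diagonal and \<open>?h\<close> the map with components
    \<open>f\<close> and \<open>g\<close>, so that the sum becomes the composite
    \<open>?h \<cdot> ?s\<close>.\<close>
  let ?s = "i \<boxplus> j" and ?h = "f \<cdot> p \<boxplus> g \<cdot> q"
  have ps: "p \<cdot> ?s = idn T X"
    using cmp_plus_right [of i X P j p X] by (simp add: Mor_iff typing eqs idn_Mor)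
  have qs: "q \<cdot> ?s = idn T X"
    using cmp_plus_right [of i X P j q X] by (simp add: Mor_iff typing eqs idn_Mor)
  have hi: "?h \<cdot> i = f"
    using cmp_plus_left [of i X P "f \<cdot> p" Y "g \<cdot> q"] by (simp add: Mor_iff typing eqs fg)
  have hj: "?h \<cdot> j = g"
    using cmp_plus_left [of j X P "f \<cdot> p" Y "g \<cdot> q"] by (simp add: Mor_iff typing eqs fg)
  have hs: "?h \<cdot> ?s = f \<boxplus> g"
    using cmp_plus_left [of ?s X P "f \<cdot> p" Y "g \<cdot> q"] by (simp add: Mor_iff typing eqs fg ps qs)
  \<comment> \<open>The tensored injections and projections still decompose the identity; here the
    adjunction enters.\<close>
  have id: "?L i \<cdot> ?L p \<boxplus> ?L j \<cdot> ?L q = idn T (P \<boxtimes> W)" (is "?e = _")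
  proof (rule ten_ext)
    show e: "?e \<in> Mor T (P \<boxtimes> W) (P \<boxtimes> W)" by (simp add: Mor_iff typing)
    let ?k = "transpose T P W (P \<boxtimes> W) ?e" and ?k' = "transpose T P W (P \<boxtimes> W) (idn T (P \<boxtimes> W))"
    note k = transpose_Mor [OF e] ev_transpose [OF e]
    note k' = transpose_Mor [OF idn_Mor [of "P \<boxtimes> W"]] ev_transpose [OF idn_Mor [of "P \<boxtimes> W"]]
    \<comment> \<open>Restricting a transpose along \<open>m\<close> transposes the restriction
      along \<open>m \<otimes> W\<close>. The two transposes are compared on \<open>i\<close> and
      \<open>j\<close>, which suffices by \<open>expand\<close>.\<close>
    have restrict: "?k \<cdot> m = ?k' \<cdot> m" if m: "src T m = X" "trg T m = P" and em: "?e \<cdot> ?L m = ?L m" for m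
    proof (rule ev_cancel)
      have "ev T W (P \<boxtimes> W) \<cdot> ?L (?k \<cdot> m) = (ev T W (P \<boxtimes> W) \<cdot> ?L ?k) \<cdot> ?L m"
        using k(1) m by (simp add: Mor_iff ten_cmp_ten)
      also have "\<dots> = (ev T W (P \<boxtimes> W) \<cdot> ?L ?k') \<cdot> ?L m"
        unfolding k(2) k'(2) em using m by simp
      also have "\<dots> = ev T W (P \<boxtimes> W) \<cdot> ?L (?k' \<cdot> m)"
        using k'(1) m by (simp add: Mor_iff ten_cmp_ten)
      finally show "ev T W (P \<boxtimes> W) \<cdot> ?L (?k \<cdot> m) = ev T W (P \<boxtimes> W) \<cdot> ?L (?k' \<cdot> m)" .
    qed (use k(1) k'(1) m in \<open>auto simp: Mor_iff\<close>)
    have "?e \<cdot> ?L i = ?L i"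
      using cmp_plus_left [of "?L i" "X \<boxtimes> W" "P \<boxtimes> W" "?L i \<cdot> ?L p" "P \<boxtimes> W" "?L j \<cdot> ?L q"]
      by (simp add: Mor_iff typing ten_cmp_ten eqs zer_ten)
    then have ki: "?k \<cdot> i = ?k' \<cdot> i" by (rule restrict [OF typing(1,2)])
    have "?e \<cdot> ?L j = ?L j"
      using cmp_plus_left [of "?L j" "X \<boxtimes> W" "P \<boxtimes> W" "?L i \<cdot> ?L p" "P \<boxtimes> W" "?L j \<cdot> ?L q"]
      by (simp add: Mor_iff typing ten_cmp_ten eqs zer_ten)
    then have kj: "?k \<cdot> j = ?k' \<cdot> j" by (rule restrict [OF typing(3,4)])
    have expand: "m = (m \<cdot> i) \<cdot> p \<boxplus> (m \<cdot> j) \<cdot> q" if "src T m = P" for m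
      using cmp_plus_right [of "i \<cdot> p" P P "j \<cdot> q" m "trg T m"] that
      by (simp add: Mor_iff typing eqs)
    have "?k = (?k \<cdot> i) \<cdot> p \<boxplus> (?k \<cdot> j) \<cdot> q" using k(1) by (intro expand) (simp add: Mor_iff)
    also have "\<dots> = (?k' \<cdot> i) \<cdot> p \<boxplus> (?k' \<cdot> j) \<cdot> q" by (simp only: ki kj)
    also have "\<dots> = ?k'" using k'(1) by (intro expand [symmetric]) (simp add: Mor_iff)
    finally show "?k = ?k'" .
  qed (rule idn_Mor)
  have "?L (f \<boxplus> g) = ?L ?h \<cdot> (?e \<cdot> ?L ?s)"
    unfolding id by (simp add: typing fg ten_cmp_ten hs)
  also have "?e \<cdot> ?L ?s = ?L i \<boxplus> ?L j"
    using cmp_plus_left [of "?L ?s" "X \<boxtimes> W" "P \<boxtimes> W" "?L i \<cdot> ?L p" "P \<boxtimes> W" "?L j \<cdot> ?L q"]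
    by (simp add: Mor_iff typing ten_cmp_ten ps qs)
  also have "?L ?h \<cdot> (?L i \<boxplus> ?L j) = ?L f \<boxplus> ?L g"
    using cmp_plus_right [of "?L i" "X \<boxtimes> W" "P \<boxtimes> W" "?L j" "?L ?h" "Y \<boxtimes> W"]
    by (simp add: Mor_iff typing fg ten_cmp_ten hi hj)
  finally show ?thesis .
qed

lemma ten_right_swap: "idn T W \<diamondop> f = swap T (trg T f) W \<cdot> ((f \<diamondop> idn T W) \<cdot> swap T W (src T f))"
  by (simp add: swap_natural_cmp swap_swap)

lemma ten_plus:
  assumes f: "f \<in> Mor T X Y" and g: "g \<in> Mor T X Y"
  shows "idn T W \<diamondop> (f \<boxplus> g) = (idn T W \<diamondop> f) \<boxplus> (idn T W \<diamondop> g)"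
proof -
  have fg: "src T f = X" "trg T f = Y" "src T g = X" "trg T g = Y" using f g by (auto simp: Mor_iff)
  have "((f \<diamondop> idn T W) \<boxplus> (g \<diamondop> idn T W)) \<cdot> swap T W X
      = (f \<diamondop> idn T W) \<cdot> swap T W X \<boxplus> (g \<diamondop> idn T W) \<cdot> swap T W X"
    by (rule cmp_plus_left) (auto simp: Mor_iff fg)
  moreover have "swap T Y W \<cdot> ((f \<diamondop> idn T W) \<cdot> swap T W X \<boxplus> (g \<diamondop> idn T W) \<cdot> swap T W X)
      = swap T Y W \<cdot> ((f \<diamondop> idn T W) \<cdot> swap T W X) \<boxplus> swap T Y W \<cdot> ((g \<diamondop> idn T W) \<cdot> swap T W X)"
    by (rule cmp_plus_right) (auto simp: Mor_iff fg)
  ultimately show ?thesis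
    using ten_right_swap [of W "f \<boxplus> g"] ten_right_swap [of W f] ten_right_swap [of W g]
    by (simp add: fg plus_ten [OF f g])
qed

lemma dualM_plus:
  assumes u: "u \<in> Mor T P C" and v: "v \<in> Mor T P C"
  shows "dualM T (u \<boxplus> v) = dualM T u \<boxplus> dualM T v"
proof (rule ev_cancel)
  let ?U = "unit T"
  have uv: "src T u = P" "trg T u = C" "src T v = P" "trg T v = C" using u v by (auto simp: Mor_iff)
  have "ev T P ?U \<cdot> ((dualM T u \<boxplus> dualM T v) \<diamondop> idn T P)
      = ev T P ?U \<cdot> ((dualM T u \<diamondop> idn T P) \<boxplus> (dualM T v \<diamondop> idn T P))"
    by (subst plus_ten [of _ "dualO T C" "dualO T P"]) (auto simp: Mor_iff uv)
  also have "\<dots> = ev T P ?U \<cdot> (dualM T u \<diamondop> idn T P) \<boxplus> ev T P ?U \<cdot> (dualM T v \<diamondop> idn T P)"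
    by (rule cmp_plus_right) (auto simp: Mor_iff uv)
  also have "\<dots> = ev T C ?U \<cdot> (idn T (dualO T C) \<diamondop> u) \<boxplus> ev T C ?U \<cdot> (idn T (dualO T C) \<diamondop> v)"
    using ev_dualM [of u] ev_dualM [of v] by (simp add: uv)
  also have "\<dots> = ev T C ?U \<cdot> ((idn T (dualO T C) \<diamondop> u) \<boxplus> (idn T (dualO T C) \<diamondop> v))"
    by (rule cmp_plus_right [symmetric]) (auto simp: Mor_iff uv)
  also have "\<dots> = ev T C ?U \<cdot> (idn T (dualO T C) \<diamondop> (u \<boxplus> v))"
    by (simp only: ten_plus [OF u v])
  also have "\<dots> = ev T P ?U \<cdot> (dualM T (u \<boxplus> v) \<diamondop> idn T P)"
    using ev_dualM [of "u \<boxplus> v"] by (simp add: uv)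
  finally show "ev T P ?U \<cdot> (dualM T (u \<boxplus> v) \<diamondop> idn T P)
      = ev T P ?U \<cdot> ((dualM T u \<boxplus> dualM T v) \<diamondop> idn T P)" by simp
qed (use u v in \<open>auto simp: Mor_iff\<close>)

lemma element_zer: "P \<in> rigids T \<Longrightarrow> element P (zer T (dualO T P) A) = zer T (unit T) (A \<boxtimes> P)"
  using coev_Mor [of P] by (simp add: element_def zer_ten Mor_iff)

lemma element_eq_zer_iff:
  assumes P: "P \<in> rigids T" and t: "t \<in> Mor T (dualO T P) A"
  shows "element P t = zer T (unit T) (A \<boxtimes> P) \<longleftrightarrow> t = zer T (dualO T P) A"
  using element_inject [OF P _ t zer_Mor] by (auto simp: element_zer [OF P])

end

section \<open>Compact objects\<close>

lemma is_coproductD: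
  assumes "is_coproduct T I A S \<iota>" "\<And>i. i \<in> I \<Longrightarrow> g i \<in> Mor T (A i) Y"
  obtains h where "h \<in> Mor T S Y" "\<And>i. i \<in> I \<Longrightarrow> h \<cdot>\<^bsub>T\<^esub> \<iota> i = g i"
  using assms unfolding is_coproduct_def by metis

context additive_category
begin

lemma coproduct_projections:
  assumes cop: "is_coproduct T I A S \<iota>"
  obtains \<pi> where "\<And>i. i \<in> I \<Longrightarrow> \<pi> i \<in> Mor T S (A i)"
    "\<And>i. i \<in> I \<Longrightarrow> \<pi> i \<cdot> \<iota> i = idn T (A i)"
    "\<And>i j. \<lbrakk>i \<in> I; j \<in> I; j \<noteq> i\<rbrakk> \<Longrightarrow> \<pi> i \<cdot> \<iota> j = zer T (A j) (A i)"
proof -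
  have "\<exists>p. p \<in> Mor T S (A i) \<and> (\<forall>j\<in>I. p \<cdot> \<iota> j = (if j = i then idn T (A i) else zer T (A j) (A i)))"
      for i
    by (rule is_coproductD [OF cop, of "\<lambda>j. if j = i then idn T (A i) else zer T (A j) (A i)" "A i"])
      (auto simp: Mor_iff)
  then show ?thesis by (metis that)
qed

text \<open>\<open>e\<close> is the projection of \<open>S\<close> onto the part indexed by
  \<open>J\<close>, the sum of the composites of coprojections with projections.\<close>

lemma coproduct_finite_part:
  assumes cop: "is_coproduct T I A S \<iota>" and J: "J \<subseteq> I" "finite J"
  obtains e where "e \<in> Mor T S S" "\<And>j. j \<in> J \<Longrightarrow> e \<cdot> \<iota> j = \<iota> j"
    "\<And>C f. f \<in> Mor T C S \<Longrightarrow> \<exists>c. (\<forall>i\<in>J. c i \<in> Mor T C (A i)) \<and>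
      e \<cdot> f = finprod (mor_group T C S) (\<lambda>i. \<iota> i \<cdot> c i) J"
proof -
  obtain \<pi> where \<pi>: "\<And>i. i \<in> I \<Longrightarrow> \<pi> i \<in> Mor T S (A i)"
      "\<And>i. i \<in> I \<Longrightarrow> \<pi> i \<cdot> \<iota> i = idn T (A i)"
      "\<And>i j. \<lbrakk>i \<in> I; j \<in> I; j \<noteq> i\<rbrakk> \<Longrightarrow> \<pi> i \<cdot> \<iota> j = zer T (A j) (A i)"
    using coproduct_projections [OF cop] by blast
  have \<iota>: "\<iota> i \<in> Mor T (A i) S" if "i \<in> I" for i using cop that by (auto simp: is_coproduct_def)
  have typing: "\<iota> i \<cdot> \<pi> i \<in> Mor T S S" if "i \<in> J" for i
    using \<iota> [of i] \<pi>(1) [of i] J that by (auto intro: cmp_Mor)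
  define e where "e = finprod (mor_group T S S) (\<lambda>i. \<iota> i \<cdot> \<pi> i) J"
  have "e \<in> Mor T S S" unfolding e_def by (rule finprod_Mor) (rule typing)
  moreover have "e \<cdot> \<iota> j = \<iota> j" if j: "j \<in> J" for j
  proof -
    have jI: "j \<in> I" using j J by auto
    have "e \<cdot> \<iota> j = finprod (mor_group T (A j) S) (\<lambda>i. (\<iota> i \<cdot> \<pi> i) \<cdot> \<iota> j) J"
      unfolding e_def by (rule finprod_cmp) (use typing \<iota> jI in \<open>auto\<close>)
    also have "\<dots> = (\<iota> j \<cdot> \<pi> j) \<cdot> \<iota> j"
    proof (rule finprod_single [OF J(2) j])
      fix i assume i: "i \<in> J"
      then show "(\<iota> i \<cdot> \<pi> i) \<cdot> \<iota> j \<in> Mor T (A j) S"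
        by (intro cmp_Mor [OF \<iota> [OF jI] typing])
      assume "i \<noteq> j"
      then show "(\<iota> i \<cdot> \<pi> i) \<cdot> \<iota> j = zer T (A j) S"
        using i J jI \<iota> [of i] \<iota> [of j] \<pi>(1) [of i] \<pi>(3) [of i j] by (auto simp: Mor_iff)
    qed
    also have "\<dots> = \<iota> j" using jI \<iota> [of j] \<pi>(1,2) [of j] by (simp add: Mor_iff)
    finally show ?thesis .
  qed
  moreover have "\<exists>c. (\<forall>i\<in>J. c i \<in> Mor T C (A i)) \<and>
      e \<cdot> f = finprod (mor_group T C S) (\<lambda>i. \<iota> i \<cdot> c i) J" if f: "f \<in> Mor T C S" for C f
  proof (intro exI conjI ballI)
    show "\<pi> i \<cdot> f \<in> Mor T C (A i)" if "i \<in> J" for i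
      using \<pi>(1) [of i] f J that by (auto intro: cmp_Mor)
    have "e \<cdot> f = finprod (mor_group T C S) (\<lambda>i. (\<iota> i \<cdot> \<pi> i) \<cdot> f) J"
      unfolding e_def by (rule finprod_cmp) (use typing f in auto)
    also have "\<dots> = finprod (mor_group T C S) (\<lambda>i. \<iota> i \<cdot> (\<pi> i \<cdot> f)) J"
    proof (rule comm_monoid.finprod_cong' [OF mor_group_monoid refl])
      show "(\<lambda>i. \<iota> i \<cdot> (\<pi> i \<cdot> f)) \<in> J \<rightarrow> carrier (mor_group T C S)"
        using \<iota> \<pi>(1) f J by (auto intro!: cmp_Mor)
      show "(\<iota> i \<cdot> \<pi> i) \<cdot> f = \<iota> i \<cdot> (\<pi> i \<cdot> f)" if "i \<in> J" for i
        using \<iota> [of i] \<pi>(1) [of i] f J that by (intro cmp_cmp) (auto simp: Mor_iff)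
    qed
    finally show "e \<cdot> f = finprod (mor_group T C S) (\<lambda>i. \<iota> i \<cdot> (\<pi> i \<cdot> f)) J" .
  qed
  ultimately show ?thesis using that by blast
qed

lemma finprod_fixed:
  assumes e: "e \<in> Mor T S S" and fix_\<iota>: "\<And>j. j \<in> J \<Longrightarrow> e \<cdot> \<iota> j = \<iota> j"
    and typing: "\<And>j. j \<in> J \<Longrightarrow> \<iota> j \<in> Mor T (A j) S" "\<And>j. j \<in> J \<Longrightarrow> c j \<in> Mor T C (A j)"
  shows "e \<cdot> finprod (mor_group T C S) (\<lambda>i. \<iota> i \<cdot> c i) J = finprod (mor_group T C S) (\<lambda>i. \<iota> i \<cdot> c i) J"
proof -
  have "e \<cdot> finprod (mor_group T C S) (\<lambda>i. \<iota> i \<cdot> c i) J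
      = finprod (mor_group T C S) (\<lambda>i. e \<cdot> (\<iota> i \<cdot> c i)) J"
    by (rule cmp_finprod [OF _ e]) (use typing in \<open>auto intro: cmp_Mor\<close>)
  also have "\<dots> = finprod (mor_group T C S) (\<lambda>i. \<iota> i \<cdot> c i) J"
  proof (rule comm_monoid.finprod_cong' [OF mor_group_monoid refl])
    show "(\<lambda>i. \<iota> i \<cdot> c i) \<in> J \<rightarrow> carrier (mor_group T C S)"
      using typing by (auto intro: cmp_Mor)
    show "e \<cdot> (\<iota> i \<cdot> c i) = \<iota> i \<cdot> c i" if "i \<in> J" for i
      using fix_\<iota> [OF that] typing [OF that] e cmp_cmp [of "c i" "\<iota> i" e] by (simp add: Mor_iff)
  qed
  finally show ?thesis .
qed

text \<open>
  A morphism into a coproduct has finite support if it is fixed by all endomorphisms that fix finitely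
  many coprojections. In this form compactness is inherited along triangles without choosing
  components.
\<close>

lemma compacts_iff:
  fixes \<kappa> :: "'u rel"
  shows "C \<in> compacts \<kappa> T \<longleftrightarrow> (\<forall>(I :: 'u set) A S \<iota>. small \<kappa> I \<and> is_coproduct T I A S \<iota> \<longrightarrow>
    (\<forall>f \<in> Mor T C S. \<exists>J \<subseteq> I. finite J \<and>
      (\<forall>e \<in> Mor T S S. (\<forall>j\<in>J. e \<cdot> \<iota> j = \<iota> j) \<longrightarrow> e \<cdot> f = f)))"
  (is "_ \<longleftrightarrow> ?R")
proof
  assume C: "C \<in> compacts \<kappa> T"
  show ?R
  proof (intro allI impI ballI)
    fix I :: "'u set" and A S \<iota> f
    assume "small \<kappa> I \<and> is_coproduct T I A S \<iota>" and f: "f \<in> Mor T C S"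
    then have cop: "is_coproduct T I A S \<iota>" and "small \<kappa> I" by auto
    with C f obtain c where c: "c \<in> (\<Pi>\<^sub>E i\<in>I. Mor T C (A i))" "finite {i \<in> I. c i \<noteq> zer T C (A i)}"
        and fc: "f = finprod (mor_group T C S) (\<lambda>i. \<iota> i \<cdot> c i) {i \<in> I. c i \<noteq> zer T C (A i)}"
      unfolding compacts_def by blast
    have "e \<cdot> f = f" if "e \<in> Mor T S S" "\<forall>j\<in>{i \<in> I. c i \<noteq> zer T C (A i)}. e \<cdot> \<iota> j = \<iota> j" for e
      unfolding fc by (rule finprod_fixed [OF that(1), where A = A])
        (use c(1) cop that(2) in \<open>auto simp: is_coproduct_def\<close>)
    then show "\<exists>J \<subseteq> I. finite J \<and> (\<forall>e \<in> Mor T S S. (\<forall>j\<in>J. e \<cdot> \<iota> j = \<iota> j) \<longrightarrow> e \<cdot> f = f)"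
      using c(2) by (intro exI [of _ "{i \<in> I. c i \<noteq> zer T C (A i)}"]) auto
  qed
next
  assume R: ?R
  show "C \<in> compacts \<kappa> T"
    unfolding compacts_def
  proof (intro CollectI allI impI ballI)
    fix I :: "'u set" and A S \<iota> f
    assume *: "small \<kappa> I \<and> is_coproduct T I A S \<iota>" and f: "f \<in> Mor T C S"
    then have cop: "is_coproduct T I A S \<iota>" by auto
    have \<iota>: "\<iota> i \<in> Mor T (A i) S" if "i \<in> I" for i using cop that by (auto simp: is_coproduct_def)
    obtain J where J: "J \<subseteq> I" "finite J" "\<And>e. \<lbrakk>e \<in> Mor T S S; \<forall>j\<in>J. e \<cdot> \<iota> j = \<iota> j\<rbrakk> \<Longrightarrow> e \<cdot> f = f"
      using R [rule_format, OF * f] by blast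
    obtain e where "e \<in> Mor T S S" "\<And>j. j \<in> J \<Longrightarrow> e \<cdot> \<iota> j = \<iota> j" and
      "\<And>C f. f \<in> Mor T C S \<Longrightarrow> \<exists>c. (\<forall>i\<in>J. c i \<in> Mor T C (A i)) \<and>
        e \<cdot> f = finprod (mor_group T C S) (\<lambda>i. \<iota> i \<cdot> c i) J"
      using coproduct_finite_part [OF cop J(1,2)] by blast
    \<comment> \<open>The projection \<open>e\<close> fixes the coprojections in \<open>J\<close>,
      so it fixes \<open>f\<close>, which is therefore a finite sum.\<close>
    with J(3) f obtain c where c: "\<And>i. i \<in> J \<Longrightarrow> c i \<in> Mor T C (A i)"
        and fc: "f = finprod (mor_group T C S) (\<lambda>i. \<iota> i \<cdot> c i) J"
      by metis
    let ?supp = "\<lambda>c. {i \<in> I. c i \<noteq> zer T C (A i)}"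
    let ?P = "\<lambda>c. c \<in> (\<Pi>\<^sub>E i\<in>I. Mor T C (A i)) \<and> finite (?supp c) \<and>
        f = finprod (mor_group T C S) (\<lambda>i. \<iota> i \<cdot> c i) (?supp c)"
    \<comment> \<open>Extends \<open>c\<close> by zero to \<open>I\<close> and leaves it undefined
      outside \<open>I\<close>, as \<open>PiE\<close> demands. Its support may be smaller than
      \<open>J\<close>, so the sum is shrunk below.\<close>
    define d where "d = (\<lambda>i\<in>I. if i \<in> J then c i else zer T C (A i))"
    have d: "d \<in> (\<Pi>\<^sub>E i\<in>I. Mor T C (A i))" using c by (auto simp: d_def zer_Mor)
    have dJ: "?supp d \<subseteq> J" by (auto simp: d_def)
    have "f = finprod (mor_group T C S) (\<lambda>i. \<iota> i \<cdot> d i) J"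
      unfolding fc
      by (rule comm_monoid.finprod_cong' [OF mor_group_monoid refl])
        (use J(1) c \<iota> in \<open>auto simp: d_def intro!: cmp_Mor\<close>)
    also have "\<dots> = finprod (mor_group T C S) (\<lambda>i. \<iota> i \<cdot> d i) (?supp d)"
    proof (rule comm_monoid.finprod_mono_neutral_cong_right [OF mor_group_monoid J(2) dJ])
      show "\<iota> i \<cdot> d i = \<one>\<^bsub>mor_group T C S\<^esub>" if "i \<in> J - ?supp d" for i
        using that J(1) \<iota> [of i] by (auto simp: Mor_iff)
      show "(\<lambda>i. \<iota> i \<cdot> d i) \<in> J \<rightarrow> carrier (mor_group T C S)"
        using J(1) d \<iota> by (auto intro!: cmp_Mor)
    qed simp
    finally have "?P d" using d finite_subset [OF dJ J(2)] by simp
    \<comment> \<open>The projections of the coproduct recover all components, also those outside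
      the support.\<close>
    moreover have "c1 = c2" if c1: "?P c1" and c2: "?P c2" for c1 c2
    proof -
      obtain \<pi> where \<pi>: "\<And>i. i \<in> I \<Longrightarrow> \<pi> i \<in> Mor T S (A i)"
        "\<And>i. i \<in> I \<Longrightarrow> \<pi> i \<cdot> \<iota> i = idn T (A i)"
        "\<And>i j. \<lbrakk>i \<in> I; j \<in> I; j \<noteq> i\<rbrakk> \<Longrightarrow> \<pi> i \<cdot> \<iota> j = zer T (A j) (A i)"
        using coproduct_projections [OF cop] by blast
      have component: "\<pi> i \<cdot> f = c i" if c: "?P c" and i: "i \<in> I" for c i
      proof -
        have typing: "c j \<in> Mor T C (A j)" if "j \<in> I" for j using c that by auto
        have "\<pi> i \<cdot> f = \<pi> i \<cdot> finprod (mor_group T C S) (\<lambda>j. \<iota> j \<cdot> c j) (?supp c)" using c by metis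
        also have "\<dots> = finprod (mor_group T C (A i)) (\<lambda>j. \<pi> i \<cdot> (\<iota> j \<cdot> c j)) (?supp c)"
          by (rule cmp_finprod [OF _ \<pi>(1) [OF i]]) (use \<iota> typing in \<open>auto intro!: cmp_Mor\<close>)
        finally have fi: "\<pi> i \<cdot> f = finprod (mor_group T C (A i)) (\<lambda>j. \<pi> i \<cdot> (\<iota> j \<cdot> c j)) (?supp c)" .
        have assoc: "\<pi> i \<cdot> (\<iota> j \<cdot> c j) = (\<pi> i \<cdot> \<iota> j) \<cdot> c j" if "j \<in> I" for j
          using \<iota> [OF that] typing [OF that] \<pi>(1) [OF i]
              by (intro cmp_cmp [symmetric]) (auto simp: Mor_iff)
        have off: "\<pi> i \<cdot> (\<iota> j \<cdot> c j) = zer T C (A i)" if "j \<in> I" "j \<noteq> i" for j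
          unfolding assoc [OF that(1)] \<pi>(3) [OF i that] using typing [OF that(1)] by (simp add: Mor_iff)
        show ?thesis
        proof (cases "i \<in> ?supp c")
          case True
          have "finprod (mor_group T C (A i)) (\<lambda>j. \<pi> i \<cdot> (\<iota> j \<cdot> c j)) (?supp c) = \<pi> i \<cdot> (\<iota> i \<cdot> c i)"
            by (rule finprod_single) (use c True off \<iota> typing \<pi>(1) [OF i] in \<open>auto intro!: cmp_Mor\<close>)
          then show ?thesis
            unfolding fi assoc [OF i] \<pi>(2) [OF i] using typing [OF i] by (simp add: Mor_iff)
        next
          case False
          have "finprod (mor_group T C (A i)) (\<lambda>j. \<pi> i \<cdot> (\<iota> j \<cdot> c j)) (?supp c)
              = \<one>\<^bsub>mor_group T C (A i)\<^esub>"
            by (rule comm_monoid.finprod_one_eqI [OF mor_group_monoid]) (use off False in auto)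
          then show ?thesis unfolding fi using False i by auto
        qed
      qed
      show ?thesis
      proof (rule PiE_ext [of _ _ "\<lambda>i. Mor T C (A i)"])
        show "c1 i = c2 i" if "i \<in> I" for i
          using component [OF c1 that] component [OF c2 that] by simp
      qed (use c1 c2 in blast)+
    qed
    ultimately show "\<exists>!c. ?P c" by blast
  qed
qed

lemma compactsD:
  fixes \<kappa> :: "'u rel" and I :: "'u set"
  assumes "C \<in> compacts \<kappa> T" "small \<kappa> I \<and> is_coproduct T I A S \<iota>" "f \<in> Mor T C S"
  obtains J where "J \<subseteq> I" "finite J"
    "\<And>e. \<lbrakk>e \<in> Mor T S S; \<And>j. j \<in> J \<Longrightarrow> e \<cdot> \<iota> j = \<iota> j\<rbrakk> \<Longrightarrow> e \<cdot> f = f"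
proof -
  obtain J where "J \<subseteq> I" "finite J"
      and J: "\<forall>e \<in> Mor T S S. (\<forall>j\<in>J. e \<cdot> \<iota> j = \<iota> j) \<longrightarrow> e \<cdot> f = f"
    using assms(1) [unfolded compacts_iff, rule_format, OF assms(2,3)] by (elim exE conjE)
  then show ?thesis using J by (intro that [of J]) auto
qed

end

section \<open>Closure of the compact objects under cones and suspension\<close>

context triangulated_category
begin

text \<open>Let \<open>J\<close> support \<open>f \<cdot> g\<close>, and let \<open>e\<close> be the
  projection to the part of \<open>J\<close>. Then \<open>f - e \<cdot> f\<close> kills
  \<open>g\<close>, so it factors through \<open>h\<close> by a map \<open>m\<close> with finite
  support \<open>K\<close>. Hence \<open>J \<union> K\<close> supports \<open>f\<close>.\<close>

lemma compacts_cone: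
  fixes \<kappa> :: "'u rel"
  assumes t: "(u, g, h) \<in> triangles T"
    and B: "trg T u \<in> compacts \<kappa> T" and SA: "trg T h \<in> compacts \<kappa> T"
  shows "trg T g \<in> compacts \<kappa> T"
  unfolding compacts_iff
proof (intro allI impI ballI)
  fix I :: "'u set" and A S \<iota> f
  assume *: "small \<kappa> I \<and> is_coproduct T I A S \<iota>" and f: "f \<in> Mor T (trg T g) S"
  then have cop: "is_coproduct T I A S \<iota>" by auto
  note typing = triangle_typing [OF t]
  have f': "src T f = trg T g" "trg T f = S" using f by (auto simp: Mor_iff)
  have \<iota>: "\<iota> i \<in> Mor T (A i) S" if "i \<in> I" for i using cop that by (auto simp: is_coproduct_def)
  have "f \<cdot> g \<in> Mor T (trg T u) S" using f' typing by (simp add: Mor_iff)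
  then obtain J where J: "J \<subseteq> I" "finite J"
      "\<And>e. \<lbrakk>e \<in> Mor T S S; \<And>j. j \<in> J \<Longrightarrow> e \<cdot> \<iota> j = \<iota> j\<rbrakk> \<Longrightarrow> e \<cdot> (f \<cdot> g) = f \<cdot> g"
    using compactsD [OF B *] by blast
  obtain e where e: "e \<in> Mor T S S" "\<And>j. j \<in> J \<Longrightarrow> e \<cdot> \<iota> j = \<iota> j" and fin:
      "\<And>C f. f \<in> Mor T C S \<Longrightarrow> \<exists>c. (\<forall>i\<in>J. c i \<in> Mor T C (A i)) \<and>
        e \<cdot> f = finprod (mor_group T C S) (\<lambda>i. \<iota> i \<cdot> c i) J"
    using coproduct_finite_part [OF cop J(1,2)] by blast
  have e': "src T e = S" "trg T e = S" using e(1) by (auto simp: Mor_iff)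
  have "e \<cdot> (f \<cdot> g) = f \<cdot> g" by (rule J(3)) (use e in auto)
  define d where "d = f \<boxplus> neg_mor T (e \<cdot> f)"
  have d: "src T d = trg T g" "trg T d = S" using f' e' by (simp_all add: d_def)
  have "d \<cdot> g = f \<cdot> g \<boxplus> neg_mor T (e \<cdot> f) \<cdot> g"
    unfolding d_def by (rule cmp_plus_left) (use f' e' typing in \<open>auto simp: Mor_iff\<close>)
  also have "\<dots> = f \<cdot> g \<boxplus> neg_mor T (f \<cdot> g)"
    using \<open>e \<cdot> (f \<cdot> g) = f \<cdot> g\<close> f' e' typing by simp
  also have "\<dots> = zer T (src T g) (trg T d)"
    using plus_neg [of "f \<cdot> g" "src T g" S] f' d typing by (simp add: Mor_iff)
  finally obtain m where m: "m \<in> Mor T (trg T h) S" "m \<cdot> h = d"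
    using triangle_weak_cokernel [OF triangle_rotateD [OF t], of d] d by metis
  obtain K where K: "K \<subseteq> I" "finite K"
      "\<And>e. \<lbrakk>e \<in> Mor T S S; \<And>j. j \<in> K \<Longrightarrow> e \<cdot> \<iota> j = \<iota> j\<rbrakk> \<Longrightarrow> e \<cdot> m = m"
    using compactsD [OF SA * m(1)] by blast
  have "e2 \<cdot> f = f" if e2: "e2 \<in> Mor T S S" "\<forall>j\<in>J \<union> K. e2 \<cdot> \<iota> j = \<iota> j" for e2
  proof -
    have e2': "src T e2 = S" "trg T e2 = S" using e2(1) by (auto simp: Mor_iff)
    have "e2 \<cdot> d = (e2 \<cdot> m) \<cdot> h"
      using m e2' typing by (metis Mor_iff cmp_cmp)
    then have e2d: "e2 \<cdot> d = d" using K(3) [of e2] e2 m(2) by simp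
    obtain c where c: "\<forall>i\<in>J. c i \<in> Mor T (trg T g) (A i)"
        "e \<cdot> f = finprod (mor_group T (trg T g) S) (\<lambda>i. \<iota> i \<cdot> c i) J"
      using fin [OF f] by blast
    \<comment> \<open>The map \<open>e \<cdot> f\<close> is a sum of maps through coprojections in
      \<open>J\<close>, which \<open>e2\<close> fixes.\<close>
    have e2e: "e2 \<cdot> (e \<cdot> f) = e \<cdot> f"
      unfolding c(2) by (rule finprod_fixed [OF e2(1), where A = A]) (use c(1) e2(2) J(1) \<iota> in auto)
    have sum: "f = d \<boxplus> e \<cdot> f"
      unfolding d_def by (rule plus_minus [symmetric]) (use f' e' in \<open>auto simp: Mor_iff\<close>)
    have "e2 \<cdot> (d \<boxplus> e \<cdot> f) = e2 \<cdot> d \<boxplus> e2 \<cdot> (e \<cdot> f)"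
      by (rule cmp_plus_right) (use f' e' e2' d in \<open>auto simp: Mor_iff\<close>)
    then show ?thesis unfolding e2d e2e sum [symmetric] .
  qed
  then show "\<exists>J \<subseteq> I. finite J \<and> (\<forall>e \<in> Mor T S S. (\<forall>j\<in>J. e \<cdot> \<iota> j = \<iota> j) \<longrightarrow> e \<cdot> f = f)"
    using J K by (intro exI [of _ "J \<union> K"]) auto
qed

text \<open>Suspension is an automorphism, so coproducts and the maps that test compactness can be
  desuspended.\<close>

lemma compacts_sus:
  fixes \<kappa> :: "'u rel"
  assumes C: "C \<in> compacts \<kappa> T"
  shows "susO T C \<in> compacts \<kappa> T"
  unfolding compacts_iff
proof (intro allI impI ballI)
  fix I :: "'u set" and A S \<iota> f
  assume *: "small \<kappa> I \<and> is_coproduct T I A S \<iota>" and f: "f \<in> Mor T (susO T C) S"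
  have surjO: "\<exists>X'. susO T X' = X" for X using bij_susO by (metis bij_pointE)
  have surjM: "\<exists>m'. susM T m' = m" for m using bij_susM by (metis bij_pointE)
  obtain S' where S': "susO T S' = S" using surjO by blast
  obtain A' where A': "\<And>i. susO T (A' i) = A i"
    using that [of "\<lambda>i. SOME X'. susO T X' = A i"] someI_ex [OF surjO] by blast
  obtain \<iota>' where \<iota>': "\<And>i. susM T (\<iota>' i) = \<iota> i"
    using that [of "\<lambda>i. SOME m. susM T m = \<iota> i"] someI_ex [OF surjM] by blast
  have lift: "susM T m \<in> Mor T (susO T X) (susO T Y) \<longleftrightarrow> m \<in> Mor T X Y" for m X Y
    using bij_is_inj [OF bij_susO] by (auto simp: Mor_iff inj_eq)
  have \<iota>typing: "\<iota> i \<in> Mor T (A i) S" if "i \<in> I" for i using * that by (auto simp: is_coproduct_def)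
  then have \<iota>'typing: "\<iota>' i \<in> Mor T (A' i) S'" if "i \<in> I" for i
    using that lift [of "\<iota>' i" "A' i" S'] by (simp add: \<iota>' A' S')
  have "is_coproduct T I A' S' \<iota>'"
    unfolding is_coproduct_def
  proof (intro conjI ballI allI impI)
    fix Y g assume g: "\<forall>i\<in>I. g i \<in> Mor T (A' i) Y"
    have "\<forall>i\<in>I. susM T (g i) \<in> Mor T (A i) (susO T Y)"
      using g lift by (metis A')
    then have ex1: "\<exists>!h. h \<in> Mor T S (susO T Y) \<and> (\<forall>i\<in>I. h \<cdot> \<iota> i = susM T (g i))"
      using conjunct2 [OF *, unfolded is_coproduct_def, THEN conjunct2, THEN spec, THEN spec,
        of "\<lambda>i. susM T (g i)" "susO T Y"] by (rule rev_mp)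
    \<comment> \<open>Through the bijection \<open>susM T\<close>, existence and uniqueness of the
      factorisation pass to the desuspended family.\<close>
    have corr: "susM T h \<in> Mor T S (susO T Y) \<and> (\<forall>i\<in>I. susM T h \<cdot> \<iota> i = susM T (g i))
        \<longleftrightarrow> h \<in> Mor T S' Y \<and> (\<forall>i\<in>I. h \<cdot> \<iota>' i = g i)" for h
    proof (cases "h \<in> Mor T S' Y")
      case True
      have "susM T h \<cdot> \<iota> i = susM T (h \<cdot> \<iota>' i)" if "i \<in> I" for i
        using True \<iota>'typing [OF that] by (simp add: Mor_iff \<iota>')
      then show ?thesis using True lift [of h S' Y] S' sus_faithful by (metis (full_types))
    qed (use lift [of h S' Y] S' in auto)
    obtain h where "h \<in> Mor T S' Y \<and> (\<forall>i\<in>I. h \<cdot> \<iota>' i = g i)" using ex1 corr surjM by metis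
    moreover have "h1 = h2" if "h1 \<in> Mor T S' Y \<and> (\<forall>i\<in>I. h1 \<cdot> \<iota>' i = g i)"
        "h2 \<in> Mor T S' Y \<and> (\<forall>i\<in>I. h2 \<cdot> \<iota>' i = g i)" for h1 h2
      using that ex1 unfolding corr [symmetric] by (blast intro: sus_faithful)
    ultimately show "\<exists>!h. h \<in> Mor T S' Y \<and> (\<forall>i\<in>I. h \<cdot> \<iota>' i = g i)" by blast
  qed (rule \<iota>'typing)
  moreover obtain f' where f': "f' \<in> Mor T C S'" "susM T f' = f"
    using f sus_full [of f C S'] by (auto simp: S')
  ultimately obtain J where J: "J \<subseteq> I" "finite J"
      "\<And>e. \<lbrakk>e \<in> Mor T S' S'; \<And>j. j \<in> J \<Longrightarrow> e \<cdot> \<iota>' j = \<iota>' j\<rbrakk> \<Longrightarrow> e \<cdot> f' = f'"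
    using * compactsD [OF C _ f'(1), of I A' \<iota>'] by blast
  have "e \<cdot> f = f" if e: "e \<in> Mor T S S" "\<forall>j\<in>J. e \<cdot> \<iota> j = \<iota> j" for e
  proof -
    obtain e' where e': "e' \<in> Mor T S' S'" "susM T e' = e"
      using e(1) sus_full [of e S' S'] by (auto simp: S')
    have "e' \<cdot> \<iota>' j = \<iota>' j" if "j \<in> J" for j
    proof (rule sus_faithful)
      show "susM T (e' \<cdot> \<iota>' j) = susM T (\<iota>' j)"
        using e(2) e' \<iota>'typing [of j] that J(1) by (auto simp: Mor_iff \<iota>')
    qed
    then have "susM T (e' \<cdot> f') = susM T f'" using J(3) e'(1) by simp
    then show ?thesis using e' f' by (simp add: Mor_iff)
  qed
  then show "\<exists>J \<subseteq> I. finite J \<and> (\<forall>e \<in> Mor T S S. (\<forall>j\<in>J. e \<cdot> \<iota> j = \<iota> j) \<longrightarrow> e \<cdot> f = f)"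
    using J by blast
qed

end

section \<open>Closure of the compact objects under duals\<close>

context big_tt_category
begin

lemma compact_rigid: "P \<in> compacts \<kappa> T \<Longrightarrow> P \<in> rigids T"
  by (simp add: compacts_eq_rigids)

text \<open>\<open>Hom(DP, -) \<cong> Hom(\<one>, - \<otimes> P)\<close>, the unit is compact, and \<open>- \<otimes> P\<close> preserves coproducts.\<close>

lemma compacts_dual:
  assumes "P \<in> compacts \<kappa> T"
  shows "dualO T P \<in> compacts \<kappa> T"
  unfolding compacts_iff
proof (intro allI impI ballI)
  fix I :: "'u set" and A S \<iota> f
  assume *: "small \<kappa> I \<and> is_coproduct T I A S \<iota>" and f: "f \<in> Mor T (dualO T P) S"
  have P: "P \<in> rigids T" using assms by (rule compact_rigid)
  have U: "unit T \<in> compacts \<kappa> T" unfolding compacts_eq_rigids by (rule unit_rigid)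
  have \<iota>: "src T (\<iota> i) = A i" "trg T (\<iota> i) = S" if "i \<in> I" for i
    using * that by (auto simp: is_coproduct_def Mor_iff)
  have "is_coproduct T I (\<lambda>i. A i \<boxtimes> P) (S \<boxtimes> P) (\<lambda>i. \<iota> i \<diamondop> idn T P)"
    using * by (intro coproduct_ten) auto
  then obtain J where J: "J \<subseteq> I" "finite J" "\<And>e. \<lbrakk>e \<in> Mor T (S \<boxtimes> P) (S \<boxtimes> P);
      \<And>j. j \<in> J \<Longrightarrow> e \<cdot> (\<iota> j \<diamondop> idn T P) = \<iota> j \<diamondop> idn T P\<rbrakk> \<Longrightarrow> e \<cdot> element P f = element P f"
    using * compactsD [OF U _ element_Mor [OF P f], of I "\<lambda>i. A i \<boxtimes> P" "\<lambda>i. \<iota> i \<diamondop> idn T P"] by blast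
  have "e \<cdot> f = f" if e: "e \<in> Mor T S S" "\<forall>j\<in>J. e \<cdot> \<iota> j = \<iota> j" for e
  proof (rule element_inject [OF P])
    have "(e \<diamondop> idn T P) \<cdot> (\<iota> j \<diamondop> idn T P) = \<iota> j \<diamondop> idn T P" if "j \<in> J" for j
      using e that J(1) \<iota> [of j] by (auto simp: Mor_iff ten_cmp_ten)
    then have "(e \<diamondop> idn T P) \<cdot> element P f = element P f"
      using e(1) by (intro J(3)) (auto simp: Mor_iff)
    then show "element P (e \<cdot> f) = element P f"
      using element_cmp [OF P f, of e] e(1) by (simp add: Mor_iff)
  qed (use e f in \<open>auto simp: Mor_iff\<close>)
  then show "\<exists>J \<subseteq> I. finite J \<and> (\<forall>e \<in> Mor T S S. (\<forall>j\<in>J. e \<cdot> \<iota> j = \<iota> j) \<longrightarrow> e \<cdot> f = f)"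
    using J by blast
qed

end

section \<open>Cokernel functors\<close>

context additive_category
begin

definition coker_class :: "'m \<Rightarrow> 'o \<Rightarrow> 'm \<Rightarrow> 'm set" where
  "coker_class f X u = precomp_image T f X #>\<^bsub>mor_group T (src T f) X\<^esub> u"

lemma precomp_image_normal: "precomp_image T f X \<lhd> mor_group T (src T f) X"
proof (rule comm_group.subgroup_imp_normal [OF mor_group_comm])
  show "subgroup (precomp_image T f X) (mor_group T (src T f) X)"
  proof (rule group.subgroupI [OF mor_group_group])
    show "precomp_image T f X \<subseteq> carrier (mor_group T (src T f) X)"
      by (auto simp: precomp_image_def Mor_iff)
    show "precomp_image T f X \<noteq> {}"
      using zer_Mor by (auto simp: precomp_image_def)
  next
    fix a assume "a \<in> precomp_image T f X"
    then obtain g where g: "src T g = trg T f" "trg T g = X" "a = g \<cdot> f"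
      by (auto simp: precomp_image_def Mor_iff)
    have "inv\<^bsub>mor_group T (src T f) X\<^esub> a = neg_mor T g \<cdot> f"
      using g by (simp flip: neg_mor_def [of T "g \<cdot> f", simplified g, simplified])
        (simp add: neg_mor_def)
    moreover have "neg_mor T g \<in> Mor T (trg T f) X" using g by (simp add: Mor_iff)
    ultimately show "inv\<^bsub>mor_group T (src T f) X\<^esub> a \<in> precomp_image T f X"
      by (auto simp: precomp_image_def)
  next
    fix a b assume "a \<in> precomp_image T f X" "b \<in> precomp_image T f X"
    then obtain g h where "g \<in> Mor T (trg T f) X" "h \<in> Mor T (trg T f) X" "a = g \<cdot> f" "b = h \<cdot> f"
      by (auto simp: precomp_image_def)
    then have "a \<boxplus> b = (g \<boxplus> h) \<cdot> f" "g \<boxplus> h \<in> Mor T (trg T f) X"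
      using cmp_plus_left [of f "src T f" "trg T f" g X h] plus_Mor by (auto simp: Mor_iff)
    then show "a \<otimes>\<^bsub>mor_group T (src T f) X\<^esub> b \<in> precomp_image T f X"
      by (auto simp: precomp_image_def)
  qed
qed

lemma precomp_image_subgroup: "subgroup (precomp_image T f X) (mor_group T (src T f) X)"
  using precomp_image_normal by (rule normal_imp_subgroup)

lemma mem_coker_class: "m \<in> coker_class f X u \<longleftrightarrow> (\<exists>g \<in> Mor T (trg T f) X. m = g \<cdot> f \<boxplus> u)"
  by (auto simp: coker_class_def r_coset_def precomp_image_def)

lemma coker_class_self: "u \<in> Mor T (src T f) X \<Longrightarrow> u \<in> coker_class f X u"
  unfolding coker_class_def using group.rcos_self [OF mor_group_group _ precomp_image_subgroup] by simp

lemma coker_class_eq: "\<lbrakk>u \<in> Mor T (src T f) X; v \<in> coker_class f X u\<rbrakk> \<Longrightarrow> coker_class f X v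
    = coker_class f X u"
  unfolding coker_class_def
      using group.repr_independence [OF mor_group_group _ _ precomp_image_subgroup]
  by (metis carrier_mor_group)

lemma coker_class_eq_image_iff:
  assumes "u \<in> Mor T (src T f) X"
  shows "coker_class f X u = precomp_image T f X \<longleftrightarrow> u \<in> precomp_image T f X"
  using group.coset_join1 [OF mor_group_group _ _ precomp_image_subgroup]
    group.coset_join2 [OF mor_group_group _ precomp_image_subgroup] assms
  unfolding coker_class_def by (metis carrier_mor_group)

lemma coker_class_Mor: "\<lbrakk>u \<in> Mor T (src T f) X; m \<in> coker_class f X u\<rbrakk> \<Longrightarrow> m \<in> Mor T (src T f) X"
  using plus_Mor cmp_Mor by (auto simp: mem_coker_class Mor_iff)

lemma carrier_coker: "carrier (fobj (coker_Hom T f) X) = coker_class f X ` Mor T (src T f) X"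
  by (simp add: coker_Hom_def carrier_FactGroup coker_class_def)

lemma one_coker: "\<one>\<^bsub>fobj (coker_Hom T f) X\<^esub> = precomp_image T f X"
  by (simp add: coker_Hom_def)

lemma mult_coker:
  "\<lbrakk>u \<in> Mor T (src T f) X; v \<in> Mor T (src T f) X\<rbrakk>
    \<Longrightarrow> coker_class f X u \<otimes>\<^bsub>fobj (coker_Hom T f) X\<^esub> coker_class f X v = coker_class f X (u \<boxplus> v)"
  using normal.rcos_sum [OF precomp_image_normal] by (simp add: coker_Hom_def coker_class_def)

lemma group_coker: "group (fobj (coker_Hom T f) X)"
  using normal.factorgroup_is_group [OF precomp_image_normal] by (simp add: coker_Hom_def)

text \<open>The link between the surjectivity in \<open>definable\<close> and the vanishing in
  \<open>annihilator\<close> and \<open>dual_definable\<close>.\<close>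

lemma trivial_coker_iff:
  "trivial_group (fobj (coker_Hom T f) X) \<longleftrightarrow> precomp_image T f X = Mor T (src T f) X"
proof -
  have sub: "precomp_image T f X \<subseteq> Mor T (src T f) X"
    using subgroup.subset [OF precomp_image_subgroup] by simp
  have "trivial_group (fobj (coker_Hom T f) X)
      \<longleftrightarrow> (\<forall>u \<in> Mor T (src T f) X. coker_class f X u = precomp_image T f X)"
    unfolding group.trivial_group_subset [OF group_coker] carrier_coker one_coker by auto
  also have "\<dots> \<longleftrightarrow> (\<forall>u \<in> Mor T (src T f) X. u \<in> precomp_image T f X)"
    using coker_class_eq_image_iff by blast
  finally show ?thesis using sub by auto
qed

text \<open>\<open>coker_Hom\<close> takes a union over all representatives of a coset; each
  contributes the same coset, because composition with \<open>u\<close> preserves factorisations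
  through \<open>f\<close>.\<close>

lemma fmor_coker:
  assumes u: "u \<in> Mor T X Y" and x: "x \<in> Mor T (src T f) X"
  shows "fmor (coker_Hom T f) u (coker_class f X x) = coker_class f Y (u \<cdot> x)"
proof -
  have ux: "u \<cdot> x \<in> Mor T (src T f) Y" using x u by (rule cmp_Mor)
  have const: "coker_class f Y (u \<cdot> y) = coker_class f Y (u \<cdot> x)" if "y \<in> coker_class f X x" for y
  proof (rule coker_class_eq [OF ux])
    obtain g where g: "g \<in> Mor T (trg T f) X" "y = g \<cdot> f \<boxplus> x"
      using \<open>y \<in> coker_class f X x\<close> by (auto simp: mem_coker_class)
    have "u \<cdot> y = u \<cdot> (g \<cdot> f) \<boxplus> u \<cdot> x"
      unfolding g(2) by (rule cmp_plus_right) (use g(1) x u in \<open>auto simp: Mor_iff\<close>)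
    also have "u \<cdot> (g \<cdot> f) = (u \<cdot> g) \<cdot> f" using g(1) u by (simp add: Mor_iff)
    finally show "u \<cdot> y \<in> coker_class f Y (u \<cdot> x)"
      using cmp_Mor [OF g(1) u] by (auto simp: mem_coker_class)
  qed
  have "trg T u = Y" using u by (simp add: Mor_iff)
  then have "fmor (coker_Hom T f) u (coker_class f X x)
      = (\<Union>y \<in> coker_class f X x. coker_class f Y (u \<cdot> y))"
    by (simp add: coker_Hom_def coker_class_def)
  also have "\<dots> = (\<Union>y \<in> coker_class f X x. coker_class f Y (u \<cdot> x))" by (intro SUP_cong refl const)
  finally show ?thesis using coker_class_self [OF x] by auto
qed

text \<open>Yoneda for \<open>Hom(coker Hom(f, -), Hom(Z, -))\<close>: these are the maps \<open>t : Z \<rightarrow> A\<close> with \<open>f t = 0\<close>.\<close>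

definition yoneda :: "'m \<Rightarrow> ('o \<Rightarrow> 'm set \<Rightarrow> 'm) \<Rightarrow> 'm" where
  "yoneda f \<theta> = \<theta> (src T f) (coker_class f (src T f) (idn T (src T f)))"

text \<open>Naturality, applied to the class of the identity, determines all values. The class of
  \<open>f\<close> itself is zero in the cokernel, hence \<open>f\<close> kills the resulting
  map.\<close>

lemma
  assumes f: "f \<in> compact_maps \<kappa> T"
    and \<theta>: "\<theta> \<in> carrier (nat_group \<kappa> T (coker_Hom T f) (representable T Z))"
  shows yoneda_Mor: "yoneda f \<theta> \<in> Mor T Z (src T f)"
    and cmp_yoneda: "f \<cdot> yoneda f \<theta> = zer T Z (trg T f)"
    and yoneda_apply: "\<And>C e. \<lbrakk>C \<in> compacts \<kappa> T; e \<in> Mor T (src T f) C\<rbrakk> \<Longrightarrow> \<theta> C (coker_class f C e)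
        = e \<cdot> yoneda f \<theta>"
proof -
  let ?A = "src T f" and ?B = "trg T f" and ?G = "coker_Hom T f"
  have AB: "?A \<in> compacts \<kappa> T" "?B \<in> compacts \<kappa> T" using f by (auto simp: compact_maps_def)
  have fAB: "f \<in> Mor T ?A ?B" by (simp add: Mor_iff)
  have hom: "\<theta> C \<in> hom (fobj ?G C) (mor_group T Z C)" if "C \<in> compacts \<kappa> T" for C
    using \<theta> that by (auto simp: nat_group_def nat_transformation_def representable_def)
  have nat: "\<theta> C (fmor ?G u x) = u \<cdot> \<theta> C' x"
    if "C' \<in> compacts \<kappa> T" "C \<in> compacts \<kappa> T" "u \<in> Mor T C' C" "x \<in> carrier (fobj ?G C')" for u x C C'
    using \<theta> that by (auto simp: nat_group_def nat_transformation_def representable_def compact_maps_def Mor_iff)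
  have idc: "coker_class f ?A (idn T ?A) \<in> carrier (fobj ?G ?A)"
    unfolding carrier_coker using idn_Mor by blast
  show t: "yoneda f \<theta> \<in> Mor T Z ?A"
    using hom_in_carrier [OF hom [OF AB(1)] idc] by (simp add: yoneda_def)
  show apply_e: "\<theta> C (coker_class f C e) = e \<cdot> yoneda f \<theta>" if "C \<in> compacts \<kappa> T" "e \<in> Mor T ?A C"
      for C e
    using nat [OF AB(1) that idc] fmor_coker [OF that(2) idn_Mor] that(2)
    by (simp add: yoneda_def Mor_iff)
  have "f \<in> precomp_image T f ?B"
    using idn_Mor by (auto simp: precomp_image_def intro!: image_eqI [where x = "idn T ?B"])
  then have "f \<cdot> yoneda f \<theta> = \<theta> ?B \<one>\<^bsub>fobj ?G ?B\<^esub>"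
    using apply_e [OF AB(2) fAB] coker_class_eq_image_iff [OF fAB] by (simp add: one_coker)
  also have "\<dots> = zer T Z ?B"
    using hom_one [OF hom [OF AB(2)] group_coker mor_group_group] by simp
  finally show "f \<cdot> yoneda f \<theta> = zer T Z ?B" .
qed

lemma yoneda_inject:
  assumes f: "f \<in> compact_maps \<kappa> T"
    and \<theta>: "\<theta> \<in> carrier (nat_group \<kappa> T (coker_Hom T f) (representable T Z))"
    and \<theta>': "\<theta>' \<in> carrier (nat_group \<kappa> T (coker_Hom T f) (representable T Z))"
    and eq: "yoneda f \<theta> = yoneda f \<theta>'"
  shows "\<theta> = \<theta>'"
proof (rule PiE_ext)
  let ?E = "\<lambda>C. extensional (carrier (fobj (coker_Hom T f) C)) :: ('m set \<Rightarrow> 'm) set"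
  show "\<theta> \<in> (\<Pi>\<^sub>E C \<in> compacts \<kappa> T. ?E C)" "\<theta>' \<in> (\<Pi>\<^sub>E C \<in> compacts \<kappa> T. ?E C)"
    using \<theta> \<theta>' by (auto simp: nat_group_def)
  fix C assume C: "C \<in> compacts \<kappa> T"
  show "\<theta> C = \<theta>' C"
  proof (rule extensionalityI)
    show "\<theta> C \<in> ?E C" "\<theta>' C \<in> ?E C" using \<theta> \<theta>' C by (auto simp: nat_group_def)
    show "\<theta> C x = \<theta>' C x" if "x \<in> carrier (fobj (coker_Hom T f) C)" for x
      using that yoneda_apply [OF f \<theta> C] yoneda_apply [OF f \<theta>' C] eq by (auto simp: carrier_coker)
  qed
qed

lemma yoneda_surj:
  assumes f: "f \<in> compact_maps \<kappa> T" and t: "t \<in> Mor T Z (src T f)" and ft: "f \<cdot> t = zer T Z (trg T f)"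
  obtains \<theta> where "\<theta> \<in> carrier (nat_group \<kappa> T (coker_Hom T f) (representable T Z))" "yoneda f \<theta> = t"
proof -
  let ?A = "src T f" and ?G = "coker_Hom T f"
  \<comment> \<open>The choice of a representative is harmless: two of them differ by some
    \<open>g \<cdot> f\<close>, and \<open>f \<cdot> t\<close> vanishes.\<close>
  define \<theta> where "\<theta> = (\<lambda>C \<in> compacts \<kappa> T. \<lambda>x \<in> carrier (fobj ?G C). (SOME e. e \<in> x) \<cdot> t)"
  have app: "\<theta> C (coker_class f C e) = e \<cdot> t" if C: "C \<in> compacts \<kappa> T" and e: "e \<in> Mor T ?A C" for C e
  proof -
    have "(SOME e'. e' \<in> coker_class f C e) \<in> coker_class f C e" using coker_class_self [OF e]
        by (rule someI)
    then obtain g where g: "g \<in> Mor T (trg T f) C" "(SOME e'. e' \<in> coker_class f C e) = g \<cdot> f \<boxplus> e"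
      by (auto simp: mem_coker_class)
    have "(g \<cdot> f \<boxplus> e) \<cdot> t = (g \<cdot> f) \<cdot> t \<boxplus> e \<cdot> t"
      by (rule cmp_plus_left [OF t]) (use g(1) e in \<open>auto simp: Mor_iff\<close>)
    also have "(g \<cdot> f) \<cdot> t = g \<cdot> (f \<cdot> t)" using g(1) t by (simp add: Mor_iff)
    finally have "(g \<cdot> f \<boxplus> e) \<cdot> t = e \<cdot> t" using g(1) e t by (simp add: ft Mor_iff)
    then show ?thesis using C e by (simp add: \<theta>_def carrier_coker g(2))
  qed
  have "\<theta> \<in> carrier (nat_group \<kappa> T ?G (representable T Z))"
  proof -
    have "nat_transformation \<kappa> T ?G (representable T Z) \<theta>"
      unfolding nat_transformation_def
    proof (intro conjI ballI)
      fix C assume C: "C \<in> compacts \<kappa> T"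
      show "\<theta> C \<in> hom (fobj ?G C) (fobj (representable T Z) C)"
      proof (rule homI)
        show "\<theta> C x \<in> carrier (fobj (representable T Z) C)" if "x \<in> carrier (fobj ?G C)" for x
          using that app [OF C] t by (auto simp: carrier_coker representable_def intro: cmp_Mor)
        fix x y assume "x \<in> carrier (fobj ?G C)" "y \<in> carrier (fobj ?G C)"
        then obtain d e where "d \<in> Mor T ?A C" "e \<in> Mor T ?A C" "x = coker_class f C d" "y
            = coker_class f C e"
          by (auto simp: carrier_coker)
        then show "\<theta> C (x \<otimes>\<^bsub>fobj ?G C\<^esub> y) = \<theta> C x \<otimes>\<^bsub>fobj (representable T Z) C\<^esub> \<theta> C y"
          using app [OF C] cmp_plus_left [OF t, of d C e]
          by (simp add: mult_coker plus_Mor representable_def)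
      qed
    next
      fix u x assume u: "u \<in> compact_maps \<kappa> T" and "x \<in> carrier (fobj ?G (src T u))"
      then obtain e where e: "e \<in> Mor T ?A (src T u)" "x = coker_class f (src T u) e"
        by (auto simp: carrier_coker)
      have uM: "u \<in> Mor T (src T u) (trg T u)" by (simp add: Mor_iff)
      show "\<theta> (trg T u) (fmor ?G u x) = fmor (representable T Z) u (\<theta> (src T u) x)"
        using u app [of "trg T u" "u \<cdot> e"] app [of "src T u" e] e t cmp_Mor [OF e(1) uM]
        by (simp add: fmor_coker [OF uM e(1)] compact_maps_def representable_def Mor_iff)
    qed
    then show ?thesis by (auto simp: nat_group_def \<theta>_def)
  qed
  moreover have "yoneda f \<theta> = t"
    using app [of ?A "idn T ?A"] f t by (simp add: yoneda_def compact_maps_def idn_Mor Mor_iff)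
  ultimately show ?thesis by (rule that)
qed

lemma yoneda_mult:
  assumes "f \<in> compact_maps \<kappa> T"
  shows "yoneda f (\<theta> \<otimes>\<^bsub>nat_group \<kappa> T (coker_Hom T f) (representable T Z)\<^esub> \<theta>')
    = yoneda f \<theta> \<boxplus> yoneda f \<theta>'"
proof -
  have "src T f \<in> compacts \<kappa> T" using assms by (simp add: compact_maps_def)
  moreover have "coker_class f (src T f) (idn T (src T f)) \<in> carrier (fobj (coker_Hom T f) (src T f))"
    unfolding carrier_coker using idn_Mor by blast
  ultimately show ?thesis by (simp add: yoneda_def nat_group_def representable_def)
qed

text \<open>Vanishing is stated as idempotence, since a homomorphism into a group sends idempotents
  to the unit; only the multiplication of \<open>nat_group\<close> is involved.\<close>

lemma yoneda_zer_idem: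
  assumes f: "f \<in> compact_maps \<kappa> T"
    and \<theta>: "\<theta> \<in> carrier (nat_group \<kappa> T (coker_Hom T f) (representable T Z))"
    and zero: "yoneda f \<theta> = zer T Z (src T f)"
  shows "\<theta> \<otimes>\<^bsub>nat_group \<kappa> T (coker_Hom T f) (representable T Z)\<^esub> \<theta> = \<theta>" (is "?\<omega> = _")
proof (rule ext, rule ext)
  fix C x
  have ext: "\<theta> \<in> extensional (compacts \<kappa> T)"
      "C \<in> compacts \<kappa> T \<Longrightarrow> \<theta> C \<in> extensional (carrier (fobj (coker_Hom T f) C))"
    using \<theta> by (auto simp: nat_group_def PiE_def)
  consider "C \<in> compacts \<kappa> T" "x \<in> carrier (fobj (coker_Hom T f) C)"
    | "C \<in> compacts \<kappa> T" "x \<notin> carrier (fobj (coker_Hom T f) C)" | "C \<notin> compacts \<kappa> T"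
    by blast
  then show "?\<omega> C x = \<theta> C x"
  proof cases
    case 1
    then obtain e where e: "e \<in> Mor T (src T f) C" "x = coker_class f C e" by (auto simp: carrier_coker)
    have "\<theta> C x = zer T Z C"
      using yoneda_apply [OF f \<theta> 1(1) e(1)] e(1) by (simp add: e(2) zero Mor_iff)
    then show ?thesis using 1 by (simp add: nat_group_def representable_def zer_Mor)
  qed (use ext in \<open>auto simp: nat_group_def extensional_def\<close>)
qed

end

context tensor_triangulated_category
begin

lemma yoneda_delta:
  assumes "f \<in> compact_maps \<kappa> T"
  shows "yoneda f (fmor (delta \<kappa> T (coker_Hom T f)) u \<theta>) = yoneda f \<theta> \<cdot> dualM T u"
proof -
  have "src T f \<in> compacts \<kappa> T" using assms by (simp add: compact_maps_def)
  moreover have "coker_class f (src T f) (idn T (src T f)) \<in> carrier (fobj (coker_Hom T f) (src T f))"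
    unfolding carrier_coker using idn_Mor by blast
  ultimately show ?thesis by (simp add: yoneda_def delta_def)
qed

lemma fobj_delta: "fobj (delta \<kappa> T G) C = nat_group \<kappa> T G (representable T (dualO T C))"
  by (simp add: delta_def)

text \<open>The composite is identified with the transformation that \<open>yoneda_surj\<close>
  builds from \<open>yoneda f \<theta> \<cdot> dualM T u\<close>: both agree on classes and are
  undefined elsewhere.\<close>

lemma delta_Mor:
  assumes f: "f \<in> compact_maps \<kappa> T" and u: "u \<in> Mor T P C"
    and \<theta>: "\<theta> \<in> carrier (fobj (delta \<kappa> T (coker_Hom T f)) P)"
  shows "fmor (delta \<kappa> T (coker_Hom T f)) u \<theta> \<in> carrier (fobj (delta \<kappa> T (coker_Hom T f)) C)"
proof -
  let ?G = "coker_Hom T f"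
  note \<theta>' = \<theta> [unfolded fobj_delta]
  have uPC: "src T u = P" "trg T u = C" using u by (auto simp: Mor_iff)
  have Du: "dualM T u \<in> Mor T (dualO T C) (dualO T P)" by (simp add: Mor_iff uPC)
  obtain \<theta>2 where \<theta>2: "\<theta>2 \<in> carrier (nat_group \<kappa> T ?G (representable T (dualO T C)))"
      "yoneda f \<theta>2 = yoneda f \<theta> \<cdot> dualM T u"
  proof (rule yoneda_surj [OF f])
    show "yoneda f \<theta> \<cdot> dualM T u \<in> Mor T (dualO T C) (src T f)"
      using Du yoneda_Mor [OF f \<theta>'] by (rule cmp_Mor)
    have "f \<cdot> (yoneda f \<theta> \<cdot> dualM T u) = (f \<cdot> yoneda f \<theta>) \<cdot> dualM T u"
      using Du yoneda_Mor [OF f \<theta>'] by (intro cmp_cmp [symmetric]) (auto simp: Mor_iff)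
    then show "f \<cdot> (yoneda f \<theta> \<cdot> dualM T u) = zer T (dualO T C) (trg T f)"
      using Du by (simp add: cmp_yoneda [OF f \<theta>'] Mor_iff)
  qed
  have "fmor (delta \<kappa> T ?G) u \<theta> = \<theta>2"
  proof
    fix D
    show "fmor (delta \<kappa> T ?G) u \<theta> D = \<theta>2 D"
    proof (cases "D \<in> compacts \<kappa> T")
      case D: True
      show ?thesis
      proof
        fix x
        show "fmor (delta \<kappa> T ?G) u \<theta> D x = \<theta>2 D x"
        proof (cases "x \<in> carrier (fobj ?G D)")
          case True
          then obtain e where e: "e \<in> Mor T (src T f) D" "x = coker_class f D e"
            by (auto simp: carrier_coker)
          have "(e \<cdot> yoneda f \<theta>) \<cdot> dualM T u = e \<cdot> (yoneda f \<theta> \<cdot> dualM T u)"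
            using Du yoneda_Mor [OF f \<theta>'] e(1) by (intro cmp_cmp) (auto simp: Mor_iff)
          then show ?thesis
            using D True yoneda_apply [OF f \<theta>' D e(1)] yoneda_apply [OF f \<theta>2(1) D e(1)]
            by (simp add: delta_def e(2) \<theta>2(2))
        next
          case False
          moreover have "\<theta>2 D \<in> extensional (carrier (fobj ?G D))"
            using \<theta>2(1) D by (auto simp: nat_group_def)
          ultimately show ?thesis using D by (simp add: delta_def extensional_def)
        qed
      qed
    next
      case False
      moreover have "\<theta>2 \<in> extensional (compacts \<kappa> T)"
        using \<theta>2(1) by (auto simp: nat_group_def PiE_def)
      ultimately show ?thesis by (simp add: delta_def extensional_def)
    qed
  qed
  then show ?thesis using \<theta>2(1) by (simp add: fobj_delta)
qed

end

section \<open>Dual definable classes\<close>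

context big_tt_category
begin

text \<open>
  With \<open>q\<close> the cofibre of \<open>Df\<close> and \<open>f'\<close> the next map, \<open>(\<delta> coker Hom(f', -))(C)\<close> consists of the maps
  \<open>DC \<rightarrow> E\<close> killed by \<open>f'\<close>, that is, of \<open>Hom(DC, DA) = Hom(A, C)\<close> modulo \<open>Hom(DC, DB) = Hom(B, C)\<close>.
\<close>

lemma delta_coker:
  assumes f: "f \<in> compact_maps \<kappa> T" and f': "f' \<in> compact_maps \<kappa> T"
    and tri: "(dualM T f, q, f') \<in> triangles T"
  shows "nat_isomorphic \<kappa> T (delta \<kappa> T (coker_Hom T f')) (coker_Hom T f)"
proof -
  let ?A = "src T f" and ?B = "trg T f" and ?G = "coker_Hom T f'" and ?H = "coker_Hom T f"
  let ?\<delta> = "delta \<kappa> T ?G"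
  have AB: "?A \<in> rigids T" "?B \<in> rigids T" using f by (auto simp: compact_maps_def compacts_eq_rigids)
  note tri' = triangle_rotateD [OF tri]
  have q: "src T q = dualO T ?A" "trg T q = src T f'" using triangle_typing [OF tri] by auto
  have qDf: "q \<cdot> dualM T f = zer T (dualO T ?B) (src T f')"
    using triangle_cmp_zer [OF tri] by (simp add: q)
  have f'q: "f' \<cdot> q = zer T (dualO T ?A) (trg T f')"
    using triangle_cmp_zer [OF tri'] by (simp add: q)
  \<comment> \<open>The set of all \<open>u\<close> for which \<open>Du\<close> lifts
    \<open>s\<close> along \<open>q\<close>. It turns out to be a coset, so \<open>\<eta>\<close> is
    defined without choosing a lift.\<close>
  define S where "S C s = {u \<in> Mor T ?A C. q \<cdot> dualM T u = s}" for C s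
  define \<eta> where "\<eta> C \<theta> = S C (yoneda f' \<theta>)" for C and \<theta> :: "'o \<Rightarrow> 'm set \<Rightarrow> 'm"
  \<comment> \<open>If \<open>d\<close> is a difference of two lifts, \<open>q\<close> kills
    \<open>Dd\<close>, so \<open>Dd\<close> factors through \<open>Df\<close>; as duality is fully
    faithful, \<open>d\<close> factors through \<open>f\<close>. Conversely, adding
    \<open>g \<cdot> f\<close> changes nothing because \<open>q\<close> kills
    \<open>Df\<close>.\<close>
  have S_coker_class: "S C s = coker_class f C u" if C: "C \<in> compacts \<kappa> T" and u: "u \<in> S C s" for C s u
  proof (intro equalityI subsetI)
    have C': "C \<in> rigids T" using C by (rule compact_rigid)
    have uA: "u \<in> Mor T ?A C" "q \<cdot> dualM T u = s" using u by (auto simp: S_def)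
    show "v \<in> coker_class f C u" if "v \<in> S C s" for v
    proof -
      have vA: "v \<in> Mor T ?A C" "q \<cdot> dualM T v = s" using that by (auto simp: S_def)
      define d where "d = v \<boxplus> neg_mor T u"
      have d: "d \<in> Mor T ?A C" using uA(1) vA(1) by (auto simp: d_def intro: plus_Mor neg_Mor)
      have vd: "v = d \<boxplus> u" using plus_minus [OF vA(1) uA(1)] by (simp add: d_def)
      have "q \<cdot> dualM T v = q \<cdot> dualM T d \<boxplus> q \<cdot> dualM T u"
        unfolding vd dualM_plus [OF d uA(1)]
        by (rule cmp_plus_right) (use d uA(1) q in \<open>auto simp: Mor_iff\<close>)
      then have eq: "s = q \<cdot> dualM T d \<boxplus> s" using vA(2) uA(2) by simp
      have "q \<cdot> dualM T d \<in> Mor T (dualO T C) (src T f')" "s \<in> Mor T (dualO T C) (src T f')"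
        using d uA q by (auto simp: Mor_iff)
      then have "q \<cdot> dualM T d = zer T (dualO T C) (src T f')"
        using eq group.r_cancel_one' [OF mor_group_group, of s "dualO T C" "src T f'"]
        by (metis carrier_mor_group mult_mor_group one_mor_group)
      then obtain r where r: "r \<in> Mor T (dualO T C) (dualO T ?B)" "dualM T f \<cdot> r = dualM T d"
        using triangle_weak_kernel [OF tri, of "dualM T d"] d q by (auto simp: Mor_iff)
      obtain g where g: "g \<in> Mor T ?B C" "dualM T g = r"
        using dualM_full [OF AB(2) C' r(1)] by blast
      have "dualM T d = dualM T (g \<cdot> f)"
        using dualM_cmp [of f ?A ?B g C] g r(2) by (simp add: Mor_iff)
      then have "d = g \<cdot> f"
        by (intro dualM_faithful [OF AB(1) C' d]) (use g(1) in \<open>auto simp: Mor_iff\<close>)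
      then show ?thesis using g(1) vd by (auto simp: mem_coker_class)
    qed
    show "v \<in> S C s" if "v \<in> coker_class f C u" for v
    proof -
      obtain g where g: "g \<in> Mor T ?B C" "v = g \<cdot> f \<boxplus> u" using \<open>v \<in> coker_class f C u\<close>
          by (auto simp: mem_coker_class)
      have gf: "g \<cdot> f \<in> Mor T ?A C" using g(1) by (simp add: Mor_iff)
      have "q \<cdot> dualM T v = q \<cdot> dualM T (g \<cdot> f) \<boxplus> q \<cdot> dualM T u"
        unfolding g(2) dualM_plus [OF gf uA(1)]
        by (rule cmp_plus_right) (use gf uA(1) q g(1) in \<open>auto simp: Mor_iff\<close>)
      also have "q \<cdot> dualM T (g \<cdot> f) = (q \<cdot> dualM T f) \<cdot> dualM T g"
        using dualM_cmp [of f ?A ?B g C] g(1) q by (simp add: Mor_iff)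
      also have "\<dots> = zer T (dualO T C) (src T f')" unfolding qDf using g(1) by (simp add: Mor_iff)
      finally have "q \<cdot> dualM T v = zer T (dualO T C) (src T f') \<boxplus> s" unfolding uA(2) .
      moreover have "s \<in> Mor T (dualO T C) (src T f')" using uA q by (auto simp: Mor_iff)
      ultimately have "q \<cdot> dualM T v = s" by simp
      then show ?thesis using coker_class_Mor [OF uA(1) \<open>v \<in> coker_class f C u\<close>] by (simp add: S_def)
    qed
  qed
  have carrierD: "\<theta> \<in> carrier (nat_group \<kappa> T ?G (representable T (dualO T C)))"
    if "\<theta> \<in> carrier (fobj ?\<delta> C)" for \<theta> C using that by (simp add: fobj_delta)
  \<comment> \<open>The Yoneda map is killed by \<open>f'\<close>, so it lifts along
    \<open>q\<close> by exactness, and fullness of duality gives the lift the form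
    \<open>Du\<close>.\<close>
  have ex: "\<exists>u. u \<in> Mor T ?A C \<and> q \<cdot> dualM T u = yoneda f' \<theta>"
    if C: "C \<in> compacts \<kappa> T" and \<theta>: "\<theta> \<in> carrier (fobj ?\<delta> C)" for C \<theta>
  proof -
    note \<theta>' = carrierD [OF \<theta>]
    have "yoneda f' \<theta> \<in> Mor T (dualO T C) (src T f')" "f' \<cdot> yoneda f' \<theta> = zer T (dualO T C) (trg T f')"
      using yoneda_Mor [OF f' \<theta>'] cmp_yoneda [OF f' \<theta>'] by auto
    then obtain r where r: "r \<in> Mor T (dualO T C) (dualO T ?A)" "q \<cdot> r = yoneda f' \<theta>"
      using triangle_weak_kernel [OF tri', of "yoneda f' \<theta>"] q by (auto simp: Mor_iff)
    then show ?thesis using dualM_full [OF AB(1) compact_rigid [OF C] r(1)] by metis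
  qed
  have \<eta>_coker_class: "\<eta> C \<theta> = coker_class f C u"
    if "C \<in> compacts \<kappa> T" "u \<in> Mor T ?A C" "q \<cdot> dualM T u = yoneda f' \<theta>" for C \<theta> u
    unfolding \<eta>_def by (rule S_coker_class) (use that in \<open>auto simp: S_def\<close>)
  have hom: "\<eta> C \<in> hom (fobj ?\<delta> C) (fobj ?H C)" if C: "C \<in> compacts \<kappa> T" for C
  proof (rule homI)
    show "\<eta> C \<theta> \<in> carrier (fobj ?H C)" if "\<theta> \<in> carrier (fobj ?\<delta> C)" for \<theta>
      using ex [OF C that] \<eta>_coker_class [OF C] by (auto simp: carrier_coker)
    fix \<theta> \<theta>' assume "\<theta> \<in> carrier (fobj ?\<delta> C)" "\<theta>' \<in> carrier (fobj ?\<delta> C)"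
    then obtain u v where u: "u \<in> Mor T ?A C" "q \<cdot> dualM T u = yoneda f' \<theta>"
        and v: "v \<in> Mor T ?A C" "q \<cdot> dualM T v = yoneda f' \<theta>'"
      using ex [OF C] by meson
    have "q \<cdot> dualM T (u \<boxplus> v) = q \<cdot> dualM T u \<boxplus> q \<cdot> dualM T v"
      unfolding dualM_plus [OF u(1) v(1)]
      by (rule cmp_plus_right) (use u(1) v(1) q in \<open>auto simp: Mor_iff\<close>)
    then have "q \<cdot> dualM T (u \<boxplus> v) = yoneda f' (\<theta> \<otimes>\<^bsub>fobj ?\<delta> C\<^esub> \<theta>')"
      using u(2) v(2) by (simp add: fobj_delta yoneda_mult [OF f'])
    then show "\<eta> C (\<theta> \<otimes>\<^bsub>fobj ?\<delta> C\<^esub> \<theta>') = \<eta> C \<theta> \<otimes>\<^bsub>fobj ?H C\<^esub> \<eta> C \<theta>'"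
      using \<eta>_coker_class [OF C plus_Mor [OF u(1) v(1)]] \<eta>_coker_class [OF C u] \<eta>_coker_class [OF C v] u(1) v(1)
      by (simp add: mult_coker)
  qed
  have inj: "inj_on (\<eta> C) (carrier (fobj ?\<delta> C))" if C: "C \<in> compacts \<kappa> T" for C
  proof (rule inj_onI)
    fix \<theta> \<theta>' assume \<theta>: "\<theta> \<in> carrier (fobj ?\<delta> C)" and \<theta>': "\<theta>' \<in> carrier (fobj ?\<delta> C)" and eq: "\<eta> C \<theta>
        = \<eta> C \<theta>'"
    obtain u where u: "u \<in> Mor T ?A C" "q \<cdot> dualM T u = yoneda f' \<theta>" using ex [OF C \<theta>] by blast
    \<comment> \<open>Both values are the same set of lifts, so the common lift \<open>u\<close>
      determines both Yoneda maps.\<close>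
    then have "u \<in> \<eta> C \<theta>" by (simp add: \<eta>_def S_def)
    then have "yoneda f' \<theta>' = yoneda f' \<theta>" unfolding eq using u(2) by (simp add: \<eta>_def S_def)
    then show "\<theta> = \<theta>'" using yoneda_inject [OF f' carrierD [OF \<theta>] carrierD [OF \<theta>']] by simp
  qed
  \<comment> \<open>As \<open>f'\<close> kills \<open>q\<close>, the map \<open>q \<cdot> Du\<close>
    comes from a transformation, and \<open>u\<close> is one of its lifts.\<close>
  have surj: "coker_class f C u \<in> \<eta> C ` carrier (fobj ?\<delta> C)"
      if C: "C \<in> compacts \<kappa> T" and u: "u \<in> Mor T ?A C" for C u
  proof -
    have Du: "src T (dualM T u) = dualO T C" "trg T (dualM T u) = dualO T ?A" using u
        by (auto simp: Mor_iff)
    obtain \<theta> where \<theta>: "\<theta> \<in> carrier (nat_group \<kappa> T ?G (representable T (dualO T C)))"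
        "yoneda f' \<theta> = q \<cdot> dualM T u"
    proof (rule yoneda_surj [OF f'])
      show "q \<cdot> dualM T u \<in> Mor T (dualO T C) (src T f')" using Du q by (simp add: Mor_iff)
      have "f' \<cdot> (q \<cdot> dualM T u) = (f' \<cdot> q) \<cdot> dualM T u" using Du q by simp
      then show "f' \<cdot> (q \<cdot> dualM T u) = zer T (dualO T C) (trg T f')" using Du by (simp add: f'q)
    qed
    then show ?thesis using \<eta>_coker_class [OF C u] by (metis fobj_delta image_eqI)
  qed
  have "nat_transformation \<kappa> T ?\<delta> ?H \<eta>"
    unfolding nat_transformation_def
  proof (intro conjI ballI)
    fix m \<theta> assume m: "m \<in> compact_maps \<kappa> T" and \<theta>: "\<theta> \<in> carrier (fobj ?\<delta> (src T m))"
    have C: "src T m \<in> compacts \<kappa> T" "trg T m \<in> compacts \<kappa> T" using m by (auto simp: compact_maps_def)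
    have mM: "m \<in> Mor T (src T m) (trg T m)" by (simp add: Mor_iff)
    obtain u where u: "u \<in> Mor T ?A (src T m)" "q \<cdot> dualM T u = yoneda f' \<theta>" using ex [OF C(1) \<theta>]
        by blast
    have "q \<cdot> dualM T (m \<cdot> u) = yoneda f' (fmor ?\<delta> m \<theta>)"
      unfolding yoneda_delta [OF f'] u(2) [symmetric] dualM_cmp [OF u(1) mM]
      using u(1) q by (simp add: Mor_iff)
    then have "\<eta> (trg T m) (fmor ?\<delta> m \<theta>) = coker_class f (trg T m) (m \<cdot> u)"
      by (rule \<eta>_coker_class [OF C(2) cmp_Mor [OF u(1) mM]])
    then show "\<eta> (trg T m) (fmor ?\<delta> m \<theta>) = fmor ?H m (\<eta> (src T m) \<theta>)"
      using \<eta>_coker_class [OF C(1) u] fmor_coker [OF mM u(1)] by simp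
  qed (rule hom)
  moreover have "\<eta> C \<in> iso (fobj ?\<delta> C) (fobj ?H C)" if C: "C \<in> compacts \<kappa> T" for C
  proof -
    have "\<eta> C ` carrier (fobj ?\<delta> C) = carrier (fobj ?H C)"
    proof
      show "\<eta> C ` carrier (fobj ?\<delta> C) \<subseteq> carrier (fobj ?H C)"
        using hom_carrier [OF hom [OF C]] .
      show "carrier (fobj ?H C) \<subseteq> \<eta> C ` carrier (fobj ?\<delta> C)"
        unfolding carrier_coker using surj [OF C] by auto
    qed
    then show ?thesis using hom [OF C] inj [OF C] by (simp add: iso_def bij_betw_def)
  qed
  ultimately show ?thesis unfolding nat_isomorphic_def by blast
qed

lemma precomp_image_eq_iff:
  "precomp_image T f X = Mor T (src T f) X
    \<longleftrightarrow> (\<forall>h \<in> Mor T (src T f) X. \<exists>g \<in> Mor T (trg T f) X. g \<cdot> f = h)"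
proof -
  have "precomp_image T f X \<subseteq> Mor T (src T f) X"
    using subgroup.subset [OF precomp_image_subgroup, of f X] by simp
  then have "precomp_image T f X = Mor T (src T f) X \<longleftrightarrow> Mor T (src T f) X \<subseteq> precomp_image T f X"
    by blast
  also have "\<dots> \<longleftrightarrow> (\<forall>h \<in> Mor T (src T f) X. \<exists>g \<in> Mor T (trg T f) X. h = g \<cdot> f)"
    by (auto simp: precomp_image_def)
  finally show ?thesis by (simp add: eq_commute)
qed

text \<open>Extension problems along the defining maps transport along isomorphisms. This is used to
  pass from \<open>DP \<otimes> Y\<close>, which the ideal contains, to
  \<open>F(P, Y)\<close>.\<close>

lemma definable_iso_closed:
  assumes D: "definable \<kappa> T D" and X: "X \<in> D" and iso: "is_iso T \<phi>" "src T \<phi> = X"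
  shows "trg T \<phi> \<in> D"
proof -
  obtain F where F: "D = {X. \<forall>f\<in>F. precomp_image T f X = Mor T (src T f) X}"
    using D unfolding definable_def by blast
  have "\<exists>g \<in> Mor T (trg T f) (trg T \<phi>). g \<cdot> f = h" if f: "f \<in> F" and h: "h \<in> Mor T (src T f) (trg T \<phi>)"
      for f h
  proof -
    have "inverse_mor T \<phi> \<cdot> h \<in> Mor T (src T f) X" using h iso by (simp add: Mor_iff)
    then obtain g where g: "g \<in> Mor T (trg T f) X" "g \<cdot> f = inverse_mor T \<phi> \<cdot> h"
      using X f unfolding F precomp_image_eq_iff by blast
    have "(\<phi> \<cdot> g) \<cdot> f = \<phi> \<cdot> (inverse_mor T \<phi> \<cdot> h)"
      using g iso by (simp add: Mor_iff)
    then have "(\<phi> \<cdot> g) \<cdot> f = h" using h iso by (simp add: Mor_iff)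
    moreover have "\<phi> \<cdot> g \<in> Mor T (trg T f) (trg T \<phi>)" using g(1) iso by (simp add: Mor_iff)
    ultimately show ?thesis by blast
  qed
  then show ?thesis unfolding F precomp_image_eq_iff by blast
qed

text \<open>
  The crux: for \<open>P\<close> rigid, \<open>F(P, Y) \<cong> DP \<otimes> Y\<close> lies in the ideal \<open>D\<close>, so \<open>x\<close> is killed by the name
  \<open>A \<rightarrow> A \<otimes> F(P, Y)\<close> of \<open>y\<close>, through which \<open>A \<otimes> y\<close> factors.
\<close>

lemma killed_swap:
  assumes D: "definable \<kappa> T D" "tensor_ideal T D" and P: "P \<in> rigids T"
    and x: "x \<in> Mor T (unit T) (A \<boxtimes> P)"
    and killed: "\<And>X a. \<lbrakk>X \<in> D; a \<in> Mor T A X\<rbrakk> \<Longrightarrow> (a \<diamondop> idn T P) \<cdot> x = zer T (unit T) (X \<boxtimes> P)"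
    and Y: "Y \<in> D" and y: "y \<in> Mor T P Y"
  shows "(idn T A \<diamondop> y) \<cdot> x = zer T (unit T) (A \<boxtimes> Y)"
proof -
  have "dualO T P \<boxtimes> Y \<in> D" using D(2) Y by (simp add: tensor_ideal_def)
  moreover have "is_iso T (rigid_map T P Y)" using P by (simp add: rigids_def)
  ultimately have "ihom T P Y \<in> D" using definable_iso_closed [OF D(1)] by fastforce
  then have X: "A \<boxtimes> ihom T P Y \<in> D" using D(2) by (simp add: tensor_ideal_def)
  obtain a b where a: "a \<in> Mor T A (A \<boxtimes> ihom T P Y)" and b: "src T b = (A \<boxtimes> ihom T P Y) \<boxtimes> P"
    and ab: "b \<cdot> (a \<diamondop> idn T P) = idn T A \<diamondop> y"
    using ten_factor_ihom [OF y, of A] by blast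
  have "trg T b = A \<boxtimes> Y"
    using arg_cong [OF ab, of "trg T"] a b y by (simp add: Mor_iff)
  have "(idn T A \<diamondop> y) \<cdot> x = b \<cdot> ((a \<diamondop> idn T P) \<cdot> x)"
    unfolding ab [symmetric] using a b x by (simp add: Mor_iff)
  also have "\<dots> = zer T (unit T) (A \<boxtimes> Y)"
    unfolding killed [OF X a] using b \<open>trg T b = A \<boxtimes> Y\<close> by simp
  finally show ?thesis .
qed

text \<open>Passing to elements over \<open>A\<close> and swapping factors puts the vanishing of
  \<open>m \<cdot> g\<close> into the form that \<open>killed_swap\<close> delivers.\<close>

lemma element_swap:
  assumes A: "A \<in> rigids T" and g: "g \<in> Mor T (dualO T A) P" and m: "m \<in> Mor T P Z"
  shows "m \<cdot> g = zer T (dualO T A) Z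
    \<longleftrightarrow> (idn T A \<diamondop> m) \<cdot> (swap T P A \<cdot> element A g) = zer T (unit T) (A \<boxtimes> Z)" (is "?l \<longleftrightarrow> ?r")
proof -
  have typing: "src T (element A g) = unit T" "trg T (element A g) = P \<boxtimes> A" "src T m = P" "trg T m = Z"
    using element_Mor [OF A g] m by (auto simp: Mor_iff)
  have "?l \<longleftrightarrow> element A (m \<cdot> g) = zer T (unit T) (Z \<boxtimes> A)"
    using element_eq_zer_iff [OF A cmp_Mor [OF g m]] by simp
  also have "\<dots> \<longleftrightarrow> (m \<diamondop> idn T A) \<cdot> element A g = zer T (unit T) (Z \<boxtimes> A)"
    using element_cmp [OF A g, of m] typing by simp
  also have "\<dots> \<longleftrightarrow> swap T Z A \<cdot> ((m \<diamondop> idn T A) \<cdot> element A g) = swap T Z A \<cdot> zer T (unit T) (Z \<boxtimes> A)"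
    using iso_cancel_left [OF is_iso_swap, of Z A "(m \<diamondop> idn T A) \<cdot> element A g" "zer T (unit T) (Z \<boxtimes> A)"] typing
    by auto
  also have "\<dots> \<longleftrightarrow> ?r" using typing by (simp add: swap_natural_cmp)
  finally show ?thesis .
qed

lemma subset_dual_definable:
  assumes D: "definable \<kappa> T D" "tensor_ideal T D" and Y: "Y \<in> D"
  shows "Y \<in> dual_definable \<kappa> T D"
proof -
  have "trivial_group (fobj (coker_Hom T k) Y)"
    if f: "f \<in> compact_maps \<kappa> T" and k: "k \<in> compact_maps \<kappa> T"
      and ann: "\<And>X. X \<in> D \<Longrightarrow> trivial_group (fobj (coker_Hom T f) X)"
      and iso: "nat_isomorphic \<kappa> T (delta \<kappa> T (coker_Hom T f)) (coker_Hom T k)" for f k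
  proof -
    let ?A = "src T f" and ?P = "src T k" and ?G = "coker_Hom T f" and ?H = "coker_Hom T k"
    let ?\<delta> = "delta \<kappa> T ?G"
    have cpt: "?A \<in> compacts \<kappa> T" "?P \<in> compacts \<kappa> T" using f k by (auto simp: compact_maps_def)
    note A = compact_rigid [OF cpt(1)] and P = compact_rigid [OF cpt(2)]
    obtain \<eta> where \<eta>: "nat_transformation \<kappa> T ?\<delta> ?H \<eta>"
        "\<And>C. C \<in> compacts \<kappa> T \<Longrightarrow> \<eta> C \<in> iso (fobj ?\<delta> C) (fobj ?H C)"
      using iso unfolding nat_isomorphic_def by blast
    have "coker_class k ?P (idn T ?P) \<in> carrier (fobj ?H ?P)" unfolding carrier_coker using idn_Mor
        by blast
    \<comment> \<open>The universal element of \<open>\<delta>G\<close>: by naturality,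
      \<open>\<eta>\<close> sends its image under a map \<open>u\<close> to the class of
      \<open>u\<close>.\<close>
    then obtain \<theta> where \<theta>: "\<theta> \<in> carrier (fobj ?\<delta> ?P)" "\<eta> ?P \<theta> = coker_class k ?P (idn T ?P)"
      using \<eta>(2) [OF cpt(2)] by (auto simp: iso_def bij_betw_def elim!: equalityE)
    note \<theta>' = \<theta>(1) [unfolded fobj_delta]
    let ?t = "yoneda f \<theta>"
    note t = yoneda_Mor [OF f \<theta>'] and ft = cmp_yoneda [OF f \<theta>']
    let ?x = "element ?P ?t"
    note x = element_Mor [OF P t]
    have killed: "(a \<diamondop> idn T ?P) \<cdot> ?x = zer T (unit T) (X \<boxtimes> ?P)" if X: "X \<in> D" and a: "a \<in> Mor T ?A X"
        for X a
    proof -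
      obtain g where g: "g \<in> Mor T (trg T f) X" "g \<cdot> f = a"
        using ann [OF X] a unfolding trivial_coker_iff precomp_image_eq_iff by blast
      have "a \<cdot> ?t = g \<cdot> (f \<cdot> ?t)"
        unfolding g(2) [symmetric] using g(1) t by (simp add: Mor_iff)
      then have "a \<cdot> ?t = zer T (dualO T ?P) X" using g(1) by (simp add: ft Mor_iff)
      then show ?thesis using element_cmp [OF P t, of a] a element_zer [OF P] by (simp add: Mor_iff)
    qed
    have "swap T ?A ?P \<cdot> ?x \<in> Mor T (unit T) (?P \<boxtimes> ?A)" using x by (simp add: Mor_iff)
    \<comment> \<open>\<open>g\<close> is the mate of \<open>?t\<close>: their elements differ only
      by the symmetry.\<close>
    then obtain g where g: "g \<in> Mor T (dualO T ?A) ?P" "element ?A g = swap T ?A ?P \<cdot> ?x"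
      using element_surj [OF A] by blast
    have gx: "swap T ?P ?A \<cdot> element ?A g = ?x" unfolding g(2) using x by (simp add: Mor_iff)
    \<comment> \<open>The cofibre of \<open>g\<close> is a weak cokernel with compact target, so
      \<open>\<eta>\<close> can be evaluated there.\<close>
    obtain u w where tri: "(g, u, w) \<in> triangles T" using triangle_ex by blast
    let ?C = "trg T u"
    have u: "u \<in> Mor T ?P ?C" using triangle_typing [OF tri] g(1) by (simp add: Mor_iff)
    have C: "?C \<in> compacts \<kappa> T"
      by (rule compacts_cone [OF tri])
        (use triangle_typing [OF tri] g(1) cpt compacts_sus [OF compacts_dual] in \<open>auto simp: Mor_iff\<close>)
    note rC = compact_rigid [OF C]
    have "u \<cdot> g = zer T (dualO T ?A) ?C" using triangle_cmp_zer [OF tri] g(1) by (simp add: Mor_iff)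
    \<comment> \<open>On elements, \<open>u \<cdot> g = 0\<close> says that
      \<open>A \<otimes> u\<close> kills \<open>?x\<close>, and by \<open>element_dualM\<close> this
      composite is the element of \<open>?t \<cdot> Du\<close>.\<close>
    then have "element ?C (?t \<cdot> dualM T u) = zer T (unit T) (?A \<boxtimes> ?C)"
      using element_swap [OF A g(1) u] element_dualM [OF P rC u t] by (simp add: gx)
    moreover have tDu: "?t \<cdot> dualM T u \<in> Mor T (dualO T ?C) ?A"
      using t u by (simp add: Mor_iff)
    ultimately have tDu0: "?t \<cdot> dualM T u = zer T (dualO T ?C) ?A"
      using element_eq_zer_iff [OF rC] by blast
    let ?\<theta>u = "fmor ?\<delta> u \<theta>"
    have \<theta>u: "?\<theta>u \<in> carrier (fobj ?\<delta> ?C)" by (rule delta_Mor [OF f u \<theta>(1)])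
    have "u \<in> compact_maps \<kappa> T" using u C cpt by (simp add: compact_maps_def Mor_iff)
    then have "\<eta> ?C ?\<theta>u = fmor ?H u (\<eta> ?P \<theta>)"
      using \<eta>(1) \<theta>(1) u unfolding nat_transformation_def by (simp add: Mor_iff)
    also have "\<dots> = coker_class k ?C u"
      unfolding \<theta>(2) fmor_coker [OF u idn_Mor] using u by (simp add: Mor_iff)
    finally have \<eta>u: "\<eta> ?C ?\<theta>u = coker_class k ?C u" .
    have \<eta>hom: "\<eta> ?C \<in> hom (fobj ?\<delta> ?C) (fobj ?H ?C)" using \<eta>(2) [OF C] by (simp add: iso_def)
    \<comment> \<open>The image of \<open>\<theta>\<close> at the cofibre has zero Yoneda map. Hence
      the class of \<open>u\<close> vanishes in the cokernel, which means that \<open>u\<close>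
      factors through \<open>k\<close>.\<close>
    have "?\<theta>u \<otimes>\<^bsub>fobj ?\<delta> ?C\<^esub> ?\<theta>u = ?\<theta>u"
      using yoneda_zer_idem [OF f \<theta>u [unfolded fobj_delta]] tDu0
          by (simp add: fobj_delta yoneda_delta [OF f])
    then have "coker_class k ?C u \<otimes>\<^bsub>fobj ?H ?C\<^esub> coker_class k ?C u = coker_class k ?C u"
      using hom_mult [OF \<eta>hom \<theta>u \<theta>u] by (simp add: \<eta>u)
    then have "coker_class k ?C u = precomp_image T k ?C"
      using group.r_cancel_one [OF group_coker [of k ?C], of "coker_class k ?C u" "coker_class k ?C u"] u
      by (simp add: one_coker carrier_coker)
    then obtain e where e: "e \<in> Mor T (trg T k) ?C" "u = e \<cdot> k"
      using coker_class_eq_image_iff [OF u] by (auto simp: precomp_image_def)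
    have "\<exists>h \<in> Mor T (trg T k) Y. h \<cdot> k = y" if y: "y \<in> Mor T ?P Y" for y
    proof -
      \<comment> \<open>The vanishing passes from maps out of \<open>A\<close> to the map
        \<open>y\<close> out of \<open>P\<close>. So \<open>y\<close> factors through
        \<open>u\<close>, and with it through \<open>k\<close>.\<close>
      have "y \<cdot> g = zer T (dualO T ?A) Y"
        unfolding element_swap [OF A g(1) y] gx by (rule killed_swap [OF D P x killed Y y])
      then obtain z where z: "z \<in> Mor T ?C Y" "z \<cdot> u = y"
        using triangle_weak_cokernel [OF tri, of y] g(1) y by (auto simp: Mor_iff)
      have "(z \<cdot> e) \<cdot> k = y" unfolding z(2) [symmetric] e(2) using z(1) e(1) by (simp add: Mor_iff)
      moreover have "z \<cdot> e \<in> Mor T (trg T k) Y" using e(1) z(1) by (rule cmp_Mor)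
      ultimately show ?thesis by blast
    qed
    then show ?thesis unfolding trivial_coker_iff precomp_image_eq_iff by blast
  qed
  then show ?thesis unfolding dual_definable_def annihilator_def fp_functors_def by blast
qed

lemma dual_definable_subset:
  assumes D: "definable \<kappa> T D" "tensor_ideal T D" and Y: "Y \<in> dual_definable \<kappa> T D"
  shows "Y \<in> D"
proof -
  obtain F where F: "F \<subseteq> compact_maps \<kappa> T" "D = {X. \<forall>f\<in>F. precomp_image T f X = Mor T (src T f) X}"
    using D(1) unfolding definable_def by blast
  have "trivial_group (fobj (coker_Hom T f) Y)" if fF: "f \<in> F" for f
  proof -
    have f: "f \<in> compact_maps \<kappa> T" using F(1) fF by blast
    let ?A = "src T f" and ?B = "trg T f"
    have cpt: "?A \<in> compacts \<kappa> T" "?B \<in> compacts \<kappa> T" using f by (auto simp: compact_maps_def)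
    note A = compact_rigid [OF cpt(1)] and B = compact_rigid [OF cpt(2)]
    \<comment> \<open>Here \<open>q\<close> takes the place of \<open>g\<close>, and
      \<open>f'\<close> presents the functor to be shown to vanish on \<open>D\<close>.\<close>
    obtain q f' where tri: "(dualM T f, q, f') \<in> triangles T" using triangle_ex by blast
    note typing = triangle_typing [OF tri]
    let ?E = "src T f'"
    have trg: "trg T f' \<in> compacts \<kappa> T"
      using typing compacts_sus [OF compacts_dual [OF cpt(2)]] by simp
    have E: "?E \<in> compacts \<kappa> T"
      using compacts_cone [OF tri _ trg] typing compacts_dual [OF cpt(1)] by simp
    have f': "f' \<in> compact_maps \<kappa> T" using E trg by (simp add: compact_maps_def)
    have q: "q \<in> Mor T (dualO T ?A) ?E" using typing by (simp add: Mor_iff)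
    let ?x = "swap T ?E ?A \<cdot> element ?A q"
    note el = element_Mor [OF A q]
    have x: "?x \<in> Mor T (unit T) (?A \<boxtimes> ?E)" using el by (simp add: Mor_iff)
    \<comment> \<open>Consecutive maps of the triangle compose to zero; on elements, precomposition
      with \<open>Df\<close> becomes \<open>E \<otimes> f\<close>, which the symmetry turns into
      \<open>f \<otimes> E\<close>.\<close>
    have fx: "(f \<diamondop> idn T ?E) \<cdot> ?x = zer T (unit T) (?B \<boxtimes> ?E)"
    proof -
      have "(f \<diamondop> idn T ?E) \<cdot> ?x = swap T ?E ?B \<cdot> ((idn T ?E \<diamondop> f) \<cdot> element ?A q)"
        using el by (simp add: swap_natural_cmp Mor_iff)
      also have "(idn T ?E \<diamondop> f) \<cdot> element ?A q = element ?B (q \<cdot> dualM T f)"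
        by (rule element_dualM [OF A B _ q, symmetric]) (simp add: Mor_iff)
      also have "\<dots> = zer T (unit T) (?E \<boxtimes> ?B)"
        using triangle_cmp_zer [OF tri] typing element_zer [OF B] by simp
      finally show ?thesis by simp
    qed
    have "precomp_image T f' X = Mor T ?E X" if X: "X \<in> D" for X
      unfolding precomp_image_eq_iff
    proof
      fix e assume e: "e \<in> Mor T ?E X"
      have "e \<cdot> q = zer T (dualO T ?A) X"
        unfolding element_swap [OF A q e]
      \<comment> \<open>Each \<open>a\<close> into an object of \<open>D\<close> extends along the
        defining map \<open>f\<close>, so it kills \<open>?x\<close> by \<open>fx\<close>.\<close>
      proof (rule killed_swap [OF D compact_rigid [OF E] x _ X e])
        fix X a assume X: "X \<in> D" and a: "a \<in> Mor T ?A X"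
        obtain g where g: "g \<in> Mor T ?B X" "g \<cdot> f = a"
          using X a fF unfolding F(2) precomp_image_eq_iff by blast
        have "(a \<diamondop> idn T ?E) \<cdot> ?x = (g \<diamondop> idn T ?E) \<cdot> ((f \<diamondop> idn T ?E) \<cdot> ?x)"
          using g x by (simp add: interchange Mor_iff)
        then show "(a \<diamondop> idn T ?E) \<cdot> ?x = zer T (unit T) (X \<boxtimes> ?E)"
          unfolding fx using g(1) by (simp add: Mor_iff)
      qed
      \<comment> \<open>After rotation, \<open>f'\<close> is a weak cokernel of
        \<open>q\<close>.\<close>
      then obtain g where "g \<in> Mor T (trg T f') X" "g \<cdot> f' = e"
        using triangle_weak_cokernel [OF triangle_rotateD [OF tri], of e] typing e
            by (auto simp: Mor_iff)
      then show "\<exists>g \<in> Mor T (trg T f') X. g \<cdot> f' = e" by blast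
    qed
    then have "coker_Hom T f' \<in> annihilator \<kappa> T D"
      using f' by (auto simp: annihilator_def fp_functors_def trivial_coker_iff)
    moreover have "coker_Hom T f \<in> fp_functors \<kappa> T" using f by (simp add: fp_functors_def)
    \<comment> \<open>By \<open>delta_coker\<close>, the cokernel of \<open>Hom(f, -)\<close>
      presents the dual of a functor annihilating \<open>D\<close>, so it must vanish at
      \<open>Y\<close>.\<close>
    ultimately show ?thesis
      using Y delta_coker [OF f f' tri] unfolding dual_definable_def by blast
  qed
  then show ?thesis unfolding F(2) by (simp add: trivial_coker_iff)
qed

end

theorem corollary8p8:
  fixes \<kappa> :: "'u rel"
    and T :: "('o, 'm) tt_cat"
    and R :: "'r ring"
    and gr :: "int \<Rightarrow> 'r set"
    and \<phi> :: "int \<Rightarrow> 'r \<Rightarrow> 'm"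
    and D :: "'o set"
  assumes "big_tt_category \<kappa> T"
    and "canonically_stratified \<kappa> T R gr \<phi>"
    and "definable \<kappa> T D"
    and "triangulated_subcategory T D"
    and "tensor_ideal T D"
  shows "D = dual_definable \<kappa> T D"
proof -
  interpret big_tt_category \<kappa> T by fact
  show ?thesis using subset_dual_definable dual_definable_subset assms(3,5) by blast
qed

end
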